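(* Let $\alpha\in(0,1)$, $T>0$, and let $\Omega\subset\mathbb R^d$ be a bounded Lipschitz domain. Assume that $u\in C^3((0,T],H_0^1(\Omega))$ is the solution to $$\partial_t^\alpha u=\Delta u+f\ \text{ in }(0,T]\times\Omega,\qquad u=0\ \text{ on }(0,T]\times\partial\Omega,\qquad u(0,\cdot)=u^0\ \text{ in }\Omega,$$ and that $|\partial_t^lu(t)|\le C_l(1+t^{\alpha-l})$ for $l=1,3$ and $0<t\le T$. If the nonuniform time mesh satisfies $\rho_k=\tau_k/\tau_{k-1}\in[\rho_{\rm L},\rho_{\rm R}]$ for $k\ge2$, where $\rho_{\rm R}=\frac{3+\sqrt{17}}2\approx3.561553$ and $\rho_{\rm L}\approx0.457333$ is the positive root of $\frac{\rho^2(1+\rho)}{1-3\rho^2(1+\rho)}=\rho_{\rm R}$, then the numerical solutions $u^k$ of the L2 scheme $$L_k^\alpha u=\Delta u^k+f^k\ \text{ in }\Omega,\qquad u^k=0\ \text{ on }\partial\Omega,\qquad f^k=f(t_k,\cdot),$$ started from $u^0$, have the following error estimate at the mesh points $t_n$: $$\|\nabla u(t_n)-\nabla u^n\|_{L^2(\Omega)}^2\le C\sum_{k=2}^n\tau_k^\alpha\left(\tau_1^\alpha(t_k-t_1)^{-\alpha}+\sum_{j=2}^{k-1}\tau_j^4(1+t_{j-1}^{\alpha-3})(t_k-t_j)^{-\alpha-1}+\tau_k^{3-\alpha}(1+t_{k-1}^{\alpha-3})\right)^2,$$ where $C$ is a constant depending on $\alpha$, $C_l$ ($l=1,3$) and 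$\Omega$.
   Context: $\partial_t^\alpha u(t)=\frac1{\Gamma(1-\alpha)}\int_0^t\frac{u'(s)}{(t-s)^\alpha}ds$ is the Caputo derivative. The time mesh on $[0,T]$ is $0=t_0<t_1<\cdots<t_N=T$, with $\tau_k=t_k-t_{k-1}$. L2 operator (applied to the sequence $u^0,u^1,\dots$): for $j\ge1$ let $H_2^j$ be the quadratic Lagrange polynomial in $t$ interpolating $u^{j-1},u^j,u^{j+1}$ at $t_{j-1},t_j,t_{j+1}$. Then $$L_1^\alpha u=\frac{u^1-u^0}{\Gamma(2-\alpha)\tau_1^\alpha},\qquad L_k^\alpha u=\frac1{\Gamma(1-\alpha)}\left(\sum_{j=1}^{k-1}\int_{t_{j-1}}^{t_j}\frac{\partial_sH_2^j(s)}{(t_k-s)^\alpha}ds+\int_{t_{k-1}}^{t_k}\frac{\partial_sH_2^{k-1}(s)}{(t_k-s)^\alpha}ds\right),\quad k\ge2.$$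
   Formalization: The estimate is stated for mesh points t_n with n ≥ 2; for n = 1 the sum on the right is empty and the claim would force ∇u(t_1) = ∇u^1, which fails e.g. for u = t²φ with φ a Dirichlet eigenfunction. *)

theory Defs
  imports "HOL-Analysis.Analysis"
begin

section \<open>The Hilbert space of square integrable functions\<close>

definition square_integrable :: "('a::euclidean_space \<Rightarrow> 'b::euclidean_space) \<Rightarrow> bool" where
  "square_integrable f \<longleftrightarrow> f \<in> borel_measurable lborel \<and> integrable lborel (\<lambda>x. (norm (f x))\<^sup>2)"

lemma square_integrable_zero: "square_integrable (\<lambda>x. 0)"
  by (simp add: square_integrable_def)

lemma square_integrable_scaleR:
  "square_integrable f \<Longrightarrow> square_integrable (\<lambda>x. c *\<^sub>R f x)"
  by (auto simp: square_integrable_def power_mult_distrib)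

lemma square_integrable_add:
  assumes "square_integrable f" "square_integrable g"
  shows "square_integrable (\<lambda>x. f x + g x)"
proof -
  have [measurable]: "f \<in> borel_measurable lborel" "g \<in> borel_measurable lborel"
    using assms by (auto simp: square_integrable_def)
  have le: "(norm (f x + g x))\<^sup>2 \<le> 2 * (norm (f x))\<^sup>2 + 2 * (norm (g x))\<^sup>2" for x
  proof -
    have "(norm (f x + g x))\<^sup>2 \<le> (norm (f x) + norm (g x))\<^sup>2"
      by (simp add: norm_triangle_ineq power_mono)
    also have "\<dots> \<le> 2 * (norm (f x))\<^sup>2 + 2 * (norm (g x))\<^sup>2"
      using zero_le_power2[of "norm (f x) - norm (g x)"]
      unfolding power2_sum power2_diff by linarith
    finally show ?thesis .
  qed
  have "integrable lborel (\<lambda>x. 2 * (norm (f x))\<^sup>2 + 2 * (norm (g x))\<^sup>2)"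
    using assms by (auto simp: square_integrable_def)
  then have "integrable lborel (\<lambda>x. (norm (f x + g x))\<^sup>2)"
    by (rule Bochner_Integration.integrable_bound) (use le in \<open>auto intro!: AE_I2\<close>)
  then show ?thesis by (simp add: square_integrable_def)
qed

lemma square_integrable_diff:
  assumes "square_integrable f" "square_integrable g"
  shows "square_integrable (\<lambda>x. f x - g x)"
  using square_integrable_add[OF assms(1) square_integrable_scaleR[OF assms(2), of "-1"]] by simp

lemma square_integrable_inner:
  assumes "square_integrable f" "square_integrable g"
  shows "integrable lborel (\<lambda>x. f x \<bullet> g x)"
proof -
  have [measurable]: "f \<in> borel_measurable lborel" "g \<in> borel_measurable lborel"
    using assms by (auto simp: square_integrable_def)
  have le: "\<bar>f x \<bullet> g x\<bar> \<le> (norm (f x))\<^sup>2 + (norm (g x))\<^sup>2" for x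
  proof -
    have "\<bar>f x \<bullet> g x\<bar> \<le> norm (f x) * norm (g x)"
      by (rule Cauchy_Schwarz_ineq2)
    also have "\<dots> \<le> (norm (f x))\<^sup>2 + (norm (g x))\<^sup>2"
      using sum_squares_bound[of "norm (f x)" "norm (g x)"]
        mult_nonneg_nonneg[OF norm_ge_zero[of "f x"] norm_ge_zero[of "g x"]] by linarith
    finally show ?thesis .
  qed
  have "integrable lborel (\<lambda>x. (norm (f x))\<^sup>2 + (norm (g x))\<^sup>2)"
    using assms by (auto simp: square_integrable_def)
  then show ?thesis
    by (rule Bochner_Integration.integrable_bound) (use le in \<open>auto intro!: AE_I2\<close>)
qed

text \<open>Square integrable functions on the whole space modulo equality almost everywhere.
  For a subset \<^term>\<open>\<Omega>\<close> the space $L^2(\Omega)$ is identified below with the subspace of elements vanishing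
  almost everywhere outside \<^term>\<open>\<Omega>\<close>, i.e. functions on \<^term>\<open>\<Omega>\<close> are extended by zero.\<close>

quotient_type (overloaded) ('a, 'b) l2 = "'a::euclidean_space \<Rightarrow> 'b::euclidean_space" / partial:
  "\<lambda>f g. square_integrable f \<and> square_integrable g \<and> (AE x in lborel. f x = g x)"
proof (rule part_equivpI)
  show "\<exists>f::'a \<Rightarrow> 'b. square_integrable f \<and> square_integrable f \<and> (AE x in lborel. f x = f x)"
    by (rule exI[of _ "\<lambda>x. 0"]) (simp add: square_integrable_zero)
  show "symp (\<lambda>f g::'a \<Rightarrow> 'b. square_integrable f \<and> square_integrable g \<and> (AE x in lborel. f x = g x))"
    by (auto simp: symp_def)
  show "transp (\<lambda>f g::'a \<Rightarrow> 'b. square_integrable f \<and> square_integrable g \<and> (AE x in lborel. f x = g x))"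
    unfolding transp_def
  proof (intro allI impI, elim conjE, intro conjI)
    fix f g h :: "'a \<Rightarrow> 'b"
    assume "AE x in lborel. f x = g x" "AE x in lborel. g x = h x"
    then show "AE x in lborel. f x = h x" by eventually_elim simp
  qed
qed

instantiation l2 :: (euclidean_space, euclidean_space) real_inner
begin

lift_definition zero_l2 :: "('a, 'b) l2" is "\<lambda>x. 0"
  by (simp add: square_integrable_zero)

lift_definition plus_l2 :: "('a, 'b) l2 \<Rightarrow> ('a, 'b) l2 \<Rightarrow> ('a, 'b) l2" is "\<lambda>f g x. f x + g x"
  by (auto simp: square_integrable_add)

lift_definition scaleR_l2 :: "real \<Rightarrow> ('a, 'b) l2 \<Rightarrow> ('a, 'b) l2" is "\<lambda>c f x. c *\<^sub>R f x"
  by (auto simp: square_integrable_scaleR)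

lift_definition uminus_l2 :: "('a, 'b) l2 \<Rightarrow> ('a, 'b) l2" is "\<lambda>f x. - f x"
  by (auto simp: square_integrable_def)

lift_definition minus_l2 :: "('a, 'b) l2 \<Rightarrow> ('a, 'b) l2 \<Rightarrow> ('a, 'b) l2" is "\<lambda>f g x. f x - g x"
  by (auto simp: square_integrable_diff)

lift_definition inner_l2 :: "('a, 'b) l2 \<Rightarrow> ('a, 'b) l2 \<Rightarrow> real" is
  "\<lambda>f g. LINT x|lborel. f x \<bullet> g x"
proof (elim conjE)
  fix f f' g g' :: "'a \<Rightarrow> 'b"
  assume "square_integrable f" "square_integrable f'" "square_integrable g" "square_integrable g'"
  then have [measurable]: "f \<in> borel_measurable lborel" "f' \<in> borel_measurable lborel"
      "g \<in> borel_measurable lborel" "g' \<in> borel_measurable lborel"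
    by (auto simp: square_integrable_def)
  assume "AE x in lborel. f x = f' x" "AE x in lborel. g x = g' x"
  then have "AE x in lborel. f x \<bullet> g x = f' x \<bullet> g' x" by eventually_elim simp
  then show "(LINT x|lborel. f x \<bullet> g x) = (LINT x|lborel. f' x \<bullet> g' x)"
    by (intro integral_cong_AE) auto
qed

definition norm_l2 :: "('a, 'b) l2 \<Rightarrow> real" where "norm_l2 f = sqrt (f \<bullet> f)"
definition dist_l2 :: "('a, 'b) l2 \<Rightarrow> ('a, 'b) l2 \<Rightarrow> real" where "dist_l2 f g = norm (f - g)"
definition sgn_l2 :: "('a, 'b) l2 \<Rightarrow> ('a, 'b) l2" where "sgn_l2 f = inverse (norm f) *\<^sub>R f"
definition uniformity_l2 :: "(('a, 'b) l2 \<times> ('a, 'b) l2) filter" where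
  "uniformity_l2 = (INF e\<in>{0 <..}. principal {(f, g). dist f g < e})"
definition open_l2 :: "('a, 'b) l2 set \<Rightarrow> bool" where
  "open_l2 S = (\<forall>f\<in>S. \<forall>\<^sub>F (f', g) in uniformity. f' = f \<longrightarrow> g \<in> S)"

instance
proof
  fix f g h :: "('a, 'b) l2" and a b :: real
  show "f + g + h = f + (g + h)"
    by transfer (auto simp: square_integrable_add add.assoc)
  show "f + g = g + f"
    by transfer (auto simp: square_integrable_add add.commute)
  show "0 + f = f"
    by transfer auto
  show "- f + f = 0"
    by transfer (auto simp: square_integrable_zero)
  show "f - g = f + - g"
    by transfer (auto simp: square_integrable_diff)
  show "a *\<^sub>R (f + g) = a *\<^sub>R f + a *\<^sub>R g"
    by transfer (auto simp: square_integrable_add square_integrable_scaleR scaleR_add_right)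
  show "(a + b) *\<^sub>R f = a *\<^sub>R f + b *\<^sub>R f"
    by transfer (auto simp: square_integrable_add square_integrable_add square_integrable_scaleR scaleR_add_left)
  show "a *\<^sub>R b *\<^sub>R f = (a * b) *\<^sub>R f"
    by transfer (auto simp: square_integrable_scaleR)
  show "1 *\<^sub>R f = f"
    by transfer auto
  show "dist f g = norm (f - g)" by (rule dist_l2_def)
  show "sgn f = inverse (norm f) *\<^sub>R f" by (rule sgn_l2_def)
  show "norm f = sqrt (f \<bullet> f)" by (rule norm_l2_def)
  show "(uniformity :: (('a, 'b) l2 \<times> ('a, 'b) l2) filter) =
      (INF e\<in>{0 <..}. principal {(f, g). dist f g < e})" by (rule uniformity_l2_def)
  show "open S = (\<forall>f\<in>S. \<forall>\<^sub>F (f', g) in uniformity. f' = f \<longrightarrow> g \<in> S)" for S :: "('a, 'b) l2 set"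
    by (rule open_l2_def)
  show "f \<bullet> g = g \<bullet> f"
    by transfer (simp add: inner_commute)
  show "(f + g) \<bullet> h = f \<bullet> h + g \<bullet> h"
    by transfer (simp add: inner_add_left square_integrable_inner)
  show "(a *\<^sub>R f) \<bullet> g = a * (f \<bullet> g)"
    by transfer simp
  show "0 \<le> f \<bullet> f"
    by transfer simp
  show "(f \<bullet> f = 0) = (f = 0)"
  proof (transfer, elim conjE)
    fix f :: "'a \<Rightarrow> 'b"
    assume f: "square_integrable f"
    have "(LINT x|lborel. f x \<bullet> f x) = 0 \<longleftrightarrow> (AE x in lborel. f x \<bullet> f x = 0)"
      by (rule integral_nonneg_eq_0_iff_AE) (auto simp: square_integrable_inner f)
    then show "((LINT x|lborel. f x \<bullet> f x) = 0) =
        (square_integrable f \<and> square_integrable (\<lambda>x. 0::'b) \<and> (AE x in lborel. f x = 0))"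
      using f by (simp add: square_integrable_zero)
  qed
qed

end


lift_definition to_l2 :: "('a::euclidean_space \<Rightarrow> 'b::euclidean_space) \<Rightarrow> ('a, 'b) l2" is
  "\<lambda>f. if square_integrable f then f else (\<lambda>x. 0)"
  by (auto simp: square_integrable_zero)

lemma AE_eq_cong:
  assumes "AE x in M. f x = g x"
  shows "(AE x in M. Q x (f x)) = (AE x in M. Q x (g x))"
  using assms by (intro iffI; elim AE_mp) (auto elim!: eventually_mono)

lift_definition vanishes_outside :: "'a set \<Rightarrow> ('a::euclidean_space, 'b::euclidean_space) l2 \<Rightarrow> bool" is
  "\<lambda>\<Omega> f. AE x in lborel. x \<notin> \<Omega> \<longrightarrow> f x = 0"
  by (elim conjE) (rule AE_eq_cong)

definition L2 :: "'a::euclidean_space set \<Rightarrow> ('a, 'b::euclidean_space) l2 set" where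
  "L2 \<Omega> = {f. vanishes_outside \<Omega> f}"

lift_definition ae_bounded :: "'a set \<Rightarrow> ('a::euclidean_space, 'b::euclidean_space) l2 \<Rightarrow> real \<Rightarrow> bool" is
  "\<lambda>\<Omega> f c. AE x in lborel. x \<in> \<Omega> \<longrightarrow> norm (f x) \<le> c"
  by (elim conjE) (intro ext AE_eq_cong)


section \<open>Lipschitz domains, test functions and Sobolev spaces\<close>

text \<open>Near each boundary point the domain is the strict epigraph of a Lipschitz function over the
  hyperplane orthogonal to a unit vector \<^term>\<open>e\<close>; \<^term>\<open>x - (x \<bullet> e) *\<^sub>R e\<close> is the projection of
  \<^term>\<open>x\<close> to that hyperplane.\<close>

definition bounded_lipschitz_domain :: "'a::euclidean_space set \<Rightarrow> bool" where
  "bounded_lipschitz_domain \<Omega> \<longleftrightarrow>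
     open \<Omega> \<and> connected \<Omega> \<and> \<Omega> \<noteq> {} \<and> bounded \<Omega> \<and>
     (\<forall>p\<in>frontier \<Omega>. \<exists>e U \<gamma> M. norm e = 1 \<and> open U \<and> p \<in> U \<and>
        M-lipschitz_on {y. y \<bullet> e = 0} (\<gamma> :: 'a \<Rightarrow> real) \<and>
        \<Omega> \<inter> U = {x \<in> U. \<gamma> (x - (x \<bullet> e) *\<^sub>R e) < x \<bullet> e})"

primrec Ck :: "nat \<Rightarrow> ('a::euclidean_space \<Rightarrow> real) \<Rightarrow> bool" where
  "Ck 0 \<phi> \<longleftrightarrow> continuous_on UNIV \<phi>"
| "Ck (Suc k) \<phi> \<longleftrightarrow> (\<forall>x. \<phi> differentiable (at x)) \<and> (\<forall>v. Ck k (\<lambda>x. frechet_derivative \<phi> (at x) v))"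

definition test_function :: "'a::euclidean_space set \<Rightarrow> ('a \<Rightarrow> real) \<Rightarrow> bool" where
  "test_function \<Omega> \<phi> \<longleftrightarrow>
     (\<forall>k. Ck k \<phi>) \<and> compact (closure {x. \<phi> x \<noteq> 0}) \<and> closure {x. \<phi> x \<noteq> 0} \<subseteq> \<Omega>"

definition gradient :: "('a::euclidean_space \<Rightarrow> real) \<Rightarrow> 'a \<Rightarrow> 'a" where
  "gradient \<phi> x = (\<Sum>b\<in>Basis. frechet_derivative \<phi> (at x) b *\<^sub>R b)"

text \<open>An element of $H^1(\Omega)$ is represented by the pair of the function and its weak gradient.
  The norm of the product type is then the $H^1$ norm
  $(\|v\|_{L^2}^2 + \|\nabla v\|_{L^2}^2)^{1/2}$, so that closures, limits and derivatives of curves with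
  respect to it are those of $H^1$.\<close>

type_synonym 'a sobolev = "('a, real) l2 \<times> ('a, 'a) l2"

abbreviation func :: "'a::euclidean_space sobolev \<Rightarrow> ('a, real) l2" where "func \<equiv> fst"
abbreviation grad :: "'a::euclidean_space sobolev \<Rightarrow> ('a, 'a) l2" where "grad \<equiv> snd"

definition H1 :: "'a::euclidean_space set \<Rightarrow> 'a sobolev set" where
  "H1 \<Omega> = {(v, g). v \<in> L2 \<Omega> \<and> g \<in> L2 \<Omega> \<and>
     (\<forall>\<phi> b. test_function \<Omega> \<phi> \<longrightarrow> b \<in> Basis \<longrightarrow>
        v \<bullet> to_l2 (\<lambda>x. frechet_derivative \<phi> (at x) b) = - (g \<bullet> to_l2 (\<lambda>x. \<phi> x *\<^sub>R b)))}"

definition H10 :: "'a::euclidean_space set \<Rightarrow> 'a sobolev set" where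
  "H10 \<Omega> = H1 \<Omega> \<inter> closure {(to_l2 \<phi>, to_l2 (gradient \<phi>)) |\<phi>. test_function \<Omega> \<phi>}"

definition locally_integrable :: "'a::euclidean_space set \<Rightarrow> ('a \<Rightarrow> real) \<Rightarrow> bool" where
  "locally_integrable \<Omega> F \<longleftrightarrow> (\<forall>K. compact K \<and> K \<subseteq> \<Omega> \<longrightarrow> set_integrable lborel K F)"

text \<open>The equation $w = \Delta v + F$ in \<^term>\<open>\<Omega>\<close>, in the sense of distributions.\<close>

definition eq_laplacian_plus ::
    "'a::euclidean_space set \<Rightarrow> ('a, real) l2 \<Rightarrow> 'a sobolev \<Rightarrow> ('a \<Rightarrow> real) \<Rightarrow> bool" where
  "eq_laplacian_plus \<Omega> w v F \<longleftrightarrow>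
     (\<forall>\<phi>. test_function \<Omega> \<phi> \<longrightarrow>
        w \<bullet> to_l2 \<phi> = - (grad v \<bullet> to_l2 (gradient \<phi>)) + (LINT x:\<Omega>|lborel. F x * \<phi> x))"


section \<open>Time derivatives and the subdiffusion problem\<close>

definition Dt :: "real set \<Rightarrow> nat \<Rightarrow> (real \<Rightarrow> 'b::real_normed_vector) \<Rightarrow> real \<Rightarrow> 'b" where
  "Dt S l u = ((\<lambda>w t. vector_derivative w (at t within S)) ^^ l) u"

definition Ck_curve :: "nat \<Rightarrow> real set \<Rightarrow> (real \<Rightarrow> 'b::real_normed_vector) \<Rightarrow> bool" where
  "Ck_curve k S u \<longleftrightarrow> (\<forall>l<k. Dt S l u differentiable_on S) \<and> continuous_on S (Dt S k u)"

definition has_caputo_derivative ::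
    "real \<Rightarrow> (real \<Rightarrow> 'b::real_normed_vector) \<Rightarrow> 'b \<Rightarrow> real \<Rightarrow> bool" where
  "has_caputo_derivative \<alpha> w D t \<longleftrightarrow>
     (\<exists>I. ((\<lambda>s. (t - s) powr (-\<alpha>) *\<^sub>R vector_derivative w (at s)) has_integral I) {0..t} \<and>
          D = (1 / Gamma (1 - \<alpha>)) *\<^sub>R I)"

text \<open>The homogeneous Dirichlet condition is the membership in $H^1_0(\Omega)$ for positive times.
  The initial value is attained in $L^2(\Omega)$; accordingly the Caputo derivative is the one of the
  $L^2(\Omega)$-valued curve, and \<^term>\<open>grad (u 0)\<close> is left unspecified.\<close>

definition subdiffusion_solution ::
    "real \<Rightarrow> real \<Rightarrow> 'a::euclidean_space set \<Rightarrow> (real \<Rightarrow> 'a \<Rightarrow> real) \<Rightarrow> ('a, real) l2 \<Rightarrow>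
     (real \<Rightarrow> 'a sobolev) \<Rightarrow> bool" where
  "subdiffusion_solution \<alpha> T \<Omega> f u0 u \<longleftrightarrow>
     (\<forall>t\<in>{0<..T}. u t \<in> H10 \<Omega>) \<and> Ck_curve 3 {0<..T} u \<and>
     u0 \<in> L2 \<Omega> \<and> func (u 0) = u0 \<and> continuous_on {0..T} (\<lambda>t. func (u t)) \<and>
     (\<forall>t\<in>{0<..T}. locally_integrable \<Omega> (f t) \<and>
        (\<exists>D. has_caputo_derivative \<alpha> (\<lambda>s. func (u s)) D t \<and> eq_laplacian_plus \<Omega> D (u t) (f t)))"


section \<open>The L2 scheme\<close>

definition time_mesh :: "real \<Rightarrow> nat \<Rightarrow> (nat \<Rightarrow> real) \<Rightarrow> bool" where
  "time_mesh T N t \<longleftrightarrow> t 0 = 0 \<and> t N = T \<and> (\<forall>k<N. t k < t (Suc k))"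

definition step :: "(nat \<Rightarrow> real) \<Rightarrow> nat \<Rightarrow> real" where
  "step t k = t k - t (k - 1)"

definition lagrange2 :: "(nat \<Rightarrow> real) \<Rightarrow> (nat \<Rightarrow> 'b::real_normed_vector) \<Rightarrow> nat \<Rightarrow> real \<Rightarrow> 'b" where
  "lagrange2 t v j s =
     (((s - t j) * (s - t (j + 1))) / ((t (j - 1) - t j) * (t (j - 1) - t (j + 1)))) *\<^sub>R v (j - 1) +
     (((s - t (j - 1)) * (s - t (j + 1))) / ((t j - t (j - 1)) * (t j - t (j + 1)))) *\<^sub>R v j +
     (((s - t (j - 1)) * (s - t j)) / ((t (j + 1) - t (j - 1)) * (t (j + 1) - t j))) *\<^sub>R v (j + 1)"

definition L2_operator ::
    "real \<Rightarrow> (nat \<Rightarrow> real) \<Rightarrow> (nat \<Rightarrow> 'b::real_normed_vector) \<Rightarrow> nat \<Rightarrow> 'b" where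
  "L2_operator \<alpha> t v k =
     (if k = 1 then (1 / (Gamma (2 - \<alpha>) * step t 1 powr \<alpha>)) *\<^sub>R (v 1 - v 0)
      else (1 / Gamma (1 - \<alpha>)) *\<^sub>R
        ((\<Sum>j=1..k-1. integral {t (j - 1)..t j}
            (\<lambda>s. (t k - s) powr (-\<alpha>) *\<^sub>R vector_derivative (lagrange2 t v j) (at s))) +
         integral {t (k - 1)..t k}
            (\<lambda>s. (t k - s) powr (-\<alpha>) *\<^sub>R vector_derivative (lagrange2 t v (k - 1)) (at s))))"

definition L2_scheme_solution ::
    "real \<Rightarrow> 'a::euclidean_space set \<Rightarrow> (real \<Rightarrow> 'a \<Rightarrow> real) \<Rightarrow> (nat \<Rightarrow> real) \<Rightarrow> nat \<Rightarrow>
     ('a, real) l2 \<Rightarrow> (nat \<Rightarrow> 'a sobolev) \<Rightarrow> bool" where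
  "L2_scheme_solution \<alpha> \<Omega> f t N u0 U \<longleftrightarrow>
     func (U 0) = u0 \<and>
     (\<forall>k\<in>{1..N}. U k \<in> H10 \<Omega> \<and>
        eq_laplacian_plus \<Omega> (L2_operator \<alpha> t (\<lambda>i. func (U i)) k) (U k) (f (t k)))"

definition rho_R :: real where
  "rho_R = (3 + sqrt 17) / 2"

definition rho_L :: real where
  "rho_L = (THE \<rho>. 0 < \<rho> \<and> \<rho>\<^sup>2 * (1 + \<rho>) / (1 - 3 * (\<rho>\<^sup>2 * (1 + \<rho>))) = rho_R)"

lemma rho_L_ex1: "\<exists>!\<rho>::real. 0 < \<rho> \<and> \<rho>\<^sup>2 * (1 + \<rho>) / (1 - 3 * (\<rho>\<^sup>2 * (1 + \<rho>))) = rho_R"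
proof -
  have R: "0 < rho_R" by (simp add: rho_R_def add_pos_nonneg)
  define c where "c = rho_R / (1 + 3 * rho_R)"
  have c: "0 < c" "c < 1" using R by (auto simp: c_def)
  have iff: "y / (1 - 3 * y) = rho_R \<longleftrightarrow> y = c" for y :: real
  proof (cases "1 - 3 * y = 0")
    case True
    then have "y = 1 / 3" by simp
    then show ?thesis using R by (auto simp: c_def field_simps)
  next
    case False
    then show ?thesis using R by (auto simp: c_def divide_simps) (auto simp: algebra_simps)
  qed
  have mono: "x\<^sup>2 * (1 + x) < y\<^sup>2 * (1 + y)" if "0 < x" "x < y" for x y :: real
    using that by (intro mult_strict_mono power_strict_mono) auto
  have "\<exists>x\<ge>0. x \<le> 1 \<and> x\<^sup>2 * (1 + x) = c"
    by (rule IVT[where f = "\<lambda>x::real. x\<^sup>2 * (1 + x)" and a = 0 and b = 1])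
       (use c in \<open>auto intro!: continuous_intros\<close>)
  then obtain x where x: "0 \<le> x" "x\<^sup>2 * (1 + x) = c" by auto
  with c have "0 < x" by (cases "x = 0") auto
  show ?thesis
    unfolding iff
  proof (rule ex1I[of _ x])
    show "0 < x \<and> x\<^sup>2 * (1 + x) = c" using x \<open>0 < x\<close> by simp
    fix y :: real assume "0 < y \<and> y\<^sup>2 * (1 + y) = c"
    then show "y = x" using mono[of x y] mono[of y x] \<open>0 < x\<close> x by (cases x y rule: linorder_cases) auto
  qed
qed

end

theory Submission
  imports Defs
begin

text \<open>The error is tested with its own increments. Write $e^k$ for the nodal error, $\delta^k = e^k - e^{k-1}$ (with
$e^0 = 0$), $\tau_k$ for the step sizes, $\rho_k = \tau_k/\tau_{k-1}$, and $R^k$ for the truncation error of the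
L2 operator along the exact solution. The source term cancels in the difference of the two weak equations, which
extends from test functions to $H^1_0$ (lemma \<open>weak_equation_on_H10\<close>), so that
$\langle L_k e - R^k, \delta^k\rangle = -\langle\nabla e^k, \nabla\delta^k\rangle$. Summing over $k$, the right-hand side
telescopes to at most $-\|\nabla e^n\|^2/2$. If $\sum_k \langle L_k e, \delta^k\rangle$ dominates
$c \sum_k \tau_k^{-\alpha}\|\delta^k\|^2$, then Young's inequality leaves
$\|\nabla e^n\|^2 \le C \sum_k \tau_k^\alpha F_k^2$ for any bounds $|\langle R^k, \delta^k\rangle| \le F_k \|\delta^k\|$
(theorem \<open>energy_estimate\<close>).

\<^bold>\<open>Coercivity\<close> (theorem \<open>L2_operator_coercive\<close>). Up to the factor $\Gamma(1-\alpha)$, the coefficient of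
$\delta^j$ in $L_k$ for $j < k$ is an average of the kernel $(t_k-s)^{-\alpha}$ over the intervals number $j-1$ and $j$,
except for one negative contribution to $\delta^{k-1}$ that comes from the last interval. The averages form a
lower triangular matrix whose quadratic form is controlled by Abel summation (lemma
\<open>quadratic_form_lower_bound\<close>) once neighbouring averages are ordered for all increasing convex kernels
(lemma \<open>wavg_mono\<close>); this is the ordering that needs
$1/(\rho_k^2(1+\rho_k)) \le 3 + 1/\rho_{k+1}$, and \<open>rho_L\<close> is the smallest lower bound of the ratios that
guarantees it when they may be as large as \<open>rho_R\<close>. The diagonal entry of the matrix is free, and the smallest admissible one is much
smaller than the true diagonal of $L_k$. The difference absorbs the negative contribution of the last interval, which for
$\alpha \to 1$ is the one of the variable step BDF2 formula (lemma \<open>diagonal_margin\<close>).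

\<^bold>\<open>Truncation\<close> (theorem \<open>truncation_error_bound\<close>). Only scalar functions $\langle u(s), w\rangle$ with a fixed
$w$ in $L^2$ have to be treated. On a history interval the interpolation error vanishes at both end points, so its
derivative has mean zero and only the increment of the kernel over the interval counts; this produces the powers
$\tau_j^4 (t_k-t_j)^{-\alpha-1}$. On the first interval the third derivative is not integrable and the bound for the first
derivative is used instead. The error of the first step, which is absent from the sum in the theorem,
is at most of the order of the contribution of the second step (lemma \<open>first_step_absorbed\<close>).\<close>

section \<open>The admissible step ratios\<close>

lemma rho_R_bounds: "3.5615 \<le> rho_R" "rho_R \<le> 3.5616"
proof -
  have "4.123 \<le> sqrt 17" by (rule real_le_rsqrt) (simp add: power2_eq_square)
  then show "3.5615 \<le> rho_R" by (simp add: rho_R_def)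
  have "sqrt 17 \<le> 4.1232" by (rule real_le_lsqrt) (simp_all add: power2_eq_square)
  then show "rho_R \<le> 3.5616" by (simp add: rho_R_def)
qed

lemma rho_L_pos: "0 < rho_L"
  and rho_L_eq: "rho_L\<^sup>2 * (1 + rho_L) * (1 + 3 * rho_R) = rho_R"
proof -
  have *: "0 < rho_L \<and> rho_L\<^sup>2 * (1 + rho_L) / (1 - 3 * (rho_L\<^sup>2 * (1 + rho_L))) = rho_R"
    unfolding rho_L_def by (rule theI'[OF rho_L_ex1])
  then show "0 < rho_L" by simp
  define c where "c = rho_L\<^sup>2 * (1 + rho_L)"
  have c: "c / (1 - 3 * c) = rho_R" using * by (simp add: c_def)
  then have "1 - 3 * c \<noteq> 0" using rho_R_bounds by auto
  then have "c * (1 + 3 * rho_R) = rho_R" using c by (simp add: field_simps)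
  then show "rho_L\<^sup>2 * (1 + rho_L) * (1 + 3 * rho_R) = rho_R" by (simp add: c_def)
qed

lemma cubic_mono: "0 \<le> x \<Longrightarrow> x \<le> y \<Longrightarrow> x\<^sup>2 * (1 + x) \<le> y\<^sup>2 * (1 + (y::real))"
  by (intro mult_mono power_mono) auto

lemma rho_L_bounds: "0.457 \<le> rho_L" "rho_L \<le> 1"
proof -
  have e: "rho_L\<^sup>2 * (1 + rho_L) = rho_R / (1 + 3 * rho_R)"
    using rho_L_eq rho_R_bounds by (simp add: field_simps)
  show "0.457 \<le> rho_L"
  proof (rule ccontr)
    assume "\<not> ?thesis"
    then have "rho_L\<^sup>2 * (1 + rho_L) \<le> 0.457\<^sup>2 * (1 + 0.457)"
      using rho_L_pos by (intro cubic_mono) auto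
    moreover have "0.3045 \<le> rho_R / (1 + 3 * rho_R)"
      using rho_R_bounds by (simp add: field_simps)
    ultimately show False using e by (simp add: power2_eq_square)
  qed
  show "rho_L \<le> 1"
  proof (rule ccontr)
    assume "\<not> ?thesis"
    then have "1\<^sup>2 * (1 + 1) \<le> rho_L\<^sup>2 * (1 + rho_L)"
      by (intro cubic_mono) auto
    moreover have "rho_R / (1 + 3 * rho_R) \<le> 1"
      using rho_R_bounds by (simp add: field_simps)
    ultimately show False using e by (simp add: power2_eq_square)
  qed
qed

text \<open>The worst case is \<open>\<rho> = rho_L\<close> and \<open>r = rho_R\<close>, where the defining equation of \<open>rho_L\<close> turns the inequality into an
equality.\<close>

lemma ratio_condition:
  assumes "rho_L \<le> \<rho>" "0 < r" "r \<le> rho_R"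
  shows "1 / (\<rho>\<^sup>2 * (1 + \<rho>)) \<le> 3 + 1 / r"
proof -
  have pos: "0 < \<rho>\<^sup>2 * (1 + \<rho>)" using assms rho_L_pos by (intro mult_pos_pos) auto
  have "rho_L\<^sup>2 * (1 + rho_L) \<le> \<rho>\<^sup>2 * (1 + \<rho>)"
    using assms rho_L_pos by (intro cubic_mono) auto
  moreover have "rho_L\<^sup>2 * (1 + rho_L) = rho_R / (1 + 3 * rho_R)"
    using rho_L_eq rho_R_bounds by (simp add: field_simps)
  ultimately have "1 / (\<rho>\<^sup>2 * (1 + \<rho>)) \<le> 1 / (rho_R / (1 + 3 * rho_R))"
    using rho_R_bounds pos by (intro divide_left_mono) (auto intro!: mult_pos_pos divide_pos_pos)
  also have "\<dots> = 3 + 1 / rho_R" using rho_R_bounds by (simp add: field_simps)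
  also have "\<dots> \<le> 3 + 1 / r" using assms by (simp add: frac_le)
  finally show ?thesis .
qed

section \<open>A quadratic form bounded by summation by parts\<close>

text \<open>A summation by parts in the spirit of Lopez-Marcos. The column differences $b_p$ of row $n+1$ are the weights of the
tail sums $S_p = x_p + \dots + x_n$, both in the bound for $n$ and, since that row is their partial sum, in the new mixed
terms $\sum_p b_p \langle S_p, x_{n+1}\rangle$. Completing squares replaces $S_p$ by $S_p + x_{n+1}$, and \<open>dec\<close> lets the weights
pass to the next row. The diagonal enters with half of its weight only, which is why it pays to choose it small.\<close>

lemma quadratic_form_lower_bound:
  fixes a :: "nat \<Rightarrow> nat \<Rightarrow> real" and x :: "nat \<Rightarrow> 'v::real_inner"
  assumes a0: "\<And>q. a q 0 = 0"
    and dec: "\<And>p q. 1 \<le> p \<Longrightarrow> p \<le> q \<Longrightarrow> q \<le> n \<Longrightarrow>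
      a (Suc q) p - a (Suc q) (p - 1) \<le> a q p - a q (p - 1)"
  shows "(\<Sum>p=1..n. (a (Suc n) p - a (Suc n) (p - 1)) * (norm (\<Sum>i=p..n. x i))\<^sup>2) / 2
    \<le> (\<Sum>k=1..n. (\<Sum>j=1..k. a k j * (x j \<bullet> x k)) - a k k / 2 * (norm (x k))\<^sup>2)"
  using dec
proof (induction n)
  case 0
  then show ?case by simp
next
  case (Suc n)
  define b where "b p = a (Suc n) p - a (Suc n) (p - 1)" for p
  define S where "S p m = (\<Sum>i=p..m. x i)" for p m
  have tele: "a (Suc n) j = (\<Sum>p=1..j. b p)" for j
    by (induction j) (auto simp: a0 b_def)
  have swap: "(\<Sum>j=1..m. a (Suc n) j * (x j \<bullet> y)) = (\<Sum>p=1..m. b p * (S p m \<bullet> y))" for m y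
  proof (induction m)
    case (Suc m)
    have "(\<Sum>p=1..Suc m. b p * (S p (Suc m) \<bullet> y))
        = (\<Sum>p=1..m. b p * (S p m \<bullet> y)) + (\<Sum>p=1..Suc m. b p) * (x (Suc m) \<bullet> y)"
      by (simp add: S_def inner_add_left distrib_left distrib_right sum.distrib sum_distrib_right)
    then show ?case using Suc tele[of "Suc m"] by simp
  qed simp
  have IH: "(\<Sum>p=1..n. b p * (norm (S p n))\<^sup>2) / 2
    \<le> (\<Sum>k=1..n. (\<Sum>j=1..k. a k j * (x j \<bullet> x k)) - a k k / 2 * (norm (x k))\<^sup>2)"
    using Suc.IH Suc.prems by (simp add: b_def S_def)
  let ?y = "x (Suc n)"
  have "(\<Sum>p=1..Suc n. (a (Suc (Suc n)) p - a (Suc (Suc n)) (p - 1)) * (norm (S p (Suc n)))\<^sup>2)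
      \<le> (\<Sum>p=1..Suc n. b p * (norm (S p (Suc n)))\<^sup>2)"
    unfolding b_def by (intro sum_mono mult_right_mono Suc.prems) auto
  also have "\<dots> = (\<Sum>p=1..n. b p * (norm (S p n))\<^sup>2) + 2 * (\<Sum>p=1..n. b p * (S p n \<bullet> ?y))
      + (\<Sum>p=1..Suc n. b p) * (norm ?y)\<^sup>2"
  proof -
    have 1: "(norm (S p (Suc n)))\<^sup>2 = (norm (S p n))\<^sup>2 + 2 * (S p n \<bullet> ?y) + (norm ?y)\<^sup>2"
      if "p \<le> Suc n" for p
      using that by (simp add: S_def power2_norm_eq_inner inner_add_left inner_add_right inner_commute)
    have "(\<Sum>p=1..n. b p * (norm (S p (Suc n)))\<^sup>2) = (\<Sum>p=1..n. b p * (norm (S p n))\<^sup>2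
       + 2 * (b p * (S p n \<bullet> ?y)) + b p * (norm ?y)\<^sup>2)"
      by (intro sum.cong refl) (auto simp: 1 algebra_simps)
    then show ?thesis
      by (simp add: sum.distrib sum_distrib_left sum_distrib_right distrib_right)
         (simp add: S_def)
  qed
  also have "\<dots> / 2 = (\<Sum>p=1..n. b p * (norm (S p n))\<^sup>2) / 2 + (\<Sum>j=1..n. a (Suc n) j * (x j \<bullet> ?y))
      + a (Suc n) (Suc n) / 2 * (norm ?y)\<^sup>2"
    unfolding swap tele[of "Suc n"] by (simp add: add_divide_distrib)
  also have "\<dots> \<le> (\<Sum>k=1..n. (\<Sum>j=1..k. a k j * (x j \<bullet> x k)) - a k k / 2 * (norm (x k))\<^sup>2)
      + (\<Sum>j=1..n. a (Suc n) j * (x j \<bullet> ?y)) + a (Suc n) (Suc n) / 2 * (norm ?y)\<^sup>2"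
    using IH by simp
  also have "\<dots> = (\<Sum>k=1..Suc n. (\<Sum>j=1..k. a k j * (x j \<bullet> x k)) - a k k / 2 * (norm (x k))\<^sup>2)"
    by (simp add: power2_norm_eq_inner)
  finally show ?case by (simp add: S_def divide_right_mono)
qed

section \<open>Convex kernels on an interval\<close>

lemma tau_ratio_condition:
  assumes "0 < x" "0 < y" "rho_L \<le> y / x" "0 < r" "r \<le> rho_R"
  shows "x ^ 3 / ((x + y) * y) \<le> y * (3 + 1 / r)"
proof -
  have "x ^ 3 / ((x + y) * y) = y * (1 / ((y / x)\<^sup>2 * (1 + y / x)))"
    using assms by (simp add: divide_simps) (simp add: power2_eq_square power3_eq_cube algebra_simps)
  also have "\<dots> \<le> y * (3 + 1 / r)"
    using ratio_condition[of "y / x" r] assms by (intro mult_left_mono) auto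
  finally show ?thesis .
qed

lemma has_integral_antiderivative:
  fixes f F :: "real \<Rightarrow> real"
  assumes "a \<le> b" "\<And>s. (F has_real_derivative f s) (at s)"
  shows "(f has_integral (F b - F a)) {a..b}"
  by (rule fundamental_theorem_of_calculus)
     (use assms in \<open>auto simp flip: has_real_derivative_iff_has_vector_derivative intro: DERIV_subset\<close>)

lemma has_integral_centred: "a \<le> b \<Longrightarrow> ((\<lambda>s. 2 * s - a - b) has_integral 0) {a..b::real}"
proof -
  assume "a \<le> b"
  then have "((\<lambda>s. 2 * s - a - b) has_integral ((b - a) * (b - b) - (a - a) * (a - b))) {a..b}"
    by (rule has_integral_antiderivative) (auto intro!: derivative_eq_intros)
  then show ?thesis by simp
qed

lemma has_integral_centred_id:
  "a \<le> b \<Longrightarrow> ((\<lambda>s. (2 * s - a - b) * s) has_integral ((b - a) ^ 3 / 6)) {a..b::real}"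
proof -
  assume "a \<le> b"
  then have "((\<lambda>s. (2 * s - a - b) * s) has_integral
      ((2 * b ^ 3 / 3 - (a + b) * b\<^sup>2 / 2) - (2 * a ^ 3 / 3 - (a + b) * a\<^sup>2 / 2))) {a..b}"
    by (rule has_integral_antiderivative)
       (auto intro!: derivative_eq_intros simp: power2_eq_square algebra_simps)
  also have "(2 * b ^ 3 / 3 - (a + b) * b\<^sup>2 / 2) - (2 * a ^ 3 / 3 - (a + b) * a\<^sup>2 / 2) = (b - a) ^ 3 / 6"
    by (simp add: power2_eq_square power3_eq_cube field_simps)
  finally show ?thesis .
qed

lemma has_integral_from_right: "a \<le> b \<Longrightarrow> ((\<lambda>s. b - s) has_integral ((b - a)\<^sup>2 / 2)) {a..b::real}"
proof -
  assume "a \<le> b"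
  then have "((\<lambda>s. b - s) has_integral ((- (b - b)\<^sup>2 / 2) - (- (b - a)\<^sup>2 / 2))) {a..b}"
    by (rule has_integral_antiderivative) (auto intro!: derivative_eq_intros simp: field_simps)
  then show ?thesis by simp
qed

lemma has_integral_from_left: "a \<le> b \<Longrightarrow> ((\<lambda>s. s - a) has_integral ((b - a)\<^sup>2 / 2)) {a..b::real}"
proof -
  assume "a \<le> b"
  then have "((\<lambda>s. s - a) has_integral (((b - a)\<^sup>2 / 2) - ((a - a)\<^sup>2 / 2))) {a..b}"
    by (rule has_integral_antiderivative) (auto intro!: derivative_eq_intros)
  then show ?thesis by simp
qed

text \<open>Twice the first moment about the midpoint: it weights the second difference in the derivative of a quadratic
interpolant.\<close>

definition moment :: "(real \<Rightarrow> real) \<Rightarrow> real \<Rightarrow> real \<Rightarrow> real" where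
  "moment K a b = integral {a..b} (\<lambda>s. (2 * s - a - b) * K s)"

lemma moment_integrable:
  "continuous_on {a..b} K \<Longrightarrow> (\<lambda>s. (2 * s - a - b) * K s) integrable_on {a..b::real}"
  by (intro integrable_continuous_interval continuous_intros)

lemma moment_diff:
  assumes "continuous_on {a..b} K" "continuous_on {a..b} L"
  shows "moment (\<lambda>s. K s - L s) a b = moment K a b - moment L a b"
  unfolding moment_def right_diff_distrib
  by (rule integral_diff) (use assms moment_integrable in blast)+

lemma moment_linear: "a \<le> b \<Longrightarrow> moment (\<lambda>s. m * s) a b = m * (b - a) ^ 3 / 6"
  using has_integral_mult_right[OF has_integral_centred_id, of a b m]
  unfolding moment_def by (auto dest!: integral_unique simp: mult_ac)

text \<open>Chebyshev's inequality: subtracting the value of \<open>K\<close> at the midpoint does not change the integral and makes both factors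
change sign there.\<close>

lemma moment_nonneg:
  assumes ab: "a \<le> b" and K: "continuous_on {a..b} K" "mono_on {a..b} K"
  shows "0 \<le> moment K a b"
proof -
  define c where "c = (a + b) / 2"
  have c: "c \<in> {a..b}" using ab by (simp add: c_def)
  have *: "((\<lambda>s. (2 * s - a - b) * K s - K c * (2 * s - a - b)) has_integral (moment K a b - K c * 0)) {a..b}"
    unfolding moment_def
    by (intro has_integral_diff integrable_integral moment_integrable K has_integral_mult_right
        has_integral_centred ab)
  have "0 \<le> (2 * s - a - b) * K s - K c * (2 * s - a - b)" if s: "s \<in> {a..b}" for s
  proof (cases "s \<le> c")
    case True
    then have "K s \<le> K c" using s c by (intro mono_onD[OF K(2)]) auto
    moreover have "2 * s - a - b \<le> 0" using True by (simp add: c_def)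
    ultimately have "0 \<le> (2 * s - a - b) * (K s - K c)" by (intro mult_nonpos_nonpos) auto
    then show ?thesis by (simp add: algebra_simps)
  next
    case False
    then have "K c \<le> K s" using s c False by (intro mono_onD[OF K(2)]) auto
    moreover have "0 \<le> 2 * s - a - b" using False by (simp add: c_def)
    ultimately have "0 \<le> (2 * s - a - b) * (K s - K c)" by (intro mult_nonneg_nonneg) auto
    then show ?thesis by (simp add: algebra_simps)
  qed
  from has_integral_nonneg[OF * this] show ?thesis by simp
qed

lemma moment_mono:
  assumes "a \<le> b" "continuous_on {a..b} K" "continuous_on {a..b} L" "mono_on {a..b} (\<lambda>s. K s - L s)"
  shows "moment L a b \<le> moment K a b"
  using moment_nonneg[of a b "\<lambda>s. K s - L s"] moment_diff[of a b K L] assms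
  by (simp add: continuous_on_diff)

lemma average_le:
  "0 < y \<Longrightarrow> x \<le> y * k - m * y\<^sup>2 / 2 \<Longrightarrow> x / y \<le> k - m * y / 2" for x y k m :: real
  by (simp add: field_simps power2_eq_square)

lemma divide_sum_split:
  "0 < x \<Longrightarrow> 0 < y \<Longrightarrow> c / (x + y) / x + c / (x + y) / y = c / (x * y)" for x y c :: real
proof -
  assume "0 < x" "0 < y"
  moreover from this have "x + y \<noteq> 0" by simp
  moreover have "c / (x + y) / x + c / (x + y) / y = c / (x + y) * ((x + y) / (x * y))"
    using calculation(1,2) by (simp add: divide_simps) (simp add: algebra_simps)
  ultimately show ?thesis by simp
qed

text \<open>Convexity is encoded by a monotone derivative, since the kernels of interest are powers and differences of powers whose
derivatives are explicit.\<close>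

definition convex_kernel :: "real \<Rightarrow> (real \<Rightarrow> real) \<Rightarrow> bool" where
  "convex_kernel b K \<longleftrightarrow> 0 \<le> K 0 \<and> (\<exists>K'. (\<forall>s\<in>{0..b}. (K has_real_derivative K' s) (at s)) \<and>
     (\<forall>s\<in>{0..b}. 0 \<le> K' s) \<and> mono_on {0..b} K')"

lemma convex_kernel_subset: "convex_kernel b K \<Longrightarrow> c \<le> b \<Longrightarrow> convex_kernel c K"
proof -
  assume "convex_kernel b K" and cb: "c \<le> b"
  then obtain K' where K': "\<forall>s\<in>{0..b}. (K has_real_derivative K' s) (at s)" "0 \<le> K 0"
    "\<forall>s\<in>{0..b}. 0 \<le> K' s" "mono_on {0..b} K'" unfolding convex_kernel_def by blast
  have "mono_on {0..c} K'" using K'(4) by (rule mono_on_subset) (use cb in auto)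
  with K' cb show "convex_kernel c K" unfolding convex_kernel_def by (auto intro!: exI[of _ K'])
qed

lemma convex_kernel_continuous: "convex_kernel b K \<Longrightarrow> 0 \<le> x \<Longrightarrow> y \<le> b \<Longrightarrow> continuous_on {x..y} K"
  unfolding convex_kernel_def
  by (rule continuous_at_imp_continuous_on) (auto intro: DERIV_isCont)

text \<open>The slope at \<open>a\<close> separates the difference quotients on both sides of \<open>a\<close>. Comparing gains to the right of a mesh point with
losses to its left through this one number is all that convexity is used for.\<close>

lemma convex_kernel_slope:
  assumes "convex_kernel b K" "0 \<le> a" "a \<le> b"
  obtains m where "0 \<le> m"
    and "\<And>x y. a \<le> x \<Longrightarrow> x \<le> y \<Longrightarrow> y \<le> b \<Longrightarrow> m * (y - x) \<le> K y - K x"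
    and "\<And>x y. 0 \<le> x \<Longrightarrow> x \<le> y \<Longrightarrow> y \<le> a \<Longrightarrow> K y - K x \<le> m * (y - x)"
proof -
  from assms obtain K' where K': "\<And>s. s \<in> {0..b} \<Longrightarrow> (K has_real_derivative K' s) (at s)"
    "\<And>s. s \<in> {0..b} \<Longrightarrow> 0 \<le> K' s" "mono_on {0..b} K'" unfolding convex_kernel_def by blast
  have mvt: "\<exists>z\<in>{x..y}. K y - K x = (y - x) * K' z" if "0 \<le> x" "x \<le> y" "y \<le> b" for x y
  proof (cases "x = y")
    case False
    then have "x < y" using that by simp
    from MVT2[OF this, of K K'] K'(1) that obtain z where "x < z" "z < y" "K y - K x = (y - x) * K' z" by auto
    then show ?thesis by (intro bexI[of _ z]) auto
  qed auto
  show ?thesis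
  proof (rule that[of "K' a"])
    show "0 \<le> K' a" using K'(2) assms by auto
    fix x y
    show "K' a * (y - x) \<le> K y - K x" if xy: "a \<le> x" "x \<le> y" "y \<le> b"
    proof -
      from mvt[of x y] xy assms obtain z where z: "z \<in> {x..y}" "K y - K x = (y - x) * K' z" by auto
      have "K' a \<le> K' z" using K'(3) z xy assms by (auto intro!: mono_onD[of "{0..b}" K'])
      then show ?thesis unfolding z(2) using xy by (simp add: mult.commute mult_right_mono)
    qed
    show "K y - K x \<le> K' a * (y - x)" if xy: "0 \<le> x" "x \<le> y" "y \<le> a"
    proof -
      from mvt[of x y] xy assms obtain z where z: "z \<in> {x..y}" "K y - K x = (y - x) * K' z" by auto
      have "K' z \<le> K' a" using K'(3) z xy assms by (auto intro!: mono_onD[of "{0..b}" K'])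
      then show ?thesis unfolding z(2) using xy by (simp add: mult.commute mult_right_mono)
    qed
  qed
qed

lemma convex_kernel_mono: "convex_kernel b K \<Longrightarrow> 0 \<le> x \<Longrightarrow> x \<le> y \<Longrightarrow> y \<le> b \<Longrightarrow> K x \<le> K y"
proof -
  assume K: "convex_kernel b K" and x: "0 \<le> x" "x \<le> y" "y \<le> b"
  then obtain m where m: "0 \<le> m" "m * (y - x) \<le> K y - K x"
    using convex_kernel_slope[OF K, of x] by (metis order_refl order_trans)
  have "0 \<le> m * (y - x)" using m(1) x by simp
  with m(2) show "K x \<le> K y" by simp
qed

lemma convex_kernel_nonneg: "convex_kernel b K \<Longrightarrow> 0 \<le> x \<Longrightarrow> x \<le> b \<Longrightarrow> 0 \<le> K x"
  using convex_kernel_mono[of b K 0 x] unfolding convex_kernel_def by auto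

lemma moment_ge:
  assumes "a \<le> b" "continuous_on {a..b} K"
    and "\<And>x y. a \<le> x \<Longrightarrow> x \<le> y \<Longrightarrow> y \<le> b \<Longrightarrow> m * (y - x) \<le> K y - K x"
  shows "m * (b - a) ^ 3 / 6 \<le> moment K a b"
  unfolding moment_linear[OF assms(1), symmetric]
proof (rule moment_mono)
  show "mono_on {a..b} (\<lambda>s. K s - m * s)"
  proof (rule mono_onI)
    fix r s assume "r \<in> {a..b}" "s \<in> {a..b}" "r \<le> s"
    with assms(3)[of r s] show "K r - m * r \<le> K s - m * s" by (simp add: algebra_simps)
  qed
qed (use assms in \<open>auto intro!: continuous_intros\<close>)

lemma moment_le:
  assumes "a \<le> b" "continuous_on {a..b} K"
    and "\<And>x y. a \<le> x \<Longrightarrow> x \<le> y \<Longrightarrow> y \<le> b \<Longrightarrow> K y - K x \<le> m * (y - x)"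
  shows "moment K a b \<le> m * (b - a) ^ 3 / 6"
  unfolding moment_linear[OF assms(1), symmetric]
proof (rule moment_mono)
  show "mono_on {a..b} (\<lambda>s. m * s - K s)"
  proof (rule mono_onI)
    fix r s assume "r \<in> {a..b}" "s \<in> {a..b}" "r \<le> s"
    with assms(3)[of r s] show "m * r - K r \<le> m * s - K s" by (simp add: algebra_simps)
  qed
qed (use assms in \<open>auto intro!: continuous_intros\<close>)

lemma integral_le_slope:
  fixes a b :: real
  assumes "a \<le> b" "continuous_on {a..b} K"
    and "\<And>x y. a \<le> x \<Longrightarrow> x \<le> y \<Longrightarrow> y \<le> b \<Longrightarrow> m * (y - x) \<le> K y - K x"
  shows "integral {a..b} K \<le> (b - a) * K b - m * (b - a)\<^sup>2 / 2"
proof -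
  have "((\<lambda>s. K b - m * (b - s)) has_integral ((b - a) * K b - m * ((b - a)\<^sup>2 / 2))) {a..b}"
    using has_integral_const_real[of "K b" a b] assms(1)
    by (intro has_integral_diff has_integral_mult_right has_integral_from_right) auto
  from integrable_integral[OF integrable_continuous_interval[OF assms(2)]] this
  have "integral {a..b} K \<le> (b - a) * K b - m * ((b - a)\<^sup>2 / 2)"
  proof (rule has_integral_le)
    fix s assume "s \<in> {a..b}"
    then show "K s \<le> K b - m * (b - s)" using assms(3)[of s b] by simp
  qed
  then show ?thesis by simp
qed

lemma integral_le_trapezoid:
  assumes "0 \<le> a" "a < b" "convex_kernel b K"
  shows "integral {a..b} K \<le> (b - a) * (K a + K b) / 2"
proof -
  have cont: "continuous_on {a..b} K" using assms convex_kernel_continuous by force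
  have chord: "K s \<le> K a + (K b - K a) / (b - a) * (s - a)" if s: "s \<in> {a..b}" for s
  proof -
    obtain m where m: "m * (b - s) \<le> K b - K s" "K s - K a \<le> m * (s - a)"
    proof (rule convex_kernel_slope[OF assms(3), of s])
      fix m
      assume "\<And>x y. s \<le> x \<Longrightarrow> x \<le> y \<Longrightarrow> y \<le> b \<Longrightarrow> m * (y - x) \<le> K y - K x"
        "\<And>x y. 0 \<le> x \<Longrightarrow> x \<le> y \<Longrightarrow> y \<le> s \<Longrightarrow> K y - K x \<le> m * (y - x)"
      from this(1)[of s b] this(2)[of a s] s assms show thesis by (intro that) auto
    qed (use s assms in auto)
    have "(K s - K a) * (b - s) \<le> m * (s - a) * (b - s)"
      using m(2) s by (intro mult_right_mono) auto
    also have "\<dots> = m * (b - s) * (s - a)" by simp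
    also have "\<dots> \<le> (K b - K s) * (s - a)"
      using m(1) s by (intro mult_right_mono) auto
    finally have "(K s - K a) * (b - a) \<le> (K b - K a) * (s - a)" by (simp add: algebra_simps)
    then show ?thesis using assms by (simp add: field_simps)
  qed
  have "((\<lambda>s. K a + (K b - K a) / (b - a) * (s - a)) has_integral
      ((b - a) * K a + (K b - K a) / (b - a) * ((b - a)\<^sup>2 / 2))) {a..b}"
    using has_integral_const_real[of "K a" a b] assms
    by (intro has_integral_add has_integral_mult_right has_integral_from_left) auto
  from has_integral_le[OF integrable_integral[OF integrable_continuous_interval[OF cont]] this chord]
  have "integral {a..b} K \<le> (b - a) * K a + (K b - K a) / (b - a) * ((b - a)\<^sup>2 / 2)" by blast
  also have "\<dots> = (b - a) * (K a + K b) / 2"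
    using assms by (simp add: field_simps power2_eq_square)
  finally show ?thesis .
qed

text \<open>The weight \<open>1 - (2 * s - a - b) / (b - a + h)\<close> is nonnegative on the interval and has integral \<open>b - a\<close>.\<close>

lemma integral_minus_moment_ge:
  assumes "0 < b - a" "0 < h" "continuous_on {a..b} K" "\<And>s. s \<in> {a..b} \<Longrightarrow> K a \<le> K s"
  shows "(b - a) * K a \<le> integral {a..b} K - moment K a b / (b - a + h)"
proof -
  define w where "w s = 1 - (2 * s - a - b) / (b - a + h)" for s
  have w: "0 \<le> w s" if "s \<in> {a..b}" for s
    using that assms by (simp add: w_def field_simps)
  have 1: "((\<lambda>s. K s - (2 * s - a - b) * K s / (b - a + h)) has_integral
     (integral {a..b} K - moment K a b / (b - a + h))) {a..b}"
    unfolding moment_def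
    by (intro has_integral_diff has_integral_divide integrable_integral moment_integrable
        integrable_continuous_interval assms)
  have "((\<lambda>s. K a - K a * (2 * s - a - b) / (b - a + h)) has_integral
     ((b - a) * K a - K a * 0 / (b - a + h))) {a..b}"
    using has_integral_const_real[of "K a" a b] assms
    by (intro has_integral_diff has_integral_divide has_integral_mult_right has_integral_centred) auto
  from this 1 have
    "(b - a) * K a - K a * 0 / (b - a + h) \<le> integral {a..b} K - moment K a b / (b - a + h)"
  proof (rule has_integral_le)
    fix s assume s: "s \<in> {a..b}"
    have eq: "k - k * X / Y = (1 - X / Y) * k" "k - X * k / Y = (1 - X / Y) * k" for k X Y :: real
      by (simp_all add: left_diff_distrib)
    have "w s * K a \<le> w s * K s" by (intro mult_left_mono w s assms)
    then show "K a - K a * (2 * s - a - b) / (b - a + h) \<le> K s - (2 * s - a - b) * K s / (b - a + h)"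
      unfolding w_def eq .
  qed
  then show ?thesis by simp
qed

section \<open>Kernel averages on a mesh with bounded step ratios\<close>

locale ratio_mesh =
  fixes t :: "nat \<Rightarrow> real"
  assumes mesh_0: "t 0 = 0"
    and mesh_less: "t k < t (Suc k)"
    and mesh_ratio: "1 \<le> k \<Longrightarrow> step t (Suc k) / step t k \<in> {rho_L..rho_R}"
begin

lemma mesh_le: "i \<le> j \<Longrightarrow> t i \<le> t j"
  by (rule lift_Suc_mono_le[of t]) (use mesh_less less_imp_le in auto)

lemma mesh_nonneg: "0 \<le> t k"
  using mesh_le[of 0 k] mesh_0 by simp

lemma step_Suc: "step t (Suc k) = t (Suc k) - t k"
  by (simp add: step_def)

lemma step_pos: "1 \<le> k \<Longrightarrow> 0 < step t k"
  using mesh_less[of "k - 1"] by (cases k) (auto simp: step_def)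

lemma step_Suc_pos: "0 < step t (Suc k)"
  by (rule step_pos) simp

text \<open>The share of \<open>wavg K (Suc i)\<close> that lives on the interval to the left of \<open>t i\<close>; on the first interval of the mesh there is none.\<close>

definition left_moment :: "(real \<Rightarrow> real) \<Rightarrow> nat \<Rightarrow> real" where
  "left_moment K i = (case i of 0 \<Rightarrow> 0 | Suc h \<Rightarrow>
      moment K (t h) (t i) / (step t i + step t (Suc i))) / step t (Suc i)"

text \<open>In the L2 operator at time $t_k$ with kernel \<open>K\<close>, this is the coefficient of increment number \<open>p < k\<close>, before the
quadratic on the last interval is taken into account. It is an
average of \<open>K\<close> with a weight of total mass one: the chord on interval \<open>p\<close> contributes the integral, the second
differences on the intervals \<open>p\<close> and \<open>p - 1\<close> contribute the two moments.\<close>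

definition wavg :: "(real \<Rightarrow> real) \<Rightarrow> nat \<Rightarrow> real" where
  "wavg K p = (case p of 0 \<Rightarrow> 0 | Suc i \<Rightarrow> (integral {t i..t p} K
      - moment K (t i) (t p) / (step t p + step t (Suc p))) / step t p + left_moment K i)"

lemma wavg_0 [simp]: "wavg K 0 = 0"
  by (simp add: wavg_def)

lemma wavg_Suc: "wavg K (Suc i) = (integral {t i..t (Suc i)} K
      - moment K (t i) (t (Suc i)) / (step t (Suc i) + step t (Suc (Suc i)))) / step t (Suc i)
      + left_moment K i"
  by (simp add: wavg_def)

lemma kernel_cont:
  assumes "convex_kernel b K" "t j \<le> b"
  shows "continuous_on {t i..t j} K"
  using convex_kernel_continuous[OF assms(1) mesh_nonneg assms(2)] .

lemma left_moment_nonneg: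
  assumes "convex_kernel (t i) K"
  shows "0 \<le> left_moment K i"
proof (cases i)
  case (Suc h)
  have "0 \<le> moment K (t h) (t i)"
    using assms Suc mesh_nonneg[of h]
    by (intro moment_nonneg mono_onI kernel_cont[of "t i"] convex_kernel_mono[OF assms] mesh_le) auto
  then show ?thesis using step_pos[of i] step_Suc_pos[of i] Suc
    by (simp add: left_moment_def)
qed (simp add: left_moment_def)

text \<open>The left moment is the only loss in the comparison of two consecutive averages, and the admissible step ratios bound it
by the gain that is available on the right of \<open>t i\<close>.\<close>

lemma left_moment_le:
  assumes "convex_kernel (t i) K" "0 \<le> m"
    and m: "\<And>x y. 0 \<le> x \<Longrightarrow> x \<le> y \<Longrightarrow> y \<le> t i \<Longrightarrow> K y - K x \<le> m * (y - x)"
    and r: "0 < r" "r \<le> rho_R"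
  shows "left_moment K i \<le> m * step t (Suc i) * (3 + 1 / r) / 6"
proof (cases i)
  case 0
  then show ?thesis using assms step_Suc_pos[of i] by (simp add: left_moment_def)
next
  case (Suc h)
  let ?x = "step t i" and ?y = "step t (Suc i)"
  have pos: "0 < ?x" "0 < ?y" using Suc step_Suc_pos by auto
  have "moment K (t h) (t i) \<le> m * (t i - t h) ^ 3 / 6"
    using Suc mesh_nonneg[of h]
    by (intro moment_le m kernel_cont[OF assms(1)] mesh_le) auto
  also have "t i - t h = ?x" by (simp add: Suc step_Suc)
  finally have "moment K (t h) (t i) / (?x + ?y) / ?y \<le> m * ?x ^ 3 / 6 / (?x + ?y) / ?y"
    using pos by (intro divide_right_mono) auto
  then have "left_moment K i \<le> m * ?x ^ 3 / 6 / (?x + ?y) / ?y"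
    by (simp add: left_moment_def Suc)
  also have "\<dots> = m * (?x ^ 3 / ((?x + ?y) * ?y)) / 6" by simp
  also have "\<dots> \<le> m * (?y * (3 + 1 / r)) / 6"
    using mesh_ratio[of i] Suc r pos assms(2)
    by (intro divide_right_mono mult_left_mono tau_ratio_condition) auto
  finally show ?thesis by (simp add: mult_ac)
qed

lemma wavg_ge:
  assumes K: "convex_kernel (t (Suc i)) K"
  shows "K (t i) + left_moment K i \<le> wavg K (Suc i)"
proof -
  let ?y = "step t (Suc i)" and ?z = "step t (Suc (Suc i))"
  have "?y * K (t i) \<le> integral {t i..t (Suc i)} K - moment K (t i) (t (Suc i)) / (?y + ?z)"
    unfolding step_Suc[of i]
    using mesh_less[of i] mesh_less[of "Suc i"] mesh_nonneg[of i]
    by (intro integral_minus_moment_ge kernel_cont[OF K] convex_kernel_mono[OF K])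
       (auto simp: step_Suc)
  then show ?thesis unfolding wavg_Suc using step_Suc_pos[of i]
    by (simp add: field_simps)
qed

text \<open>Compare \<open>wavg K (Suc i)\<close> with \<open>wavg K i\<close> and let \<open>m\<close> be the slope of \<open>K\<close> at the left end \<open>t h\<close> of interval number \<open>i\<close>, of length
\<open>x\<close>, with \<open>y\<close> the length of the next one. To the right of \<open>t h\<close> mass has been moved towards larger values of \<open>K\<close>, with a gain of
at least \<open>m * x / 2 + m * x\<^sup>2 / (6 * y)\<close>; the only loss is \<open>left_moment K h\<close>, and by the ratio condition it does not exceed the
same number.\<close>

lemma wavg_mono:
  assumes K: "convex_kernel (t p) K" and p: "1 \<le> p"
  shows "wavg K (p - 1) \<le> wavg K p"
proof -
  obtain i where i: "p = Suc i" using p by (cases p) auto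
  show ?thesis
  proof (cases i)
    case 0
    have "0 \<le> K (t i)" "0 \<le> left_moment K i"
      using convex_kernel_nonneg[OF K mesh_nonneg, of i] mesh_le[of i p] i
        left_moment_nonneg[OF convex_kernel_subset[OF K], of i] by auto
    with wavg_ge[of i K] K i 0 show ?thesis by simp
  next
    case (Suc h)
    let ?x = "step t i" and ?y = "step t (Suc i)"
    have pos: "0 < ?x" "0 < ?y" using Suc step_Suc_pos by auto
    let ?J = "integral {t h..t i} K" and ?c = "moment K (t h) (t i)"
    have sub: "t i \<le> t p" "t h \<le> t i" using i Suc mesh_le by auto
    obtain m where m: "0 \<le> m"
      "\<And>x y. t h \<le> x \<Longrightarrow> x \<le> y \<Longrightarrow> y \<le> t i \<Longrightarrow> m * (y - x) \<le> K y - K x"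
      "\<And>x y. 0 \<le> x \<Longrightarrow> x \<le> y \<Longrightarrow> y \<le> t h \<Longrightarrow> K y - K x \<le> m * (y - x)"
      by (rule convex_kernel_slope[OF convex_kernel_subset[OF K sub(1)] mesh_nonneg sub(2)]) auto
    have len: "t i - t h = ?x" by (simp add: Suc step_Suc)
    have J: "?J \<le> ?x * K (t i) - m * ?x\<^sup>2 / 2"
      using integral_le_slope[of "t h" "t i" K m] m(2) sub kernel_cont[OF K] unfolding len by blast
    have c: "m * ?x ^ 3 / 6 \<le> ?c"
      using moment_ge[of "t h" "t i" K m] m(2) sub kernel_cont[OF K] unfolding len by blast
    have E: "left_moment K h \<le> m * ?x * (3 + 1 / (?y / ?x)) / 6"
      using left_moment_le[OF convex_kernel_subset[OF K] m(1,3), of h "?y / ?x"] sub mesh_ratio[of i]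
        pos Suc by auto
    have upper: "wavg K i = (?J - ?c / (?x + ?y)) / ?x + left_moment K h"
      using wavg_Suc[of K h] Suc by simp
    have lower: "K (t i) + ?c / (?x + ?y) / ?y \<le> wavg K (Suc i)"
      using wavg_ge[of i K] K i Suc by (simp add: left_moment_def)
    have J': "?J / ?x \<le> K (t i) - m * ?x / 2"
      by (rule average_le[OF pos(1) J])
    have c': "m * ?x\<^sup>2 / ?y / 6 \<le> ?c / (?x * ?y)"
      using c pos by (simp add: field_simps power2_eq_square power3_eq_cube)
    have c'': "?c / (?x + ?y) / ?x + ?c / (?x + ?y) / ?y = ?c / (?x * ?y)"
      using pos by (rule divide_sum_split)
    have E': "m * ?x * (3 + 1 / (?y / ?x)) / 6 = m * ?x / 2 + m * ?x\<^sup>2 / ?y / 6"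
      using pos by (simp add: field_simps power2_eq_square)
    have "wavg K i \<le> K (t i) - m * ?x / 2 - ?c / (?x + ?y) / ?x + left_moment K h"
      unfolding upper diff_divide_distrib using J' by simp
    with lower c' c'' E E' have "wavg K i \<le> wavg K (Suc i)" by linarith
    then show ?thesis using i by simp
  qed
qed

text \<open>On the interval itself the average stays below the right end value by \<open>m * y / 2\<close>, while the left moment is at most
\<open>11 / 20 * m * y\<close>; the remaining twentieth of \<open>m * y\<close> is bounded by the increment of \<open>K\<close>.\<close>

lemma wavg_le:
  assumes K: "convex_kernel (t (Suc i)) K"
  shows "wavg K (Suc i) \<le> 21 / 20 * K (t (Suc i))"
proof -
  let ?y = "step t (Suc i)" and ?z = "step t (Suc (Suc i))"
  have pos: "0 < ?y" "0 < ?z" using step_Suc_pos by auto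
  have len: "t (Suc i) - t i = ?y" by (simp add: step_Suc)
  have sub: "t i \<le> t (Suc i)" by (rule mesh_le) simp
  obtain m where m: "0 \<le> m"
    "\<And>x y. t i \<le> x \<Longrightarrow> x \<le> y \<Longrightarrow> y \<le> t (Suc i) \<Longrightarrow> m * (y - x) \<le> K y - K x"
    "\<And>x y. 0 \<le> x \<Longrightarrow> x \<le> y \<Longrightarrow> y \<le> t i \<Longrightarrow> K y - K x \<le> m * (y - x)"
    by (rule convex_kernel_slope[OF K mesh_nonneg sub]) auto
  have J: "integral {t i..t (Suc i)} K \<le> ?y * K (t (Suc i)) - m * ?y\<^sup>2 / 2"
    using integral_le_slope[of "t i" "t (Suc i)" K m] m(2) sub kernel_cont[OF K] unfolding len by blast
  have "0 \<le> moment K (t i) (t (Suc i))"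
    using sub mesh_nonneg[of i]
    by (intro moment_nonneg mono_onI kernel_cont[OF K] convex_kernel_mono[OF K]) auto
  then have "integral {t i..t (Suc i)} K - moment K (t i) (t (Suc i)) / (?y + ?z)
      \<le> ?y * K (t (Suc i)) - m * ?y\<^sup>2 / 2"
    using J pos by (smt (verit) divide_nonneg_pos)
  then have 1: "(integral {t i..t (Suc i)} K - moment K (t i) (t (Suc i)) / (?y + ?z)) / ?y
      \<le> K (t (Suc i)) - m * ?y / 2"
    by (rule average_le[OF pos(1)])
  have 2: "left_moment K i \<le> m * ?y * (3 + 1 / rho_R) / 6"
    using left_moment_le[OF convex_kernel_subset[OF K] m(1,3), of i rho_R] sub rho_R_bounds by auto
  have "1 / rho_R \<le> 0.3" using rho_R_bounds by (simp add: field_simps)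
  then have "m * ?y * (3 + 1 / rho_R) / 6 \<le> m * ?y * (3 + 0.3) / 6"
    using m(1) pos by (intro divide_right_mono mult_left_mono add_left_mono) auto
  also have "\<dots> = 11 / 20 * (m * ?y)" by simp
  finally have 3: "wavg K (Suc i) \<le> K (t (Suc i)) + 1 / 20 * (m * ?y)"
    unfolding wavg_Suc using 1 2 by linarith
  have "m * ?y \<le> K (t (Suc i)) - K (t i)" using m(2)[of "t i" "t (Suc i)"] sub len by simp
  moreover have "0 \<le> K (t i)" using convex_kernel_nonneg[OF K mesh_nonneg] sub .
  ultimately show ?thesis using 3 by simp
qed

end

section \<open>Power kernels and the history part of the L2 operator\<close>

lemma DERIV_power_kernel:
  assumes "s < (b::real)"
  shows "((\<lambda>s. (b - s) powr (- \<gamma>)) has_real_derivative \<gamma> * (b - s) powr (- \<gamma> - 1)) (at s)"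
proof -
  have "((\<lambda>s. (b - s) powr (- \<gamma>)) has_real_derivative (- \<gamma> * (b - s) powr (- \<gamma> - 1)) * (0 - 1)) (at s)"
    by (rule DERIV_chain2[of "\<lambda>x. x powr (- \<gamma>)"])
       (use assms in \<open>auto intro!: has_real_derivative_powr derivative_eq_intros\<close>)
  then show ?thesis by simp
qed

lemma power_kernel_diff_mono:
  assumes "0 < \<gamma>" "x \<le> y" "y < b" "b \<le> (c::real)"
  shows "(b - x) powr (- \<gamma>) - (c - x) powr (- \<gamma>) \<le> (b - y) powr (- \<gamma>) - (c - y) powr (- \<gamma>)"
proof (rule DERIV_nonneg_imp_nondecreasing[OF assms(2)])
  fix s assume s: "x \<le> s" "s \<le> y"
  have "(c - s) powr (- \<gamma> - 1) \<le> (b - s) powr (- \<gamma> - 1)"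
    using assms s by (intro powr_mono2') auto
  then have "0 \<le> \<gamma> * (b - s) powr (- \<gamma> - 1) - \<gamma> * (c - s) powr (- \<gamma> - 1)"
    using assms(1) by simp
  moreover have "((\<lambda>s. (b - s) powr (- \<gamma>) - (c - s) powr (- \<gamma>)) has_real_derivative
      \<gamma> * (b - s) powr (- \<gamma> - 1) - \<gamma> * (c - s) powr (- \<gamma> - 1)) (at s)"
    using assms s by (intro DERIV_diff DERIV_power_kernel) auto
  ultimately show "\<exists>d. ((\<lambda>s. (b - s) powr (- \<gamma>) - (c - s) powr (- \<gamma>)) has_real_derivative d) (at s) \<and> 0 \<le> d"
    by blast
qed

lemma convex_kernel_power:
  assumes "0 < \<gamma>" "0 \<le> b" "b < c"
  shows "convex_kernel b (\<lambda>s. (c - s) powr (- \<gamma>))"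
  unfolding convex_kernel_def
proof (intro conjI exI ballI)
  show "mono_on {0..b} (\<lambda>s. \<gamma> * (c - s) powr (- \<gamma> - 1))"
    using assms by (intro mono_onI mult_left_mono powr_mono2') auto
qed (use assms in \<open>auto intro!: DERIV_power_kernel\<close>)

text \<open>Differences of rows of the L2 matrix are averages of these kernels.\<close>

lemma convex_kernel_power_diff:
  assumes "0 < \<gamma>" "0 \<le> b" "b < c" "c \<le> d"
  shows "convex_kernel b (\<lambda>s. (c - s) powr (- \<gamma>) - (d - s) powr (- \<gamma>))"
  unfolding convex_kernel_def
proof (intro conjI exI ballI)
  show "0 \<le> (c - 0) powr (- \<gamma>) - (d - 0) powr (- \<gamma>)"
    using assms powr_mono2'[of "- \<gamma>" c d] by simp
next
  fix s assume s: "s \<in> {0..b}"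
  show "((\<lambda>s. (c - s) powr (- \<gamma>) - (d - s) powr (- \<gamma>)) has_real_derivative
      \<gamma> * (c - s) powr (- \<gamma> - 1) - \<gamma> * (d - s) powr (- \<gamma> - 1)) (at s)"
    using assms s by (intro DERIV_diff DERIV_power_kernel) auto
  have "(d - s) powr (- \<gamma> - 1) \<le> (c - s) powr (- \<gamma> - 1)"
    using assms s by (intro powr_mono2') auto
  then show "0 \<le> \<gamma> * (c - s) powr (- \<gamma> - 1) - \<gamma> * (d - s) powr (- \<gamma> - 1)"
    using assms(1) by simp
next
  show "mono_on {0..b} (\<lambda>s. \<gamma> * (c - s) powr (- \<gamma> - 1) - \<gamma> * (d - s) powr (- \<gamma> - 1))"
  proof (rule mono_onI)
    fix x y assume "x \<in> {0..b}" "y \<in> {0..b}" "x \<le> y"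
    then have "(c - x) powr (- (\<gamma> + 1)) - (d - x) powr (- (\<gamma> + 1))
        \<le> (c - y) powr (- (\<gamma> + 1)) - (d - y) powr (- (\<gamma> + 1))"
      using assms by (intro power_kernel_diff_mono) auto
    then have "\<gamma> * ((c - x) powr (- \<gamma> - 1) - (d - x) powr (- \<gamma> - 1))
        \<le> \<gamma> * ((c - y) powr (- \<gamma> - 1) - (d - y) powr (- \<gamma> - 1))"
      using assms(1) unfolding minus_add_distrib diff_conv_add_uminus[symmetric] by (intro mult_left_mono) auto
    then show "\<gamma> * (c - x) powr (- \<gamma> - 1) - \<gamma> * (d - x) powr (- \<gamma> - 1)
        \<le> \<gamma> * (c - y) powr (- \<gamma> - 1) - \<gamma> * (d - y) powr (- \<gamma> - 1)"
      by (simp add: right_diff_distrib)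
  qed
qed

lemma powr_convex_exponent:
  assumes "0 < x" "0 \<le> a" "a \<le> 1"
  shows "x powr ((1 - a) * p + a * q) \<le> (1 - a) * x powr p + a * x powr (q::real)"
proof -
  have "exp ((1 - a) *\<^sub>R (p * ln x) + a *\<^sub>R (q * ln x)) \<le> (1 - a) * exp (p * ln x) + a * exp (q * ln x)"
    using convex_onD[OF exp_convex, of a "p * ln x" "q * ln x"] assms by simp
  then show ?thesis using assms by (simp add: powr_def algebra_simps)
qed

text \<open>With \<open>r\<close> the next step ratio and the current step scaled to one, the left-hand side bounds the diagonal of the history
form. For small \<open>r\<close> the powers are compared with those for \<open>\<alpha> = 1\<close>, and \<open>r \<ge> 457 / 1000\<close> suffices.\<close>

lemma diagonal_share_bound:
  assumes "0 < \<alpha>" "\<alpha> < 1" "rho_L \<le> r"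
  shows "(r powr (-\<alpha>) + (1 + r) powr (-\<alpha>)) / 2 + 21 / 20 * (1 - (1 + r) powr (-\<alpha>)) \<le> 19 / 10"
proof (cases "r < 1")
  case True
  have r: "457 / 1000 \<le> r" using assms rho_L_bounds by simp
  have "r powr (-\<alpha>) \<le> r powr (-1)" using assms True r by (intro powr_mono') auto
  also have "\<dots> \<le> 219 / 100" using r by (simp add: powr_minus field_simps)
  finally have 1: "r powr (-\<alpha>) \<le> 219 / 100" .
  have "1 / 2 \<le> (1 + r) powr (-1)" using True r by (simp add: powr_minus field_simps)
  also have "\<dots> \<le> (1 + r) powr (-\<alpha>)" using assms r by (intro powr_mono) auto
  finally show ?thesis using 1 by argo
next
  case False
  have "r powr (-\<alpha>) \<le> r powr 0" using False assms by (intro powr_mono) auto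
  then have "r powr (-\<alpha>) \<le> 1" using False by simp
  moreover have "0 \<le> (1 + r) powr (-\<alpha>)" by simp
  ultimately show ?thesis by argo
qed

lemma fraction_bound: "0 < r \<Longrightarrow> r \<le> rho_R \<Longrightarrow> r / (1 + r) \<le> (7808 / 10000)"
  using rho_R_bounds by (simp add: field_simps)

text \<open>The power of \<open>rho_R\<close> with exponent \<open>1 - \<alpha> / 2\<close> is interpolated between the exponents \<open>1\<close> and \<open>1 / 2\<close>, and \<open>35616 / 10000\<close> and
\<open>189 / 100\<close> bound \<open>rho_R\<close> and its square root.\<close>

lemma ratio_power_bound:
  assumes "0 < \<alpha>" "\<alpha> < 1" "0 < r" "r \<le> rho_R"
  shows "r powr (2 - \<alpha> / 2) / (1 + r) \<le> (35616 / 10000 - 16716 / 10000 * \<alpha>) * (r / (1 + r))"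
proof -
  have "r powr (1 - \<alpha> / 2) \<le> rho_R powr (1 - \<alpha> / 2)"
    using assms by (intro powr_mono2) auto
  also have "\<dots> = rho_R powr ((1 - \<alpha>) * 1 + \<alpha> * (1 / 2))" by (simp add: field_simps)
  also have "\<dots> \<le> (1 - \<alpha>) * rho_R powr 1 + \<alpha> * rho_R powr (1 / 2)"
    using assms by (intro powr_convex_exponent) auto
  finally have "r powr (1 - \<alpha> / 2) \<le> (1 - \<alpha>) * rho_R powr 1 + \<alpha> * rho_R powr (1 / 2)" .
  moreover have "(1 - \<alpha>) * rho_R powr 1 \<le> (1 - \<alpha>) * (35616 / 10000)"
    using rho_R_bounds assms by (intro mult_left_mono) auto
  moreover have "rho_R powr (1 / 2) \<le> 189 / 100"
  proof -
    have "sqrt rho_R \<le> 189 / 100"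
      using rho_R_bounds by (intro real_le_lsqrt) (auto simp: power2_eq_square)
    then show ?thesis using rho_R_bounds by (simp add: powr_half_sqrt)
  qed
  then have "\<alpha> * rho_R powr (1 / 2) \<le> \<alpha> * (189 / 100)"
    using assms by (intro mult_left_mono) auto
  ultimately have Y: "r powr (1 - \<alpha> / 2) \<le> 35616 / 10000 - 16716 / 10000 * \<alpha>"
    by argo
  have "r powr (2 - \<alpha> / 2) = r powr (1 - \<alpha> / 2) * r"
    using assms powr_add[of r "1 - \<alpha> / 2" 1] by simp
  then have "r powr (2 - \<alpha> / 2) / (1 + r) = r powr (1 - \<alpha> / 2) * (r / (1 + r))" by simp
  also have "\<dots> \<le> (35616 / 10000 - 16716 / 10000 * \<alpha>) * (r / (1 + r))"
    using assms by (intro mult_right_mono Y) auto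
  finally show ?thesis .
qed

text \<open>After multiplication with \<open>(1 - \<alpha>) * (2 - \<alpha>)\<close> the claim is reduced to extreme \<open>x\<close> and \<open>y\<close>, where it concerns quadratic
polynomials in \<open>\<alpha>\<close>.\<close>

lemma diagonal_margin_aux:
  assumes \<alpha>: "0 < \<alpha>" "\<alpha> < (1::real)" and x: "0 \<le> x" "x \<le> (7808 / 10000)" and y: "0 \<le> y" "y \<le> (7808 / 10000)"
    and Y: "Y = 35616 / 10000 - 16716 / 10000 * \<alpha>"
  shows "39 / 20 \<le> 2 / (1 - \<alpha>) + \<alpha> / ((1 - \<alpha>) * (2 - \<alpha>)) * ((2 - Y) * x - Y * y)"
proof -
  have Y0: "0 \<le> Y" using \<alpha> Y by simp
  have a2: "0 \<le> \<alpha> * (1 - \<alpha>)" using \<alpha> by simp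
  \<comment> \<open>In the case \<open>2 \<le> Y\<close> the quadratic polynomial has its minimum near \<open>11 / 100\<close>.\<close>
  have sq: "0 \<le> (\<alpha> - 11 / 100)\<^sup>2" by simp
  define Z where "Z = (2 - Y) * x - Y * y"
  have yy: "Y * y \<le> Y * (7808 / 10000)" using y Y0 by (intro mult_left_mono) auto
  have "39 / 20 * ((1 - \<alpha>) * (2 - \<alpha>)) \<le> 2 * (2 - \<alpha>) + \<alpha> * Z"
  proof (cases "2 \<le> Y")
    case True
    have "(Y - 2) * x \<le> (Y - 2) * (7808 / 10000)" using x True by (intro mult_left_mono) auto
    with yy have "(2 - 2 * Y) * (7808 / 10000) \<le> Z" unfolding Z_def by argo
    then have "\<alpha> * ((2 - 2 * Y) * (7808 / 10000)) \<le> \<alpha> * Z"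
      using \<alpha> by (intro mult_left_mono) auto
    then show ?thesis using sq a2 \<alpha> unfolding Y power2_eq_square by argo
  next
    case False
    then have "0 \<le> (2 - Y) * x" using x by simp
    with yy have "- Y * (7808 / 10000) \<le> Z" unfolding Z_def by argo
    then have "\<alpha> * (- Y * (7808 / 10000)) \<le> \<alpha> * Z"
      using \<alpha> by (intro mult_left_mono) auto
    then show ?thesis using a2 \<alpha> unfolding Y by argo
  qed
  then have "39 / 20 \<le> (2 * (2 - \<alpha>) + \<alpha> * ((2 - Y) * x - Y * y)) / ((1 - \<alpha>) * (2 - \<alpha>))"
    using \<alpha> by (simp add: Z_def pos_le_divide_eq)
  also have "\<dots> = 2 / (1 - \<alpha>) + \<alpha> / ((1 - \<alpha>) * (2 - \<alpha>)) * ((2 - Y) * x - Y * y)"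
  proof -
    have "2 * (2 - \<alpha>) / ((1 - \<alpha>) * (2 - \<alpha>)) = 2 / (1 - \<alpha>)"
      using \<alpha> by (intro nonzero_mult_divide_mult_cancel_right) auto
    then show ?thesis by (simp add: Z_def add_divide_distrib)
  qed
  finally show ?thesis .
qed

text \<open>Here \<open>2 / (1 - \<alpha>) + 2 * \<beta> * \<rho> / (1 + \<rho>)\<close> is twice the diagonal of the L2 matrix, without its left moment and in units of
\<open>\<tau>\<close> to the power \<open>-\<alpha>\<close>, and the two subtracted terms are what a symmetric arithmetic-geometric mean inequality takes from it
for the products with the previous and with the next increment. The remainder \<open>39 / 20\<close> exceeds the bound
\<open>19 / 10\<close> of \<open>diagonal_share_bound\<close>. The first part is the case of the first time step.\<close>

lemma diagonal_margin:
  assumes \<alpha>: "0 < \<alpha>" "\<alpha> < 1" and r: "0 < r" "r \<le> rho_R"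
  defines "\<beta> \<equiv> \<alpha> / ((1 - \<alpha>) * (2 - \<alpha>))"
  shows "39 / 20 \<le> 2 / (1 - \<alpha>) - \<beta> * (r powr (2 - \<alpha> / 2) / (1 + r))"
    and "0 < \<rho> \<Longrightarrow> \<rho> \<le> rho_R \<Longrightarrow> 39 / 20 \<le> 2 / (1 - \<alpha>) + 2 * \<beta> * (\<rho> / (1 + \<rho>))
           - \<beta> * (\<rho> powr (2 - \<alpha> / 2) / (1 + \<rho>)) - \<beta> * (r powr (2 - \<alpha> / 2) / (1 + r))"
proof -
  define Y where "Y = 35616 / 10000 - 16716 / 10000 * \<alpha>"
  have \<beta>: "0 \<le> \<beta>" using \<alpha> by (simp add: \<beta>_def)
  have ry: "\<beta> * (r powr (2 - \<alpha> / 2) / (1 + r)) \<le> \<beta> * (Y * (r / (1 + r)))"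
    unfolding Y_def using \<beta> \<alpha> r by (intro mult_left_mono ratio_power_bound)
  have y: "0 \<le> r / (1 + r)" "r / (1 + r) \<le> (7808 / 10000)" using r fraction_bound by auto
  show "39 / 20 \<le> 2 / (1 - \<alpha>) - \<beta> * (r powr (2 - \<alpha> / 2) / (1 + r))"
    using diagonal_margin_aux[OF \<alpha> order_refl _ y Y_def] ry unfolding \<beta>_def[symmetric] by simp
  assume \<rho>: "0 < \<rho>" "\<rho> \<le> rho_R"
  have rx: "\<beta> * (\<rho> powr (2 - \<alpha> / 2) / (1 + \<rho>)) \<le> \<beta> * (Y * (\<rho> / (1 + \<rho>)))"
    unfolding Y_def using \<beta> \<alpha> \<rho> by (intro mult_left_mono ratio_power_bound)
  have x: "0 \<le> \<rho> / (1 + \<rho>)" "\<rho> / (1 + \<rho>) \<le> (7808 / 10000)" using \<rho> fraction_bound by auto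
  have "\<beta> * ((2 - Y) * X - Y * R) = 2 * \<beta> * X - \<beta> * (Y * X) - \<beta> * (Y * R)" for X R
    by (simp add: algebra_simps)
  note split = this[of "\<rho> / (1 + \<rho>)" "r / (1 + r)"]
  have combine: "l \<le> d + e \<Longrightarrow> e = f - p - q \<Longrightarrow> p' \<le> p \<Longrightarrow> q' \<le> q \<Longrightarrow> l \<le> d + f - p' - q'"
    for d e f l p p' q q' :: real by simp
  show "39 / 20 \<le> 2 / (1 - \<alpha>) + 2 * \<beta> * (\<rho> / (1 + \<rho>))
           - \<beta> * (\<rho> powr (2 - \<alpha> / 2) / (1 + \<rho>)) - \<beta> * (r powr (2 - \<alpha> / 2) / (1 + r))"
    by (rule combine[OF diagonal_margin_aux[OF \<alpha> x y Y_def, folded \<beta>_def] split rx ry])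
qed

locale subdiffusion_mesh = ratio_mesh t for t +
  fixes \<alpha> :: real
  assumes alpha: "0 < \<alpha>" "\<alpha> < 1"
begin

definition ker :: "nat \<Rightarrow> real \<Rightarrow> real" where
  "ker q s = (t q - s) powr (- \<alpha>)"

definition \<beta> :: real where "\<beta> = \<alpha> / ((1 - \<alpha>) * (2 - \<alpha>))"

lemma ker_convex: "p < q \<Longrightarrow> convex_kernel (t p) (ker q)"
  unfolding ker_def using alpha mesh_nonneg mesh_less[of p] mesh_le[of "Suc p" q]
  by (intro convex_kernel_power) auto

lemma ker_diff_convex: "p < q \<Longrightarrow> convex_kernel (t p) (\<lambda>s. ker q s - ker (Suc q) s)"
  unfolding ker_def using alpha mesh_nonneg mesh_less[of p] mesh_le[of "Suc p" q] mesh_less[of q]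
  by (intro convex_kernel_power_diff) auto

lemma ker_cont: "j < q \<Longrightarrow> continuous_on {t i..t j} (ker q)"
  by (rule kernel_cont[OF ker_convex]) auto

lemma wavg_ker_diff:
  assumes "p < q"
  shows "wavg (\<lambda>s. ker q s - ker (Suc q) s) p = wavg (ker q) p - wavg (ker (Suc q)) p"
proof (cases p)
  case (Suc i)
  have 1: "continuous_on {t i..t p} (ker q)" "continuous_on {t i..t p} (ker (Suc q))"
    using assms by (auto intro!: ker_cont)
  have I: "integral {t i..t p} (\<lambda>s. ker q s - ker (Suc q) s) =
    integral {t i..t p} (ker q) - integral {t i..t p} (ker (Suc q))"
    by (intro integral_diff integrable_continuous_interval 1)
  have M: "left_moment (\<lambda>s. ker q s - ker (Suc q) s) i = left_moment (ker q) i - left_moment (ker (Suc q)) i"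
    using assms Suc
    by (cases i) (auto simp: left_moment_def moment_diff ker_cont diff_divide_distrib)
  show ?thesis
    unfolding Suc wavg_Suc using I moment_diff[OF 1] M by (simp add: Suc diff_divide_distrib)
qed simp

text \<open>Below the diagonal these are the averages of the L2 matrix. The diagonal entry is chosen as the smallest number for which
the hypothesis of \<open>quadratic_form_lower_bound\<close> holds at \<open>p = q\<close>, where it then is an equality. It stays bounded as
\<open>\<alpha>\<close> tends to one, whereas the diagonal of the L2 matrix does not.\<close>

definition history :: "nat \<Rightarrow> nat \<Rightarrow> real" where
  "history q p = (if p < q then wavg (ker q) p
     else wavg (ker q) (q - 1) + wavg (ker (Suc q)) q - wavg (ker (Suc q)) (q - 1))"

lemma history_0: "history q 0 = 0"
  by (cases q) (auto simp: history_def)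

lemma history_dec:
  assumes "1 \<le> p" "p \<le> q"
  shows "history (Suc q) p - history (Suc q) (p - 1) \<le> history q p - history q (p - 1)"
proof (cases "p = q")
  case True
  then show ?thesis using assms by (simp add: history_def less_Suc_eq_le)
next
  case False
  then have "p < q" "p - 1 < q" using assms by simp_all
  with wavg_mono[OF ker_diff_convex assms(1), of q] show ?thesis
    by (simp add: history_def wavg_ker_diff less_Suc_eq_le)
qed

lemma history_mono: "1 \<le> p \<Longrightarrow> p \<le> q \<Longrightarrow> history (Suc q) (p - 1) \<le> history (Suc q) p"
  using wavg_mono[OF ker_convex, of p "Suc q"] by (auto simp: history_def)

lemma history_form_ge:
  fixes x :: "nat \<Rightarrow> 'v::real_inner"
  shows "(\<Sum>k=1..n. history k k / 2 * (norm (x k))\<^sup>2)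
      \<le> (\<Sum>k=1..n. \<Sum>j=1..k. history k j * (x j \<bullet> x k))"
proof -
  have "0 \<le> (\<Sum>p=1..n. (history (Suc n) p - history (Suc n) (p - 1)) * (norm (\<Sum>i=p..n. x i))\<^sup>2) / 2"
    using history_mono[of _ n] by (intro divide_nonneg_nonneg sum_nonneg mult_nonneg_nonneg) auto
  also have "\<dots> \<le> (\<Sum>k=1..n. (\<Sum>j=1..k. history k j * (x j \<bullet> x k)) - history k k / 2 * (norm (x k))\<^sup>2)"
    by (rule quadratic_form_lower_bound) (use history_0 history_dec in auto)
  finally show ?thesis by (simp add: sum_subtractf)
qed

lemma left_moment_ker_mono:
  assumes "i < q"
  shows "left_moment (ker (Suc q)) i \<le> left_moment (ker q) i"
proof (cases i)
  case (Suc h)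
  have "moment (ker (Suc q)) (t h) (t i) \<le> moment (ker q) (t h) (t i)"
    using assms Suc mesh_nonneg[of h]
    by (intro moment_mono mono_onI ker_cont convex_kernel_mono[OF ker_diff_convex] mesh_le) auto
  then show ?thesis using Suc step_Suc_pos[of h] step_Suc_pos[of i]
    by (simp add: left_moment_def divide_right_mono)
qed (simp add: left_moment_def)

text \<open>The diagonal entry is the average \<open>i\<close> of the kernel difference plus the average \<open>Suc i\<close> of the next kernel. The first is at most
\<open>21 / 20\<close> times its value at \<open>t i\<close>; the trapezoidal rule bounds the second up to its left moment, which is kept since the true
diagonal contains the left moment as well.\<close>

lemma history_diag_le:
  "history (Suc i) (Suc i) \<le> left_moment (ker (Suc i)) i + 19 / 10 * step t (Suc i) powr (- \<alpha>)"
proof -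
  let ?q = "Suc i" and ?y = "step t (Suc i)" and ?z = "step t (Suc (Suc i))"
  define r where "r = ?z / ?y"
  have pos: "0 < ?y" "0 < ?z" using step_Suc_pos by auto
  have r: "rho_L \<le> r" "0 < r" using mesh_ratio[of ?q] pos by (auto simp: r_def)
  have z: "?z = ?y * r" using pos by (simp add: r_def)
  have yz: "?y + ?z = ?y * (1 + r)" unfolding z by (simp add: algebra_simps)
  have k1: "ker ?q (t i) = ?y powr (- \<alpha>)" by (simp add: ker_def step_Suc)
  have k2: "ker (Suc ?q) (t i) = ?y powr (- \<alpha>) * (1 + r) powr (- \<alpha>)"
  proof -
    have "t (Suc ?q) - t i = ?y + ?z" by (simp add: step_Suc)
    then show ?thesis using yz pos r by (simp add: ker_def powr_mult)
  qed
  have k3: "ker (Suc ?q) (t ?q) = ?y powr (- \<alpha>) * r powr (- \<alpha>)"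
  proof -
    have "t (Suc ?q) - t ?q = ?z" by (simp add: step_Suc)
    then show ?thesis using z pos r by (simp add: ker_def powr_mult)
  qed
  have *: "history ?q ?q = wavg (\<lambda>s. ker ?q s - ker (Suc ?q) s) i + wavg (ker (Suc ?q)) ?q"
    by (simp add: history_def wavg_ker_diff)
  have "wavg (\<lambda>s. ker ?q s - ker (Suc ?q) s) i \<le> 21 / 20 * (ker ?q (t i) - ker (Suc ?q) (t i))"
  proof (cases i)
    case 0
    then show ?thesis using convex_kernel_nonneg[OF ker_diff_convex[of i ?q], of "t i"] mesh_nonneg
      by auto
  next
    case (Suc h)
    with wavg_le[of h "\<lambda>s. ker ?q s - ker (Suc ?q) s"] ker_diff_convex[of i ?q]
    show ?thesis by simp
  qed
  moreover have "wavg (ker (Suc ?q)) ?q \<le> (ker (Suc ?q) (t i) + ker (Suc ?q) (t ?q)) / 2 + left_moment (ker ?q) i"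
  proof -
    have K: "convex_kernel (t ?q) (ker (Suc ?q))" by (rule ker_convex) simp
    have "0 \<le> moment (ker (Suc ?q)) (t i) (t ?q)"
      using mesh_nonneg[of i]
      by (intro moment_nonneg mono_onI kernel_cont[OF K] convex_kernel_mono[OF K] mesh_le) auto
    then have "integral {t i..t ?q} (ker (Suc ?q)) - moment (ker (Suc ?q)) (t i) (t ?q) / (?y + ?z)
        \<le> integral {t i..t ?q} (ker (Suc ?q))" using pos by simp
    also have "\<dots> \<le> ?y * (ker (Suc ?q) (t i) + ker (Suc ?q) (t ?q)) / 2"
      unfolding step_Suc[of i] by (rule integral_le_trapezoid[OF mesh_nonneg mesh_less K])
    finally have "(integral {t i..t ?q} (ker (Suc ?q)) - moment (ker (Suc ?q)) (t i) (t ?q) / (?y + ?z)) / ?y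
        \<le> (ker (Suc ?q) (t i) + ker (Suc ?q) (t ?q)) / 2"
      using pos(1) by (simp add: pos_divide_le_eq mult.commute)
    moreover have "left_moment (ker (Suc ?q)) i \<le> left_moment (ker ?q) i"
      by (rule left_moment_ker_mono) simp
    ultimately show ?thesis unfolding wavg_Suc by linarith
  qed
  ultimately have "history ?q ?q \<le> left_moment (ker ?q) i + ?y powr (- \<alpha>) *
      ((r powr (-\<alpha>) + (1 + r) powr (-\<alpha>)) / 2 + 21 / 20 * (1 - (1 + r) powr (-\<alpha>)))"
    unfolding * k1 k2 k3 by argo
  also have "\<dots> \<le> left_moment (ker ?q) i + ?y powr (- \<alpha>) * (19 / 10)"
    by (intro add_left_mono mult_left_mono diagonal_share_bound alpha r(1)) auto
  finally show ?thesis by (simp add: mult.commute)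
qed

end

section \<open>The L2 operator in terms of increments\<close>

lemma has_integral_power_from_right:
  fixes a b p :: real
  assumes "a \<le> b" "-1 < p"
  shows "((\<lambda>s. (b - s) powr p) has_integral ((b - a) powr (p + 1) / (p + 1))) {a..b}"
proof -
  have "((\<lambda>x. x powr p) has_integral ((b - a) powr (p + 1) / (p + 1))) {0..b - a}"
    using has_integral_powr_from_0[of p "b - a"] assms by simp
  then have "((\<lambda>x. (-1 * x + b) powr p) has_integral (1 / \<bar>-1\<bar>) *\<^sub>R ((b - a) powr (p + 1) / (p + 1)))
      ((\<lambda>x. (1 / -1) *\<^sub>R x + - ((1 / -1) *\<^sub>R b)) ` {0..b - a})"
    using has_integral_affinity[of "\<lambda>x. x powr p" _ 0 "b - a" "-1" b] by simp
  moreover have "(\<lambda>x. (1 / -1) *\<^sub>R x + - ((1 / -1) *\<^sub>R b)) ` {0..b - a} = {a..b}"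
    using image_diff_atLeastAtMost[of b 0 "b - a"] assms by (simp add: add.commute)
  ultimately show ?thesis by simp
qed

text \<open>In Newton's form the interpolant is expressed by increments, the only quantities with which the error is tested.\<close>

lemma lagrange2_newton:
  fixes v :: "nat \<Rightarrow> 'v::real_normed_vector"
  assumes "t (j - 1) = a" "t j = b" "t (j + 1) = c" "a < b" "b < c"
  shows "lagrange2 t v j s = v (j - 1) + ((s - a) / (b - a)) *\<^sub>R (v j - v (j - 1))
    + ((s - a) * (s - b) / (c - a)) *\<^sub>R ((1 / (c - b)) *\<^sub>R (v (j + 1) - v j) - (1 / (b - a)) *\<^sub>R (v j - v (j - 1)))"
proof -
  define X where "X = (s - a) / (b - a)"
  define Z where "Z = (s - a) * (s - b) / (c - a)"
  have ne: "b - a \<noteq> 0" "c - a \<noteq> 0" "c - b \<noteq> 0" "a - b \<noteq> 0" "a - c \<noteq> 0" "b - c \<noteq> 0" using assms by auto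
  have c0: "(s - b) * (s - c) / ((a - b) * (a - c)) = 1 - X + Z / (b - a)"
    unfolding X_def Z_def using ne by (simp add: divide_simps) (simp add: algebra_simps)
  have c1: "(s - a) * (s - c) / ((b - a) * (b - c)) = X - Z / (c - b) - Z / (b - a)"
    unfolding X_def Z_def using ne by (simp add: divide_simps) (simp add: algebra_simps)
  have c2: "(s - a) * (s - b) / ((c - a) * (c - b)) = Z / (c - b)"
    unfolding Z_def by simp
  show ?thesis
    unfolding lagrange2_def assms c0 c1 c2 unfolding X_def[symmetric] Z_def[symmetric]
    by (simp add: algebra_simps)
qed

lemma lagrange2_derivative:
  fixes v :: "nat \<Rightarrow> 'v::real_normed_vector"
  assumes "t (j - 1) = a" "t j = b" "t (j + 1) = c" "a < b" "b < c"
  shows "(lagrange2 t v j has_vector_derivative (1 / (b - a)) *\<^sub>R (v j - v (j - 1)) + ((2 * s - a - b) / (c - a)) *\<^sub>R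
      ((1 / (c - b)) *\<^sub>R (v (j + 1) - v j) - (1 / (b - a)) *\<^sub>R (v j - v (j - 1)))) (at s)"
proof -
  have scale: "((\<lambda>x. f x *\<^sub>R w) has_vector_derivative f' *\<^sub>R w) (at s)"
    if "(f has_real_derivative f') (at s)" for f f' and w :: 'v
    using has_vector_derivative_scaleR[OF that has_vector_derivative_const] by simp
  let ?D = "(1 / (c - b)) *\<^sub>R (v (j + 1) - v j) - (1 / (b - a)) *\<^sub>R (v j - v (j - 1))"
  have 1: "((\<lambda>s. (s - a) / (b - a)) has_real_derivative 1 / (b - a)) (at s)"
    by (rule DERIV_cdivide) (auto intro!: derivative_eq_intros)
  have 2: "((\<lambda>s. (s - a) * (s - b) / (c - a)) has_real_derivative (2 * s - a - b) / (c - a)) (at s)"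
    by (rule DERIV_cdivide) (auto intro!: derivative_eq_intros)
  have "((\<lambda>s. v (j - 1) + ((s - a) / (b - a)) *\<^sub>R (v j - v (j - 1)) + ((s - a) * (s - b) / (c - a)) *\<^sub>R ?D)
      has_vector_derivative 0 + (1 / (b - a)) *\<^sub>R (v j - v (j - 1)) + ((2 * s - a - b) / (c - a)) *\<^sub>R ?D) (at s)"
    by (intro has_vector_derivative_add has_vector_derivative_const scale 1 2)
  moreover have "lagrange2 t v j = (\<lambda>s. v (j - 1) + ((s - a) / (b - a)) *\<^sub>R (v j - v (j - 1))
      + ((s - a) * (s - b) / (c - a)) *\<^sub>R ?D)"
    by (rule ext) (rule lagrange2_newton[OF assms])
  ultimately show ?thesis by simp
qed

context subdiffusion_mesh
begin

definition incr :: "(nat \<Rightarrow> 'v::real_normed_vector) \<Rightarrow> nat \<Rightarrow> 'v" where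
  "incr v k = v k - v (k - 1)"

definition curv :: "(nat \<Rightarrow> 'v::real_normed_vector) \<Rightarrow> nat \<Rightarrow> 'v" where
  "curv v j = (1 / (step t j + step t (Suc j))) *\<^sub>R
     ((1 / step t (Suc j)) *\<^sub>R incr v (Suc j) - (1 / step t j) *\<^sub>R incr v j)"

lemma lagrange2_deriv:
  assumes "1 \<le> j"
  shows "vector_derivative (lagrange2 t v j) (at s) =
    (1 / step t j) *\<^sub>R incr v j + (2 * s - t (j - 1) - t j) *\<^sub>R curv v j"
proof -
  obtain i where i: "j = Suc i" using assms by (cases j) auto
  have "step t j + step t (Suc j) = t (j + 1) - t (j - 1)" by (simp add: step_def)
  then show ?thesis
    using vector_derivative_at[OF lagrange2_derivative[of t j, OF refl refl refl, of v s]]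
      mesh_less[of i] mesh_less[of j] i
    by (simp add: incr_def curv_def step_def)
qed

lemma has_integral_kernel_linear:
  assumes "(K has_integral I) {a..b}" "((\<lambda>s. (2 * s - a - b) * K s) has_integral M) {a..b}"
  shows "((\<lambda>s. K s *\<^sub>R (x + (2 * s - a - b) *\<^sub>R y)) has_integral I *\<^sub>R x + M *\<^sub>R y) {a..b}"
proof -
  have "((\<lambda>s. K s *\<^sub>R x + ((2 * s - a - b) * K s) *\<^sub>R y) has_integral I *\<^sub>R x + M *\<^sub>R y) {a..b}"
    by (intro has_integral_add has_integral_scaleR_left assms)
  then show ?thesis by (simp add: scaleR_add_right mult.commute)
qed

lemma has_integral_last_kernel:
  assumes "1 \<le> k"
  shows "(ker k has_integral (step t k powr (1 - \<alpha>) / (1 - \<alpha>))) {t (k - 1)..t k}"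
    and "((\<lambda>s. (2 * s - t (k - 1) - t k) * ker k s) has_integral (\<beta> * step t k powr (2 - \<alpha>))) {t (k - 1)..t k}"
proof -
  let ?a = "t (k - 1)" and ?b = "t k" and ?y = "step t k"
  let ?e = "?y * (?y powr (1 - \<alpha>) / (1 - \<alpha>)) - 2 * (?y powr (2 - \<alpha>) / (2 - \<alpha>))"
  have ab: "?a \<le> ?b" by (rule mesh_le) simp
  have y: "0 < ?y" "?b - ?a = ?y" using step_pos[OF assms] by (auto simp: step_def)
  show 1: "(ker k has_integral (?y powr (1 - \<alpha>) / (1 - \<alpha>))) {?a..?b}"
    using has_integral_power_from_right[OF ab, of "-\<alpha>"] alpha y by (simp add: ker_def[abs_def])
  have 2: "((\<lambda>s. (?b - s) powr (1 - \<alpha>)) has_integral (?y powr (2 - \<alpha>) / (2 - \<alpha>))) {?a..?b}"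
    using has_integral_power_from_right[OF ab, of "1 - \<alpha>"] alpha y by simp
  have 3: "((\<lambda>s. ?y * ker k s - 2 * (?b - s) powr (1 - \<alpha>)) has_integral
      (?e)) {?a..?b}"
    by (intro has_integral_diff has_integral_mult_right 1 2)
  have "?y * ?y powr (1 - \<alpha>) = ?y powr (2 - \<alpha>)"
    using y powr_add[of ?y 1 "1 - \<alpha>"] by simp
  then have "?e
      = ?y powr (2 - \<alpha>) * (1 / (1 - \<alpha>) - 2 / (2 - \<alpha>))"
    by (simp add: algebra_simps)
  also have "1 / (1 - \<alpha>) - 2 / (2 - \<alpha>) = \<beta>"
    using alpha by (simp add: \<beta>_def divide_simps)
  finally have 4: "?e = \<beta> * ?y powr (2 - \<alpha>)"
    by simp
  show "((\<lambda>s. (2 * s - ?a - ?b) * ker k s) has_integral (\<beta> * ?y powr (2 - \<alpha>))) {?a..?b}"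
  proof (rule has_integral_eq[OF _ 3[unfolded 4]])
    fix s assume s: "s \<in> {?a..?b}"
    have "(?b - s) powr (1 - \<alpha>) = (?b - s) * ker k s"
    proof (cases "s = ?b")
      case False
      then show ?thesis using s powr_add[of "?b - s" 1 "- \<alpha>"] by (simp add: ker_def)
    qed (use alpha in \<open>simp add: ker_def\<close>)
    then show "?y * ker k s - 2 * (?b - s) powr (1 - \<alpha>) = (2 * s - ?a - ?b) * ker k s"
      unfolding y(2)[symmetric] by (simp add: algebra_simps)
  qed
qed

lemma integral_kernel_linear_history:
  assumes "j < k"
  shows "integral {t (j - 1)..t j} (\<lambda>s. ker k s *\<^sub>R (x + (2 * s - t (j - 1) - t j) *\<^sub>R y))
    = integral {t (j - 1)..t j} (ker k) *\<^sub>R x + moment (ker k) (t (j - 1)) (t j) *\<^sub>R y"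
  unfolding moment_def
  by (intro integral_unique has_integral_kernel_linear integrable_integral integrable_continuous_interval
      moment_integrable ker_cont assms)

text \<open>Collecting coefficients: the second difference on interval \<open>j\<close> contributes to the increments \<open>j\<close> and \<open>Suc j\<close>, and its share for the last
increment \<open>Suc m\<close> remains as a left moment.\<close>

lemma history_sum_eq:
  fixes v :: "nat \<Rightarrow> 'v::real_normed_vector"
  shows
  "(\<Sum>j=1..m. integral {t (j - 1)..t j} K *\<^sub>R ((1 / step t j) *\<^sub>R incr v j)
      + moment K (t (j - 1)) (t j) *\<^sub>R curv v j)
    = (\<Sum>j=1..m. wavg K j *\<^sub>R incr v j) + left_moment K m *\<^sub>R incr v (Suc m)"
proof (induction m)
  case 0
  then show ?case by (simp add: left_moment_def)
next
  case (Suc m)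
  let ?J = "integral {t m..t (Suc m)} K" and ?c = "moment K (t m) (t (Suc m))"
  let ?x = "step t (Suc m)" and ?y = "step t (Suc (Suc m))"
  have "left_moment K m *\<^sub>R incr v (Suc m) + (?J *\<^sub>R ((1 / ?x) *\<^sub>R incr v (Suc m)) + ?c *\<^sub>R curv v (Suc m))
     = wavg K (Suc m) *\<^sub>R incr v (Suc m) + left_moment K (Suc m) *\<^sub>R incr v (Suc (Suc m))"
    by (simp add: wavg_Suc left_moment_def curv_def algebra_simps diff_divide_distrib)
  with Suc show ?case by (simp add: add.assoc)
qed

lemma Gamma_pos: "0 < Gamma (1 - \<alpha>)"
  using alpha by (intro Gamma_real_pos) simp

text \<open>The sum is the history, \<open>step t k powr (-\<alpha>) / (1 - \<alpha>)\<close> comes from the chord on the last interval and the final term from the second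
difference there. On that interval the quadratic through the last three nodes is used, hence the
negative multiple of the previous increment.\<close>

lemma L2_operator_eq:
  assumes k: "2 \<le> k"
  defines "\<rho> \<equiv> step t k / step t (k - 1)"
  shows "Gamma (1 - \<alpha>) *\<^sub>R L2_operator \<alpha> t v k =
     (\<Sum>j=1..k-1. wavg (ker k) j *\<^sub>R incr v j)
     + (left_moment (ker k) (k - 1) + step t k powr (-\<alpha>) / (1 - \<alpha>)) *\<^sub>R incr v k
     + (\<beta> * step t k powr (-\<alpha>) * (\<rho> / (1 + \<rho>))) *\<^sub>R (incr v k - \<rho> *\<^sub>R incr v (k - 1))"
proof -
  define x where "x = step t (k - 1)"
  define y where "y = step t k"
  have pos: "0 < x" "0 < y" using step_pos[of "k - 1"] step_pos[of k] k by (auto simp: x_def y_def)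
  have Suck: "Suc (k - 1) = k" using k by simp
  let ?K = "\<lambda>s. (t k - s) powr (-\<alpha>)"
  let ?V = "\<lambda>j. integral {t (j - 1)..t j} (\<lambda>s. ?K s *\<^sub>R vector_derivative (lagrange2 t v j) (at s))"
  let ?L = "integral {t (k - 1)..t k} (\<lambda>s. ?K s *\<^sub>R vector_derivative (lagrange2 t v (k - 1)) (at s))"
  have "?V j
     = integral {t (j - 1)..t j} (ker k) *\<^sub>R ((1 / step t j) *\<^sub>R incr v j)
      + moment (ker k) (t (j - 1)) (t j) *\<^sub>R curv v j" if "j \<in> {1..k-1}" for j
  proof -
    have "j < k" "1 \<le> j" using that k by auto
    with integral_kernel_linear_history[of j k "(1 / step t j) *\<^sub>R incr v j" "curv v j"]
    show ?thesis by (simp add: lagrange2_deriv ker_def)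
  qed
  then have hist: "(\<Sum>j=1..k-1. ?V j)
     = (\<Sum>j=1..k-1. wavg (ker k) j *\<^sub>R incr v j) + left_moment (ker k) (k - 1) *\<^sub>R incr v k"
    using history_sum_eq[where m = "k - 1" and K = "ker k" and v = v] unfolding Suck by simp
  \<comment> \<open>Recentring the quadratic from the previous interval to the last one turns its chord into the last chord.\<close>
  have shift: "2 * s - t (k - 1 - 1) - t (k - 1) = (x + y) + (2 * s - t (k - 1) - t k)" for s
    using k by (simp add: x_def y_def step_def)
  have curv: "curv v (k - 1) = (1 / (x + y)) *\<^sub>R ((1 / y) *\<^sub>R incr v k - (1 / x) *\<^sub>R incr v (k - 1))"
    by (simp only: curv_def Suck x_def y_def)
  have "(1 / x) *\<^sub>R incr v (k - 1) + (x + y) *\<^sub>R curv v (k - 1) = (1 / y) *\<^sub>R incr v k"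
    unfolding curv using pos by simp
  then have "vector_derivative (lagrange2 t v (k - 1)) (at s)
      = (1 / y) *\<^sub>R incr v k + (2 * s - t (k - 1) - t k) *\<^sub>R curv v (k - 1)" for s
    using lagrange2_deriv[of "k - 1" v s] k unfolding shift x_def[symmetric]
    by (simp add: scaleR_add_left add.assoc[symmetric])
  then have last: "?L
     = (y powr (1 - \<alpha>) / (1 - \<alpha>)) *\<^sub>R ((1 / y) *\<^sub>R incr v k) + (\<beta> * y powr (2 - \<alpha>)) *\<^sub>R curv v (k - 1)"
    using integral_unique[OF has_integral_kernel_linear[OF has_integral_last_kernel, of k "(1 / y) *\<^sub>R incr v k" "curv v (k - 1)"]] k
    by (simp add: ker_def y_def)
  have p1: "y powr (1 - \<alpha>) = y powr (-\<alpha>) * y" and p2: "y powr (2 - \<alpha>) = y powr (-\<alpha>) * y * y"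
    using pos powr_add[of y "-\<alpha>" 1] powr_add[of y "1 - \<alpha>" 1] by simp_all
  have \<rho>: "\<rho> = y / x" by (simp add: \<rho>_def x_def y_def)
  have frac: "\<rho> / (1 + \<rho>) = y / (x + y)" unfolding \<rho> using pos by (simp add: divide_simps)
  have first: "(y powr (1 - \<alpha>) / (1 - \<alpha>)) *\<^sub>R ((1 / y) *\<^sub>R incr v k) = (y powr (-\<alpha>) / (1 - \<alpha>)) *\<^sub>R incr v k"
    unfolding p1 using pos by simp
  have second: "(\<beta> * y powr (2 - \<alpha>)) *\<^sub>R curv v (k - 1)
     = (\<beta> * y powr (-\<alpha>) * (\<rho> / (1 + \<rho>))) *\<^sub>R (incr v k - \<rho> *\<^sub>R incr v (k - 1))"
    unfolding p2 curv frac unfolding \<rho> using pos by (simp add: scaleR_diff_right mult.assoc)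
  have "Gamma (1 - \<alpha>) *\<^sub>R L2_operator \<alpha> t v k =
     (\<Sum>j=1..k-1. ?V j)
     + ?L"
    using k Gamma_pos by (simp add: L2_operator_def)
  then show ?thesis
    unfolding hist last first second y_def[symmetric] by (simp add: scaleR_add_left)
qed

lemma L2_operator_1: "Gamma (1 - \<alpha>) *\<^sub>R L2_operator \<alpha> t v 1 = (step t 1 powr (-\<alpha>) / (1 - \<alpha>)) *\<^sub>R incr v 1"
proof -
  have "Gamma (2 - \<alpha>) = (1 - \<alpha>) * Gamma (1 - \<alpha>)"
  proof -
    have "1 - \<alpha> \<notin> \<int>\<^sub>\<le>\<^sub>0" using nonpos_Ints_nonpos[of "1 - \<alpha>"] alpha by auto
    then show ?thesis using Gamma_plus1[of "1 - \<alpha>"] by (simp add: algebra_simps)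
  qed
  moreover have "Gamma (1 - \<alpha>) \<noteq> 0" using Gamma_pos by linarith
  ultimately show ?thesis using alpha
    by (simp add: L2_operator_def incr_def powr_minus divide_simps)
qed

end

section \<open>Coercivity of the L2 operator\<close>

context subdiffusion_mesh
begin

text \<open>The weight with which the product of increments \<open>k - 1\<close> and \<open>k\<close> is charged to each of the two energies.\<close>

definition offdiag :: "nat \<Rightarrow> real" where
  "offdiag k = \<beta> * ((step t k / step t (k - 1)) powr (2 - \<alpha> / 2) / (1 + step t k / step t (k - 1)))"

definition energy :: "(nat \<Rightarrow> 'v::real_inner) \<Rightarrow> nat \<Rightarrow> real" where
  "energy v k = step t k powr (-\<alpha>) * (norm (incr v k))\<^sup>2"

lemma beta_nonneg: "0 \<le> \<beta>"
  using alpha by (simp add: \<beta>_def)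

lemma offdiag_nonneg: "2 \<le> k \<Longrightarrow> 0 \<le> offdiag k"
proof -
  assume "2 \<le> k"
  then have "0 < step t k" "0 < step t (k - 1)" by (auto intro: step_pos)
  then show ?thesis unfolding offdiag_def
    by (intro mult_nonneg_nonneg divide_nonneg_nonneg beta_nonneg) auto
qed

lemma energy_nonneg: "0 \<le> energy v k"
  by (simp add: energy_def)

text \<open>Both increments are scaled by the power \<open>-\<alpha> / 2\<close> of their own step before the arithmetic-geometric mean inequality is applied; this
balances the charges and produces the exponent \<open>2 - \<alpha> / 2\<close> of the ratio.\<close>

lemma offdiag_bound:
  assumes k: "2 \<le> k"
  defines "\<rho> \<equiv> step t k / step t (k - 1)"
  shows "\<beta> * step t k powr (-\<alpha>) * (\<rho> / (1 + \<rho>)) * \<rho> * (incr v (k - 1) \<bullet> incr v k)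
    \<le> offdiag k / 2 * (energy v k + energy v (k - 1))"
proof -
  define x where "x = step t (k - 1)"
  define y where "y = step t k"
  have pos: "0 < x" "0 < y" using step_pos[of "k - 1"] step_pos[of k] k by (auto simp: x_def y_def)
  have \<rho>: "\<rho> = y / x" "0 < \<rho>" using pos by (auto simp: \<rho>_def x_def y_def)
  define p where "p = y powr (-\<alpha> / 2) * norm (incr v k)"
  define q where "q = x powr (-\<alpha> / 2) * norm (incr v (k - 1))"
  have half: "z powr (-\<alpha> / 2) * z powr (-\<alpha> / 2) = z powr (-\<alpha>)" for z :: real
    by (simp add: powr_add[symmetric])
  have p2: "p\<^sup>2 = energy v k" and q2: "q\<^sup>2 = energy v (k - 1)"
    by (simp_all add: p_def q_def energy_def power_mult_distrib power2_eq_square half[symmetric] x_def y_def)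
  have "y powr (-\<alpha>) * \<rho>\<^sup>2 = \<rho> powr (2 - \<alpha> / 2) * (y powr (-\<alpha> / 2) * x powr (-\<alpha> / 2))"
  proof -
    have "\<rho> powr (2 - \<alpha> / 2) = \<rho>\<^sup>2 * \<rho> powr (-\<alpha> / 2)"
      using \<rho>(2) powr_add[of \<rho> 2 "-\<alpha> / 2"] by simp
    moreover have "\<rho> powr (-\<alpha> / 2) * x powr (-\<alpha> / 2) = y powr (-\<alpha> / 2)"
      using pos \<rho> powr_mult[of \<rho> x "-\<alpha> / 2"] by simp
    ultimately show ?thesis by (simp add: half[of y, symmetric])
  qed
  then have e: "\<beta> * y powr (-\<alpha>) * (\<rho> / (1 + \<rho>)) * \<rho> = offdiag k * (y powr (-\<alpha> / 2) * x powr (-\<alpha> / 2))"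
    unfolding offdiag_def \<rho>_def[symmetric] by (simp add: power2_eq_square mult_ac)
  have "incr v (k - 1) \<bullet> incr v k \<le> norm (incr v (k - 1)) * norm (incr v k)"
    using norm_cauchy_schwarz .
  then have "\<beta> * y powr (-\<alpha>) * (\<rho> / (1 + \<rho>)) * \<rho> * (incr v (k - 1) \<bullet> incr v k)
     \<le> offdiag k * (y powr (-\<alpha> / 2) * x powr (-\<alpha> / 2)) * (norm (incr v (k - 1)) * norm (incr v k))"
    unfolding e using offdiag_nonneg[OF k] by (intro mult_left_mono) auto
  also have "\<dots> = offdiag k * (p * q)" by (simp add: p_def q_def)
  also have "\<dots> \<le> offdiag k * ((p\<^sup>2 + q\<^sup>2) / 2)"
    using offdiag_nonneg[OF k] sum_squares_bound[of p q] by (intro mult_left_mono) auto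
  finally show ?thesis unfolding p2 q2 y_def by simp
qed

lemma diagonal_absorbs_offdiag:
  assumes "1 \<le> k"
  defines "\<rho> \<equiv> step t k / step t (k - 1)"
  shows "39 / 20 + offdiag (Suc k) + (if k = 1 then 0 else offdiag k)
    \<le> 2 / (1 - \<alpha>) + (if k = 1 then 0 else 2 * \<beta> * (\<rho> / (1 + \<rho>)))"
proof -
  have r: "0 < step t (Suc k) / step t k" "step t (Suc k) / step t k \<le> rho_R"
    using step_pos[of k] step_Suc_pos[of k] mesh_ratio[of k] assms by auto
  show ?thesis
  proof (cases "k = 1")
    case True
    then show ?thesis using diagonal_margin(1)[OF alpha r] by (simp add: offdiag_def \<beta>_def)
  next
    case False
    then have k: "Suc (k - 1) = k" "1 \<le> k - 1" using assms by auto
    have \<rho>: "0 < \<rho>" "\<rho> \<le> rho_R"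
      using step_pos[of k] step_pos[of "k - 1"] mesh_ratio[of "k - 1"] k assms by (auto simp: \<rho>_def)
    have "39 / 20 \<le> 2 / (1 - \<alpha>) + 2 * \<beta> * (\<rho> / (1 + \<rho>)) - offdiag k - offdiag (Suc k)"
      using diagonal_margin(2)[OF alpha r \<rho>, folded \<beta>_def] by (simp add: offdiag_def \<rho>_def)
    then show ?thesis using False by simp
  qed
qed

text \<open>What row \<open>k\<close> takes from the energy of increment \<open>k - 1\<close>; row \<open>k - 1\<close> has set it aside, so that these terms telescope.\<close>

definition carry :: "(nat \<Rightarrow> 'v::real_inner) \<Rightarrow> nat \<Rightarrow> real" where
  "carry v k = (if k \<le> 1 then 0 else offdiag k / 2 * energy v (k - 1))"

lemma L2_operator_row:
  fixes v :: "nat \<Rightarrow> 'v::real_inner"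
  assumes k: "1 \<le> k"
  shows "(\<Sum>j=1..k. history k j * (incr v j \<bullet> incr v k)) - history k k / 2 * (norm (incr v k))\<^sup>2
      + energy v k / 40 + carry v (Suc k) - carry v k
    \<le> Gamma (1 - \<alpha>) * (L2_operator \<alpha> t v k \<bullet> incr v k)"
proof -
  let ?n = "(norm (incr v k))\<^sup>2" and ?y = "step t k powr (-\<alpha>)" and ?lm = "left_moment (ker k) (k - 1)"
  define \<rho> where "\<rho> = step t k / step t (k - 1)"
  define D where "D = ?y / (1 - \<alpha>) + (if k = 1 then 0 else \<beta> * ?y * (\<rho> / (1 + \<rho>)))"
  define O' where "O' = (if k = 1 then 0 else \<beta> * ?y * (\<rho> / (1 + \<rho>)) * \<rho> * (incr v (k - 1) \<bullet> incr v k))"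
  define H where "H = (\<Sum>j=1..k-1. history k j * (incr v j \<bullet> incr v k))"
  have lm: "0 \<le> ?lm" using k by (intro left_moment_nonneg ker_convex) auto
  have split: "(\<Sum>j=1..k. history k j * (incr v j \<bullet> incr v k)) = H + history k k * ?n"
    using k by (cases k) (auto simp: H_def power2_norm_eq_inner)
  have row: "Gamma (1 - \<alpha>) * (L2_operator \<alpha> t v k \<bullet> incr v k) = H + ?lm * ?n + D * ?n - O'"
  proof (cases "k = 1")
    case True
    have "Gamma (1 - \<alpha>) * (L2_operator \<alpha> t v 1 \<bullet> incr v 1) = (Gamma (1 - \<alpha>) *\<^sub>R L2_operator \<alpha> t v 1) \<bullet> incr v 1"
      by simp
    also have "\<dots> = (step t 1 powr (-\<alpha>) / (1 - \<alpha>)) * (norm (incr v 1))\<^sup>2"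
      unfolding L2_operator_1 by (simp add: power2_norm_eq_inner)
    finally show ?thesis using True by (simp add: H_def D_def O'_def left_moment_def)
  next
    case False
    then have k2: "2 \<le> k" using k by simp
    have H: "H = (\<Sum>j=1..k-1. wavg (ker k) j * (incr v j \<bullet> incr v k))"
      unfolding H_def by (intro sum.cong) (auto simp: history_def)
    have "Gamma (1 - \<alpha>) * (L2_operator \<alpha> t v k \<bullet> incr v k) = (Gamma (1 - \<alpha>) *\<^sub>R L2_operator \<alpha> t v k) \<bullet> incr v k"
      by simp
    also have "\<dots> = H + (?lm + ?y / (1 - \<alpha>)) * ?n
        + \<beta> * ?y * (\<rho> / (1 + \<rho>)) * (?n - \<rho> * (incr v (k - 1) \<bullet> incr v k))"
      unfolding L2_operator_eq[OF k2] \<rho>_def[symmetric] H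
      by (simp only: inner_add_left inner_sum_left inner_scaleR_left inner_diff_left power2_norm_eq_inner)
    finally show ?thesis using False by (simp only: D_def O'_def if_False) (simp add: algebra_simps)
  qed
  have off: "O' \<le> (if k = 1 then 0 else offdiag k) / 2 * energy v k + carry v k"
    using offdiag_bound[of k v] k by (auto simp: O'_def carry_def \<rho>_def distrib_left)
  have hist: "history k k \<le> ?lm + 19 / 10 * ?y"
    using history_diag_le[of "k - 1"] k by simp
  have "(39 / 20 + offdiag (Suc k) + (if k = 1 then 0 else offdiag k)) * ?y
     \<le> (2 / (1 - \<alpha>) + (if k = 1 then 0 else 2 * \<beta> * (\<rho> / (1 + \<rho>)))) * ?y"
    using diagonal_absorbs_offdiag[OF k, folded \<rho>_def] by (intro mult_right_mono) auto
  also have "\<dots> = 2 * D" by (simp add: D_def algebra_simps)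
  finally have "(39 / 20 + offdiag (Suc k) + (if k = 1 then 0 else offdiag k)) * ?y \<le> 2 * D" .
  then have D: "history k k / 2 + (1 / 40 + offdiag (Suc k) / 2 + (if k = 1 then 0 else offdiag k) / 2) * ?y
     \<le> ?lm + D"
    using hist lm by argo
  have "history k k / 2 * ?n + (1 / 40 + offdiag (Suc k) / 2 + (if k = 1 then 0 else offdiag k) / 2) * energy v k
     \<le> (?lm + D) * ?n"
    using mult_right_mono[OF D, of ?n] unfolding energy_def by (simp only: distrib_right mult.assoc) simp
  moreover have "carry v (Suc k) = offdiag (Suc k) / 2 * energy v k" using k by (simp add: carry_def)
  ultimately show ?thesis unfolding row split using off by argo
qed

theorem L2_operator_coercive:
  fixes v :: "nat \<Rightarrow> 'v::real_inner"
  shows "(\<Sum>k=1..n. energy v k) / 40 \<le> Gamma (1 - \<alpha>) * (\<Sum>k=1..n. L2_operator \<alpha> t v k \<bullet> incr v k)"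
proof -
  have tele: "(\<Sum>k=1..n. carry v (Suc k) - carry v k) = carry v (Suc n)"
    by (induction n) (auto simp: carry_def)
  have "0 \<le> carry v (Suc n)"
    using offdiag_nonneg[of "Suc n"] energy_nonneg[of v n] by (simp add: carry_def)
  then have "(\<Sum>k=1..n. energy v k) / 40 \<le> (\<Sum>k=1..n. \<Sum>j=1..k. history k j * (incr v j \<bullet> incr v k))
      - (\<Sum>k=1..n. history k k / 2 * (norm (incr v k))\<^sup>2) + (\<Sum>k=1..n. energy v k) / 40
      + (\<Sum>k=1..n. carry v (Suc k) - carry v k)"
    using history_form_ge[where n = n and x = "incr v"] tele by simp
  also have "\<dots> = (\<Sum>k=1..n. (\<Sum>j=1..k. history k j * (incr v j \<bullet> incr v k))
      - history k k / 2 * (norm (incr v k))\<^sup>2 + energy v k / 40 + (carry v (Suc k) - carry v k))"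
    by (simp add: sum.distrib sum_subtractf sum_divide_distrib)
  also have "\<dots> \<le> (\<Sum>k=1..n. Gamma (1 - \<alpha>) * (L2_operator \<alpha> t v k \<bullet> incr v k))"
    using L2_operator_row[of _ v] by (intro sum_mono) (simp add: add_diff_eq)
  finally show ?thesis by (simp add: sum_distrib_left)
qed

end

section \<open>Truncation error of the L2 operator\<close>

lemma abs_difference_le:
  fixes f :: "real \<Rightarrow> real"
  assumes "a \<le> b" "continuous_on {a..b} f"
    and "\<And>x. a < x \<Longrightarrow> x < b \<Longrightarrow> (f has_real_derivative f' x) (at x)"
    and "\<And>x. a < x \<Longrightarrow> x < b \<Longrightarrow> \<bar>f' x\<bar> \<le> B"
  shows "\<bar>f b - f a\<bar> \<le> B * (b - a)"
proof (cases "a = b")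
  case False
  then have ab: "a < b" using assms(1) by simp
  obtain l z where z: "a < z" "z < b" "(f has_real_derivative l) (at z)" "f b - f a = (b - a) * l"
    using MVT[OF ab assms(2)] assms(3) real_differentiable_def by blast
  have "l = f' z" using DERIV_unique[OF z(3) assms(3)[OF z(1,2)]] .
  then have "\<bar>l\<bar> \<le> B" using assms(4) z by simp
  then show ?thesis unfolding z(4) using ab by (simp add: abs_mult mult.commute)
qed simp

text \<open>By Rolle's theorem the error has a critical point between any two neighbouring nodes, and its second derivative vanishes between
those. Integrating the third derivative twice from these points costs the length of the interval each time.\<close>

lemma quadratic_interpolation_derivative_error:
  fixes H H1 g g1 g2 g3 :: "real \<Rightarrow> real"
  assumes x: "x0 < x1" "x1 < x2"
    and H: "\<And>s. (H has_real_derivative H1 s) (at s)" "\<And>s. (H1 has_real_derivative c) (at s)"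
    and nodes: "H x0 = g x0" "H x1 = g x1" "H x2 = g x2"
    and cont: "continuous_on {x0..x2} g" "continuous_on {x0..x2} g1"
    and d: "\<And>s. x0 < s \<Longrightarrow> s < x2 \<Longrightarrow> (g has_real_derivative g1 s) (at s)"
      "\<And>s. x0 < s \<Longrightarrow> s < x2 \<Longrightarrow> (g1 has_real_derivative g2 s) (at s)"
      "\<And>s. x0 < s \<Longrightarrow> s < x2 \<Longrightarrow> (g2 has_real_derivative g3 s) (at s)"
    and M: "\<And>s. x0 < s \<Longrightarrow> s < x2 \<Longrightarrow> \<bar>g3 s\<bar> \<le> M"
    and s: "x0 \<le> s" "s \<le> x2"
  shows "\<bar>H1 s - g1 s\<bar> \<le> M * (x2 - x0)\<^sup>2"
proof -
  have cH: "continuous_on A H" "continuous_on A H1" for A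
    using H by (auto intro!: continuous_at_imp_continuous_on DERIV_isCont)
  have e1: "((\<lambda>s. H s - g s) has_real_derivative H1 s - g1 s) (at s)" if "x0 < s" "s < x2" for s
    using that by (intro DERIV_diff H d)
  have e2: "((\<lambda>s. H1 s - g1 s) has_real_derivative c - g2 s) (at s)" if "x0 < s" "s < x2" for s
    using that by (intro DERIV_diff H d)
  have e3: "((\<lambda>s. c - g2 s) has_real_derivative - g3 s) (at s)" if "x0 < s" "s < x2" for s
    using DERIV_diff[OF DERIV_const d(3)[OF that], of c] by simp
  have M0: "0 \<le> M" using M[OF x] by linarith
  have root: "\<exists>\<xi>. a < \<xi> \<and> \<xi> < b \<and> H1 \<xi> = g1 \<xi>" if ab: "x0 \<le> a" "a < b" "b \<le> x2" "H a = g a" "H b = g b" for a b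
  proof -
    have "continuous_on {a..b} (\<lambda>s. H s - g s)"
      using ab by (intro continuous_on_diff cH continuous_on_subset[OF cont(1)]) auto
    then obtain \<xi> where \<xi>: "a < \<xi>" "\<xi> < b" "((\<lambda>s. H s - g s) has_real_derivative 0) (at \<xi>)"
      using Rolle[OF ab(2), of "\<lambda>s. H s - g s"] ab e1 real_differentiable_def
      by (metis (no_types, lifting) diff_self order.strict_trans1 order.strict_trans2)
    with DERIV_unique[OF \<xi>(3) e1[of \<xi>]] ab show ?thesis by (intro exI[of _ \<xi>]) auto
  qed
  obtain \<xi>1 where \<xi>1: "x0 < \<xi>1" "\<xi>1 < x1" "H1 \<xi>1 = g1 \<xi>1" using root[of x0 x1] x nodes by auto
  obtain \<xi>2 where \<xi>2: "x1 < \<xi>2" "\<xi>2 < x2" "H1 \<xi>2 = g1 \<xi>2" using root[of x1 x2] x nodes by auto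
  have c1: "continuous_on {a..b} (\<lambda>s. H1 s - g1 s)" if "x0 \<le> a" "b \<le> x2" for a b
    using that by (intro continuous_on_diff cH continuous_on_subset[OF cont(2)]) auto
  obtain \<eta> where \<eta>: "\<xi>1 < \<eta>" "\<eta> < \<xi>2" "((\<lambda>s. H1 s - g1 s) has_real_derivative 0) (at \<eta>)"
  proof -
    have "\<xi>1 < \<xi>2" using \<xi>1 \<xi>2 by simp
    moreover have "(\<lambda>s. H1 s - g1 s) differentiable (at s)" if "\<xi>1 < s" "s < \<xi>2" for s
      using e2[of s] that \<xi>1 \<xi>2 real_differentiable_def by auto
    ultimately show thesis
      using Rolle[of \<xi>1 \<xi>2 "\<lambda>s. H1 s - g1 s"] c1[of \<xi>1 \<xi>2] \<xi>1 \<xi>2 that by auto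
  qed
  have \<eta>in: "x0 < \<eta>" "\<eta> < x2" using \<eta> \<xi>1 \<xi>2 by auto
  have \<eta>0: "c - g2 \<eta> = 0" using DERIV_unique[OF \<eta>(3) e2[OF \<eta>in]] by simp
  have c2: "continuous_on {a..b} (\<lambda>s. c - g2 s)" if "x0 < a" "b < x2" for a b
    using that e3 by (intro continuous_at_imp_continuous_on ballI DERIV_isCont[OF e3]) auto
  have second: "\<bar>c - g2 y\<bar> \<le> M * (x2 - x0)" if y: "x0 < y" "y < x2" for y
  proof (cases "\<eta> \<le> y")
    case True
    have "\<bar>(c - g2 y) - (c - g2 \<eta>)\<bar> \<le> M * (y - \<eta>)"
      using True y \<eta>in M by (intro abs_difference_le[where f' = "\<lambda>s. - g3 s"] c2 e3) auto
    also have "\<dots> \<le> M * (x2 - x0)" using M0 y \<eta>in by (intro mult_left_mono) auto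
    finally show ?thesis using \<eta>0 by simp
  next
    case False
    have "\<bar>(c - g2 \<eta>) - (c - g2 y)\<bar> \<le> M * (\<eta> - y)"
      using False y \<eta>in M by (intro abs_difference_le[where f' = "\<lambda>s. - g3 s"] c2 e3) auto
    also have "\<dots> \<le> M * (x2 - x0)" using M0 y \<eta>in by (intro mult_left_mono) auto
    finally show ?thesis using \<eta>0 by simp
  qed
  have B0: "0 \<le> M * (x2 - x0)" using M0 x by simp
  have "\<bar>H1 s - g1 s\<bar> \<le> M * (x2 - x0) * (x2 - x0)"
  proof (cases "\<xi>1 \<le> s")
    case True
    have "\<bar>(H1 s - g1 s) - (H1 \<xi>1 - g1 \<xi>1)\<bar> \<le> M * (x2 - x0) * (s - \<xi>1)"
      using True s \<xi>1 second by (intro abs_difference_le[where f' = "\<lambda>s. c - g2 s"] c1 e2) auto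
    also have "\<dots> \<le> M * (x2 - x0) * (x2 - x0)" using B0 s \<xi>1 by (intro mult_left_mono) auto
    finally show ?thesis using \<xi>1 by simp
  next
    case False
    have "\<bar>(H1 \<xi>1 - g1 \<xi>1) - (H1 s - g1 s)\<bar> \<le> M * (x2 - x0) * (\<xi>1 - s)"
      using False s \<xi>1 x second by (intro abs_difference_le[where f' = "\<lambda>s. c - g2 s"] c1 e2) auto
    also have "\<dots> \<le> M * (x2 - x0) * (x2 - x0)" using B0 s \<xi>1 x by (intro mult_left_mono) auto
    finally show ?thesis using \<xi>1 by simp
  qed
  then show ?thesis by (simp add: power2_eq_square)
qed

text \<open>The constant \<open>K a\<close> may be subtracted from the kernel because \<open>D\<close> has mean zero, which leaves the increment of the kernel. The majorant
\<open>m\<close> is a function since the derivative of the solution is unbounded on the first interval.\<close>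

lemma zero_mean_kernel_integral_bound:
  fixes K D m :: "real \<Rightarrow> real"
  assumes ab: "a \<le> b" and D: "(D has_integral 0) {a..b}"
    and KD: "(\<lambda>s. K s * D s) integrable_on {a..b}"
    and K: "\<And>s. s \<in> {a..b} \<Longrightarrow> K a \<le> K s" "\<And>s. s \<in> {a..b} \<Longrightarrow> K s \<le> K b"
    and m: "(m has_integral X) {a..b}" "\<And>s. s \<in> {a..b} \<Longrightarrow> \<bar>D s\<bar> \<le> m s"
  shows "\<bar>integral {a..b} (\<lambda>s. K s * D s)\<bar> \<le> (K b - K a) * X"
proof -
  have 1: "((\<lambda>s. K s * D s - K a * D s) has_integral (integral {a..b} (\<lambda>s. K s * D s) - K a * 0)) {a..b}"
    by (intro has_integral_diff has_integral_mult_right integrable_integral KD D)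
  have 2: "((\<lambda>s. (K b - K a) * m s) has_integral ((K b - K a) * X)) {a..b}"
    by (intro has_integral_mult_right m)
  have "norm (integral {a..b} (\<lambda>s. K s * D s - K a * D s)) \<le> integral {a..b} (\<lambda>s. (K b - K a) * m s)"
  proof (rule integral_norm_bound_integral)
    fix s assume s: "s \<in> {a..b}"
    have "\<bar>K s - K a\<bar> * \<bar>D s\<bar> \<le> (K b - K a) * m s"
      using K[OF s] m(2)[OF s] by (intro mult_mono) auto
    then show "norm (K s * D s - K a * D s) \<le> (K b - K a) * m s"
      by (simp add: left_diff_distrib[symmetric] abs_mult)
  qed (use has_integral_integrable[OF 1] has_integral_integrable[OF 2] in auto)
  then show ?thesis unfolding integral_unique[OF 1] integral_unique[OF 2] by simp
qed

lemma has_integral_one_plus_power: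
  assumes "0 < \<alpha>" "0 \<le> a"
  shows "((\<lambda>s. 1 + s powr (\<alpha> - 1)) has_integral (a + a powr \<alpha> / \<alpha>)) {0..a::real}"
  using has_integral_add[OF has_integral_const_real[of 1 0 a] has_integral_powr_from_0[of "\<alpha> - 1" a]] assms
  by simp

context subdiffusion_mesh
begin

lemma ker_mono: "t (j - 1) \<le> r \<Longrightarrow> r \<le> s \<Longrightarrow> s \<le> t j \<Longrightarrow> j < k \<Longrightarrow> ker k r \<le> ker k s"
  using convex_kernel_mono[OF ker_convex[of j k], of r s] mesh_nonneg[of "j - 1"] by simp

lemma ker_increment_le:
  assumes "j < k"
  shows "ker k (t j) - ker k (t (j - 1)) \<le> \<alpha> * step t j * (t k - t j) powr (- \<alpha> - 1)"
proof -
  let ?a = "t (j - 1)" and ?b = "t j"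
  have ab: "?a \<le> ?b" by (rule mesh_le) simp
  have bk: "?b < t k" using mesh_less[of j] mesh_le[of "Suc j" k] assms by simp
  have d: "(ker k has_real_derivative \<alpha> * (t k - s) powr (- \<alpha> - 1)) (at s)" if "s \<le> ?b" for s
    unfolding ker_def using that bk by (intro DERIV_power_kernel) simp
  have "\<bar>ker k ?b - ker k ?a\<bar> \<le> \<alpha> * (t k - ?b) powr (- \<alpha> - 1) * (?b - ?a)"
  proof (rule abs_difference_le[OF ab, where f' = "\<lambda>s. \<alpha> * (t k - s) powr (- \<alpha> - 1)"])
    show "continuous_on {?a..?b} (ker k)" using ker_cont[OF assms] .
    fix s assume s: "?a < s" "s < ?b"
    show "(ker k has_real_derivative \<alpha> * (t k - s) powr (- \<alpha> - 1)) (at s)" using d s by simp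
    show "\<bar>\<alpha> * (t k - s) powr (- \<alpha> - 1)\<bar> \<le> \<alpha> * (t k - ?b) powr (- \<alpha> - 1)"
      using s bk alpha by (simp add: powr_mono2')
  qed
  then show ?thesis by (simp add: step_def mult_ac)
qed

end

text \<open>The function \<open>g\<close> stands for an inner product of the exact solution with a fixed element. At time zero \<open>g1\<close> is only a bounded default
value, and the derivatives are those of \<open>g\<close> for positive times.\<close>

locale scalar_curve = subdiffusion_mesh t \<alpha> for t \<alpha> +
  fixes g g1 g2 g3 :: "real \<Rightarrow> real" and T K1 K3 :: real
  assumes cont: "continuous_on {0..T} g" "continuous_on {0<..T} g1"
    and deriv1: "\<And>s. 0 < s \<Longrightarrow> s < T \<Longrightarrow> (g has_real_derivative g1 s) (at s)"
    and deriv2: "\<And>s. 0 < s \<Longrightarrow> s < T \<Longrightarrow> (g1 has_real_derivative g2 s) (at s)"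
    and deriv3: "\<And>s. 0 < s \<Longrightarrow> s < T \<Longrightarrow> (g2 has_real_derivative g3 s) (at s)"
    and bound1: "\<And>s. 0 \<le> s \<Longrightarrow> s \<le> T \<Longrightarrow> \<bar>g1 s\<bar> \<le> K1 * (1 + s powr (\<alpha> - 1))"
    and bound3: "\<And>s. 0 < s \<Longrightarrow> s \<le> T \<Longrightarrow> \<bar>g3 s\<bar> \<le> K3 * (1 + s powr (\<alpha> - 3))"
    and K_nonneg: "0 \<le> K1" "0 \<le> K3"
begin

definition nodal :: "nat \<Rightarrow> real" where "nodal i = g (t i)"

definition slope :: "nat \<Rightarrow> real \<Rightarrow> real" where
  "slope j s = incr nodal j / step t j + (2 * s - t (j - 1) - t j) * curv nodal j"

text \<open>The derivative of the interpolation error.\<close>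

definition defect :: "nat \<Rightarrow> real \<Rightarrow> real" where
  "defect j s = slope j s - g1 s"

lemma slope_deriv:
  assumes "1 \<le> j"
  shows "(lagrange2 t nodal j has_real_derivative slope j s) (at s)"
proof -
  obtain i where i: "j = Suc i" using assms by (cases j) auto
  have "step t j + step t (Suc j) = t (j + 1) - t (j - 1)" by (simp add: step_def)
  then show ?thesis
    using lagrange2_derivative[of t j, OF refl refl refl, of nodal s] mesh_less[of i] mesh_less[of j] i
    by (simp add: incr_def curv_def step_def slope_def has_real_derivative_iff_has_vector_derivative)
qed

lemma lagrange2_nodes:
  assumes "1 \<le> j"
  shows "lagrange2 t nodal j (t (j - 1)) = g (t (j - 1))" "lagrange2 t nodal j (t j) = g (t j)"
    "lagrange2 t nodal j (t (Suc j)) = g (t (Suc j))"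
proof -
  obtain i where i: "j = Suc i" using assms by (cases j) auto
  have "t i < t j" "t j < t (Suc j)" using mesh_less i by auto
  then show "lagrange2 t nodal j (t (j - 1)) = g (t (j - 1))" "lagrange2 t nodal j (t j) = g (t j)"
    "lagrange2 t nodal j (t (Suc j)) = g (t (Suc j))"
    using i by (auto simp: lagrange2_def nodal_def)
qed

lemma slope_continuous: "continuous_on A (slope j)"
  unfolding slope_def by (intro continuous_intros)

lemma defect_has_integral_0:
  assumes j: "1 \<le> j" and T: "t (Suc j) \<le> T"
  shows "(defect j has_integral 0) {t (j - 1)..t j}"
proof -
  have jT: "t j \<le> T" using mesh_le[of j "Suc j"] T by simp
  have "(defect j has_integral ((lagrange2 t nodal j (t j) - g (t j))
      - (lagrange2 t nodal j (t (j - 1)) - g (t (j - 1))))) {t (j - 1)..t j}"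
  proof (rule fundamental_theorem_of_calculus_interior)
    show "t (j - 1) \<le> t j" by (rule mesh_le) simp
    show "continuous_on {t (j - 1)..t j} (\<lambda>s. lagrange2 t nodal j s - g s)"
      using mesh_nonneg[of "j - 1"] jT slope_deriv[OF j]
      by (intro continuous_on_diff continuous_on_subset[OF cont(1)])
         (auto intro!: continuous_at_imp_continuous_on DERIV_isCont)
    fix s assume "s \<in> {t (j - 1)<..<t j}"
    then have "0 < s" "s < T" using mesh_nonneg[of "j - 1"] jT by auto
    then show "((\<lambda>s. lagrange2 t nodal j s - g s) has_vector_derivative defect j s) (at s)"
      unfolding defect_def has_real_derivative_iff_has_vector_derivative[symmetric]
      by (intro DERIV_diff slope_deriv j deriv1)
  qed
  then show ?thesis using lagrange2_nodes[OF j] by simp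
qed

lemma defect_bound:
  assumes j: "2 \<le> j" and T: "t (Suc j) \<le> T" and s: "t (j - 1) \<le> s" "s \<le> t (Suc j)"
  shows "\<bar>defect j s\<bar> \<le> K3 * (1 + t (j - 1) powr (\<alpha> - 3)) * (step t j + step t (Suc j))\<^sup>2"
proof -
  obtain i where i: "j = Suc (Suc i)" using j by (metis add_2_eq_Suc le_Suc_ex)
  have pos: "0 < t (j - 1)" using mesh_less[of i] mesh_nonneg[of i] i by simp
  have "\<bar>slope j s - g1 s\<bar> \<le> K3 * (1 + t (j - 1) powr (\<alpha> - 3)) * (t (Suc j) - t (j - 1))\<^sup>2"
  proof (rule quadratic_interpolation_derivative_error[where H = "lagrange2 t nodal j" and g = g
        and c = "2 * curv nodal j" and ?x1.0 = "t j" and ?H1.0 = "slope j" and ?g1.0 = g1 and ?g2.0 = g2 and ?g3.0 = g3])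
    show "t (j - 1) < t j" "t j < t (Suc j)" using mesh_less i by auto
    show "(lagrange2 t nodal j has_real_derivative slope j s) (at s)" for s
      using slope_deriv[of j] j by simp
    show "(slope j has_real_derivative 2 * curv nodal j) (at s)" for s
      unfolding slope_def by (auto intro!: derivative_eq_intros)
    show "continuous_on {t (j - 1)..t (Suc j)} g" "continuous_on {t (j - 1)..t (Suc j)} g1"
      using pos T by (auto intro!: continuous_on_subset[OF cont(1)] continuous_on_subset[OF cont(2)])
    fix s assume s: "t (j - 1) < s" "s < t (Suc j)"
    then have sT: "0 < s" "s < T" using pos T by auto
    show "(g has_real_derivative g1 s) (at s)" "(g1 has_real_derivative g2 s) (at s)"
      "(g2 has_real_derivative g3 s) (at s)" using deriv1 deriv2 deriv3 sT by auto
    have "s powr (\<alpha> - 3) \<le> t (j - 1) powr (\<alpha> - 3)"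
      using pos s alpha by (intro powr_mono2') auto
    then have "K3 * (1 + s powr (\<alpha> - 3)) \<le> K3 * (1 + t (j - 1) powr (\<alpha> - 3))"
      using K_nonneg by (intro mult_left_mono) auto
    then show "\<bar>g3 s\<bar> \<le> K3 * (1 + t (j - 1) powr (\<alpha> - 3))" using bound3[of s] sT by simp
  qed (use s lagrange2_nodes[of j] j in auto)
  also have "t (Suc j) - t (j - 1) = step t j + step t (Suc j)" by (simp add: step_def)
  finally show ?thesis by (simp add: defect_def)
qed

end

context ratio_mesh
begin

lemma step_Suc_le: "1 \<le> k \<Longrightarrow> step t (Suc k) \<le> 4 * step t k"
proof -
  assume k: "1 \<le> k"
  have "step t (Suc k) \<le> rho_R * step t k"
    using mesh_ratio[OF k] step_pos[OF k] by (simp add: pos_divide_le_eq)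
  also have "\<dots> \<le> 4 * step t k"
    using rho_R_bounds step_pos[OF k] by (intro mult_right_mono) auto
  finally show ?thesis .
qed

lemma step_le_Suc: "1 \<le> k \<Longrightarrow> step t k \<le> 11 / 5 * step t (Suc k)"
proof -
  assume k: "1 \<le> k"
  have "457 / 1000 * step t k \<le> rho_L * step t k"
    using rho_L_bounds step_pos[OF k] by (intro mult_right_mono) auto
  also have "\<dots> \<le> step t (Suc k)"
    using mesh_ratio[OF k] step_pos[OF k] by (simp add: pos_le_divide_eq)
  finally show ?thesis using step_pos[OF k] by argo
qed

lemma step_1: "step t 1 = t 1" "step t (Suc 0) = t (Suc 0)"
  by (simp_all add: step_def mesh_0)

lemma integral_mesh_split:
  fixes f :: "real \<Rightarrow> real"
  assumes "f integrable_on {0..t m}"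
  shows "integral {0..t m} f = (\<Sum>j=1..m. integral {t (j - 1)..t j} f)"
  using assms
proof (induction m)
  case 0
  then show ?case by (simp add: mesh_0)
next
  case (Suc m)
  have le: "0 \<le> t m" "t m \<le> t (Suc m)" using mesh_nonneg mesh_less[of m] by auto
  have "f integrable_on {0..t m}"
    by (rule integrable_on_subinterval[OF Suc.prems]) (use le in auto)
  with Suc.IH have "integral {0..t m} f = (\<Sum>j=1..m. integral {t (j - 1)..t j} f)" by blast
  then show ?case using Henstock_Kurzweil_Integration.integral_combine[OF le Suc.prems] by simp
qed

end

context subdiffusion_mesh
begin

definition middle :: "nat \<Rightarrow> nat \<Rightarrow> real" where
  "middle k j = step t j ^ 4 * (1 + t (j - 1) powr (\<alpha> - 3)) * (t k - t j) powr (-\<alpha> - 1)"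

text \<open>The bracket of the error estimate at level \<open>k\<close>.\<close>

definition consistency :: "nat \<Rightarrow> real" where
  "consistency k = step t 1 powr \<alpha> * (t k - t 1) powr (-\<alpha>)
     + (\<Sum>j=2..k-1. middle k j)
     + step t k powr (3 - \<alpha>) * (1 + t (k - 1) powr (\<alpha> - 3))"

lemma consistency_sum_nonneg:
  "0 \<le> (\<Sum>j=2..k-1. middle k j)"
  using step_pos unfolding middle_def by (intro sum_nonneg mult_nonneg_nonneg) (auto intro: less_imp_le)

lemma consistency_ge_first: "step t 1 powr \<alpha> * (t k - t 1) powr (-\<alpha>) \<le> consistency k" (is "?a \<le> _")
  and consistency_ge_sum: "(\<Sum>j=2..k-1. middle k j) \<le> consistency k" (is "?b \<le> _")
  and consistency_ge_last: "step t k powr (3 - \<alpha>) * (1 + t (k - 1) powr (\<alpha> - 3)) \<le> consistency k" (is "?c \<le> _")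
  and consistency_nonneg: "0 \<le> consistency k"
proof -
  have "0 \<le> ?a" "0 \<le> ?c" by simp_all
  with consistency_sum_nonneg[of k]
  show "?a \<le> consistency k" "?b \<le> consistency k" "?c \<le> consistency k" "0 \<le> consistency k"
    unfolding consistency_def by linarith+
qed

text \<open>Up to a constant, the size of the first increment allowed by the bound on the first derivative: its two terms come from the two terms of
\<open>1 + s powr (\<alpha> - 1)\<close>.\<close>

definition start :: real where
  "start = step t 1 + step t 1 powr \<alpha>"

lemma start_nonneg: "0 \<le> start"
  using step_pos[of 1] by (simp add: start_def)

lemma start_le_small: "step t 1 \<le> 1 \<Longrightarrow> start \<le> 2 * step t 1 powr \<alpha>"
  using powr_mono'[of \<alpha> 1 "step t 1"] alpha step_pos[of 1] by (simp add: start_def)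

lemma start_le_large: "1 \<le> step t 1 \<Longrightarrow> start \<le> 2 * step t 1"
  using powr_mono[of \<alpha> 1 "step t 1"] alpha by (simp add: start_def)

lemma start_le_consistency_2: "step t 2 powr (-\<alpha>) * start \<le> 22 * consistency 2"
proof (cases "step t 1 \<le> 1")
  case True
  have "t 2 - t 1 = step t 2" by (simp add: step_def)
  then have "step t 2 powr (-\<alpha>) * (2 * step t 1 powr \<alpha>) \<le> 2 * consistency 2"
    using consistency_ge_first[of 2] by (simp add: mult.commute)
  moreover have "step t 2 powr (-\<alpha>) * start \<le> step t 2 powr (-\<alpha>) * (2 * step t 1 powr \<alpha>)"
    using start_le_small[OF True] by (intro mult_left_mono) auto
  ultimately show ?thesis using consistency_nonneg[of 2] by simp
next
  case False
  let ?x = "step t 1" and ?y = "step t 2"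
  have xy: "?x \<le> 11 / 5 * ?y" "0 < ?y" using step_le_Suc[of 1] step_pos[of 2] by (simp_all add: numeral_2_eq_2)
  have "?x \<le> ?x ^ 3" using False power_increasing[of 1 3 ?x] by simp
  also have "\<dots> \<le> (11 / 5 * ?y) ^ 3" using False xy by (intro power_mono) auto
  also have "\<dots> = 1331 / 125 * ?y ^ 3" by (simp add: power_mult_distrib power_divide)
  also have "\<dots> \<le> 11 * ?y ^ 3" using xy by simp
  finally have "start \<le> 22 * ?y ^ 3" using start_le_large False by simp
  then have "?y powr (-\<alpha>) * start \<le> ?y powr (-\<alpha>) * (22 * ?y ^ 3)" by (intro mult_left_mono) auto
  also have "\<dots> = 22 * ?y powr (3 - \<alpha>)"
    using powr_add[of ?y "-\<alpha>" 3] xy by (simp add: powr_realpow[of ?y 3, simplified])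
  also have "\<dots> \<le> 22 * (?y powr (3 - \<alpha>) * (1 + t 1 powr (\<alpha> - 3)))"
    by (simp add: distrib_left)
  also have "\<dots> \<le> 22 * consistency 2" using consistency_ge_last[of 2] by simp
  finally show ?thesis .
qed

text \<open>For a short first step \<open>start\<close> is of order $\tau_1^\alpha$ and the first term of \<open>consistency\<close> suffices. If the first step is longer than
one, \<open>start\<close> is of order $\tau_1$, and the first term grows too slowly with $\tau_1$. Then, for \<open>k \<ge> 3\<close>, the mean value theorem for
the kernel gives another factor $\tau_1$, and $\tau_1^2 \le \tau_1^4$ is dominated by the term of the second interval; for \<open>k = 2\<close> the last
term dominates $\tau_1 \le \tau_1^3$. In this way the constants are independent of the length of the time interval.\<close>

lemma kernel_increment_start_le:
  assumes k: "2 \<le> k"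
  shows "(ker k (t 1) - ker k (t 0)) * start \<le> 48 * consistency k"
proof -
  have inc: "ker k (t 1) - ker k (t 0) \<le> (t k - t 1) powr (-\<alpha>)"
    by (simp add: ker_def)
  show ?thesis
  proof (cases "k = 2")
    case True
    have "(ker k (t 1) - ker k (t 0)) * start \<le> (t k - t 1) powr (-\<alpha>) * start"
      using inc start_nonneg by (rule mult_right_mono)
    also have "\<dots> = step t 2 powr (-\<alpha>) * start" using True by (simp add: step_def)
    also have "\<dots> \<le> 22 * consistency 2" by (rule start_le_consistency_2)
    finally show ?thesis using True consistency_nonneg[of 2] by simp
  next
    case False
    then have k3: "3 \<le> k" using k by simp
    show ?thesis
    proof (cases "step t 1 \<le> 1")
      case True
      have "(ker k (t 1) - ker k (t 0)) * start \<le> (t k - t 1) powr (-\<alpha>) * start"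
        using inc start_nonneg by (rule mult_right_mono)
      also have "\<dots> \<le> (t k - t 1) powr (-\<alpha>) * (2 * step t 1 powr \<alpha>)"
        using start_le_small[OF True] by (intro mult_left_mono) auto
      also have "\<dots> \<le> 2 * consistency k" using consistency_ge_first[of k] by (simp add: mult.commute)
      finally show ?thesis using consistency_nonneg[of k] by simp
    next
      case large: False
      let ?x = "step t 1" and ?y = "step t 2"
      have xy: "?x \<le> 11 / 5 * ?y" "0 < ?y" using step_le_Suc[of 1] step_pos[of 2] by (simp_all add: numeral_2_eq_2)
      have tk: "t 1 \<le> t 2" "t 2 < t k" using mesh_le[of 1 2] mesh_less[of 2] mesh_le[of 3 k] k3
        by (simp_all add: numeral_3_eq_3 numeral_2_eq_2)
      let ?p = "(t k - t 2) powr (-\<alpha> - 1)"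
      have "(ker k (t 1) - ker k (t 0)) \<le> \<alpha> * ?x * (t k - t 1) powr (-\<alpha> - 1)"
        using ker_increment_le[of 1 k] k by simp
      also have "\<dots> \<le> \<alpha> * ?x * ?p"
        using alpha tk large by (intro mult_left_mono powr_mono2') auto
      also have "\<dots> \<le> 1 * ?x * ?p"
        using alpha large by (intro mult_right_mono) auto
      finally have "(ker k (t 1) - ker k (t 0)) * start \<le> (?x * ?p) * start"
        using start_nonneg by (intro mult_right_mono) auto
      also have "\<dots> \<le> (?x * ?p) * (2 * ?x)"
        using start_le_large large by (intro mult_left_mono) auto
      also have "\<dots> = 2 * ?x ^ 2 * ?p" by (simp add: power2_eq_square)
      also have "\<dots> \<le> 2 * ?x ^ 4 * ?p"
        using large by (intro mult_right_mono mult_left_mono power_increasing) auto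
      also have "\<dots> \<le> 2 * (11 / 5 * ?y) ^ 4 * ?p"
        using large xy by (intro mult_right_mono mult_left_mono power_mono) auto
      also have "\<dots> = 2 * (14641 / 625) * (?y ^ 4 * ?p)" by (simp add: power_mult_distrib power_divide)
      also have "\<dots> \<le> 48 * (?y ^ 4 * ?p)" by (intro mult_right_mono) auto
      also have "\<dots> \<le> 48 * (?y ^ 4 * (1 + t (2 - 1) powr (\<alpha> - 3)) * ?p)"
        using xy by (simp add: mult_left_mono mult_right_mono)
      also have "\<dots> = 48 * middle k 2" by (simp add: middle_def)
      also have "\<dots> \<le> 48 * (\<Sum>j=2..k-1. middle k j)"
        using k3 step_pos
        by (intro mult_left_mono member_le_sum[where f = "middle k"])
           (auto simp: middle_def intro!: mult_nonneg_nonneg intro: less_imp_le)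
      also have "\<dots> \<le> 48 * consistency k" using consistency_ge_sum[of k] by simp
      finally show ?thesis .
    qed
  qed
qed

end

context scalar_curve
begin

lemma g1_integral:
  assumes "t 1 \<le> T"
  shows "(g1 has_integral incr nodal 1) {0..t 1}"
proof -
  have "(g1 has_integral (g (t 1) - g 0)) {0..t 1}"
  proof (rule fundamental_theorem_of_calculus_interior)
    show "continuous_on {0..t 1} g" using assms by (intro continuous_on_subset[OF cont(1)]) auto
    fix s assume "s \<in> {0<..<t 1}"
    then show "(g has_vector_derivative g1 s) (at s)"
      using assms deriv1[of s] by (simp add: has_real_derivative_iff_has_vector_derivative)
  qed (rule mesh_nonneg)
  then show ?thesis by (simp add: incr_def nodal_def mesh_0)
qed

lemma abs_g1_integral_bound:
  shows "((\<lambda>s. K1 * (1 + s powr (\<alpha> - 1))) has_integral (K1 * (step t 1 + step t 1 powr \<alpha> / \<alpha>))) {0..t 1}"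
  using has_integral_mult_right[OF has_integral_one_plus_power[OF alpha(1) mesh_nonneg[of 1]], of K1]
  by (simp add: step_1)

lemma incr_1_bound:
  assumes "t 1 \<le> T"
  shows "\<bar>incr nodal 1\<bar> \<le> K1 * (step t 1 + step t 1 powr \<alpha> / \<alpha>)"
proof -
  have "norm (integral {0..t 1} g1) \<le> integral {0..t 1} (\<lambda>s. K1 * (1 + s powr (\<alpha> - 1)))"
    using g1_integral[OF assms] abs_g1_integral_bound bound1 assms
    by (intro integral_norm_bound_integral) (auto intro: has_integral_integrable)
  then show ?thesis
    unfolding integral_unique[OF g1_integral[OF assms]] integral_unique[OF abs_g1_integral_bound] by simp
qed

lemma g1_bound_after_first:
  assumes "t 1 \<le> s" "s \<le> T"
  shows "\<bar>g1 s\<bar> \<le> K1 * (1 + step t 1 powr (\<alpha> - 1))"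
proof -
  have "s powr (\<alpha> - 1) \<le> t 1 powr (\<alpha> - 1)"
    using assms alpha step_pos[of 1] by (intro powr_mono2') (auto simp: step_1)
  then have "K1 * (1 + s powr (\<alpha> - 1)) \<le> K1 * (1 + step t 1 powr (\<alpha> - 1))"
    using K_nonneg by (intro mult_left_mono) (auto simp: step_1)
  with bound1[of s] assms mesh_nonneg[of 1] show ?thesis by simp
qed

lemma incr_2_bound:
  assumes "t 2 \<le> T"
  shows "\<bar>incr nodal 2\<bar> \<le> K1 * (1 + step t 1 powr (\<alpha> - 1)) * step t 2"
proof -
  have "0 < t 1" "t 1 \<le> t 2" using step_pos[of 1] mesh_le[of 1 2] by (auto simp: step_1)
  then have "\<bar>g (t 2) - g (t 1)\<bar> \<le> K1 * (1 + step t 1 powr (\<alpha> - 1)) * (t 2 - t 1)"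
    using assms g1_bound_after_first
    by (intro abs_difference_le[where f' = g1] continuous_on_subset[OF cont(1)] deriv1) auto
  then show ?thesis by (simp add: incr_def nodal_def step_def)
qed

lemma start_eq: "(1 + step t 1 powr (\<alpha> - 1)) * step t 1 = start"
proof -
  have "step t 1 powr (\<alpha> - 1) * step t 1 = step t 1 powr \<alpha>"
    using step_pos[of 1] powr_add[of "step t 1" "\<alpha> - 1" 1] by simp
  then show ?thesis by (simp add: start_def distrib_right)
qed

lemma slope_1_bound:
  assumes T: "t 2 \<le> T" and s: "0 \<le> s" "s \<le> t 2"
  shows "\<bar>slope 1 s\<bar> \<le> 5 / \<alpha> * K1 * (1 + step t 1 powr (\<alpha> - 1))"
proof -
  let ?x = "step t 1" and ?y = "step t 2"
  define B where "B = K1 * (1 + ?x powr (\<alpha> - 1))"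
  define a where "a = incr nodal 1 / ?x"
  define b where "b = incr nodal 2 / ?y"
  have pos: "0 < ?x" "0 < ?y" using step_pos by auto
  have B0: "0 \<le> B" using K_nonneg by (simp add: B_def)
  have T1: "t 1 \<le> T" using T mesh_le[of 1 2] by simp
  have Bx: "B * ?x = K1 * start" by (simp only: B_def mult.assoc start_eq)
  have "\<bar>incr nodal 1\<bar> \<le> K1 * (?x + ?x powr \<alpha> / \<alpha>)" by (rule incr_1_bound[OF T1])
  also have "\<dots> \<le> K1 * (?x / \<alpha> + ?x powr \<alpha> / \<alpha>)"
    using K_nonneg alpha pos by (intro mult_left_mono add_right_mono) (auto simp: field_simps)
  also have "\<dots> = K1 * start / \<alpha>" by (simp add: start_def add_divide_distrib[symmetric])
  also have "\<dots> = B / \<alpha> * ?x" unfolding Bx[symmetric] by simp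
  finally have a: "\<bar>a\<bar> \<le> B / \<alpha>" using pos by (simp add: a_def pos_divide_le_eq)
  have b: "\<bar>b\<bar> \<le> B" using incr_2_bound[OF T] pos by (simp add: b_def B_def pos_divide_le_eq)
  have BB: "B \<le> B / \<alpha>" using B0 alpha by (simp add: field_simps mult_left_le)
  have c: "curv nodal 1 = (b - a) / (?x + ?y)"
    by (simp add: curv_def a_def b_def numeral_2_eq_2)
  have xy: "t 2 = ?x + ?y" "t 1 = ?x" by (simp_all add: step_def mesh_0)
  have "\<bar>(2 * s - t 1) / (?x + ?y)\<bar> \<le> 2"
    using s pos unfolding xy by (simp add: abs_le_iff pos_divide_le_eq)
  then have "\<bar>(2 * s - t 1) / (?x + ?y)\<bar> * \<bar>b - a\<bar> \<le> 2 * (B + B / \<alpha>)"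
    using a b B0 by (intro mult_mono) auto
  then have "\<bar>(2 * s - t 1) * curv nodal 1\<bar> \<le> 2 * (B + B / \<alpha>)"
    unfolding c by (simp add: abs_mult)
  moreover have "slope 1 s = a + (2 * s - t 1) * curv nodal 1"
    by (simp add: slope_def a_def mesh_0)
  ultimately have "\<bar>slope 1 s\<bar> \<le> B / \<alpha> + 2 * (B + B / \<alpha>)"
    using a abs_triangle_ineq[of a "(2 * s - t 1) * curv nodal 1"] by simp
  also have "\<dots> \<le> B / \<alpha> + 2 * (B / \<alpha> + B / \<alpha>)" using BB by simp
  also have "\<dots> = 5 / \<alpha> * B" by simp
  finally show ?thesis by (simp add: B_def)
qed

lemma ker_g1_integrable:
  assumes "(\<lambda>s. ker k s * g1 s) integrable_on {0..t k}" "j \<le> k"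
  shows "(\<lambda>s. ker k s * g1 s) integrable_on {t (j - 1)..t j}"
  by (rule integrable_on_subinterval[OF assms(1)]) (use mesh_nonneg mesh_le[OF assms(2)] in auto)

text \<open>The kernel is singular on the last interval, so integrability is read off from the explicit integrals after recentring.\<close>

lemma last_slope_integrable:
  assumes "2 \<le> k"
  shows "(\<lambda>s. ker k s * slope (k - 1) s) integrable_on {t (k - 1)..t k}"
proof -
  define x where "x = incr nodal (k - 1) / step t (k - 1) + (t k - t (k - 2)) * curv nodal (k - 1)"
  have "1 \<le> k" using assms by simp
  from has_integral_kernel_linear[OF has_integral_last_kernel[OF this], of x "curv nodal (k - 1)"]
  have "(\<lambda>s. ker k s * (x + (2 * s - t (k - 1) - t k) * curv nodal (k - 1))) integrable_on {t (k - 1)..t k}"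
    by (auto intro: has_integral_integrable)
  moreover have "x + (2 * s - t (k - 1) - t k) * curv nodal (k - 1) = slope (k - 1) s" for s
    by (simp add: x_def slope_def algebra_simps numeral_2_eq_2)
  ultimately show ?thesis by simp
qed

lemma history_slope_integrable: "j < k \<Longrightarrow> (\<lambda>s. ker k s * slope j s) integrable_on {t (j - 1)..t j}"
  by (intro integrable_continuous_interval continuous_on_mult ker_cont slope_continuous)

lemma truncation_error_split:
  assumes k: "2 \<le> k" and I: "((\<lambda>s. ker k s * g1 s) has_integral I) {0..t k}"
  shows "Gamma (1 - \<alpha>) * L2_operator \<alpha> t nodal k - I
    = (\<Sum>j=1..k-1. integral {t (j - 1)..t j} (\<lambda>s. ker k s * defect j s))
      + integral {t (k - 1)..t k} (\<lambda>s. ker k s * defect (k - 1) s)"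
proof -
  let ?V = "\<lambda>j. integral {t (j - 1)..t j} (\<lambda>s. (t k - s) powr (-\<alpha>) *\<^sub>R vector_derivative (lagrange2 t nodal j) (at s))"
  let ?L = "integral {t (k - 1)..t k} (\<lambda>s. (t k - s) powr (-\<alpha>) *\<^sub>R vector_derivative (lagrange2 t nodal (k - 1)) (at s))"
  let ?D = "\<lambda>j. integral {t (j - 1)..t j} (\<lambda>s. ker k s * defect j s)" and ?G = "\<lambda>j. integral {t (j - 1)..t j} (\<lambda>s. ker k s * g1 s)"
  have Iint: "(\<lambda>s. ker k s * g1 s) integrable_on {0..t k}" using I by blast
  have vd: "vector_derivative (lagrange2 t nodal j) (at s) = slope j s" if "1 \<le> j" for j s
    using slope_deriv[OF that] by (intro vector_derivative_at) (simp add: has_real_derivative_iff_has_vector_derivative)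
  have h: "?D j
     = ?V j
       - ?G j" if j: "j \<in> {1..k-1}" for j
  proof -
    have "j < k" "1 \<le> j" using j k by auto
    then have "integral {t (j - 1)..t j} (\<lambda>s. ker k s * slope j s - ker k s * g1 s)
      = integral {t (j - 1)..t j} (\<lambda>s. ker k s * slope j s) - ?G j"
      using ker_g1_integrable[OF Iint, of j] by (intro integral_diff history_slope_integrable) auto
    then show ?thesis using vd[OF \<open>1 \<le> j\<close>] by (simp add: defect_def right_diff_distrib ker_def)
  qed
  have l: "integral {t (k - 1)..t k} (\<lambda>s. ker k s * defect (k - 1) s)
     = ?L
       - integral {t (k - 1)..t k} (\<lambda>s. ker k s * g1 s)"
  proof -
    have "integral {t (k - 1)..t k} (\<lambda>s. ker k s * slope (k - 1) s - ker k s * g1 s)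
      = integral {t (k - 1)..t k} (\<lambda>s. ker k s * slope (k - 1) s) - integral {t (k - 1)..t k} (\<lambda>s. ker k s * g1 s)"
      by (intro integral_diff last_slope_integrable[OF k] ker_g1_integrable[OF Iint order_refl])
    moreover have "1 \<le> k - 1" using k by simp
    ultimately show ?thesis using vd by (simp add: defect_def right_diff_distrib ker_def)
  qed
  have "{1..k} = insert k {1..k-1}" using k by auto
  then have "I = (\<Sum>j=1..k-1. ?G j)
      + integral {t (k - 1)..t k} (\<lambda>s. ker k s * g1 s)"
    using integral_mesh_split[OF Iint] integral_unique[OF I] k by simp
  moreover have "Gamma (1 - \<alpha>) * L2_operator \<alpha> t nodal k =
     (\<Sum>j=1..k-1. ?V j)
     + ?L"
  proof -
    have "Gamma (1 - \<alpha>) \<noteq> 0" using Gamma_pos by linarith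
    then show ?thesis using k by (simp add: L2_operator_def)
  qed
  moreover have "(\<Sum>j=1..k-1. ?D j)
     = (\<Sum>j=1..k-1. ?V j)
       - (\<Sum>j=1..k-1. ?G j)"
    unfolding sum_subtractf[symmetric] by (rule sum.cong[OF refl h])
  ultimately show ?thesis unfolding l by linarith
qed

lemma defect_integrable:
  assumes "(\<lambda>s. ker k s * g1 s) integrable_on {0..t k}" "j < k"
  shows "(\<lambda>s. ker k s * defect j s) integrable_on {t (j - 1)..t j}"
  unfolding defect_def right_diff_distrib
  by (intro integrable_diff history_slope_integrable ker_g1_integrable[OF assms(1)] assms less_imp_le)

lemma history_defect_bound:
  assumes Iint: "(\<lambda>s. ker k s * g1 s) integrable_on {0..t k}" and T: "t k \<le> T" and j: "1 \<le> j" "j < k"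
    and m: "(m has_integral X) {t (j - 1)..t j}"
      "\<And>s. t (j - 1) \<le> s \<Longrightarrow> s \<le> t j \<Longrightarrow> \<bar>defect j s\<bar> \<le> m s"
  shows "\<bar>integral {t (j - 1)..t j} (\<lambda>s. ker k s * defect j s)\<bar> \<le> (ker k (t j) - ker k (t (j - 1))) * X"
proof (rule zero_mean_kernel_integral_bound)
  show "t (j - 1) \<le> t j" by (rule mesh_le) simp
  have "t (Suc j) \<le> T" using mesh_le[of "Suc j" k] j T by simp
  then show "(defect j has_integral 0) {t (j - 1)..t j}" using defect_has_integral_0 j by blast
qed (use defect_integrable[OF Iint] ker_mono[of j] j m in auto)

text \<open>Near time zero only the first derivative is under control, and its bound is integrable there. The interpolant involves the
first two increments, which are bounded by the same quantity.\<close>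

lemma first_defect_bound:
  assumes Iint: "(\<lambda>s. ker k s * g1 s) integrable_on {0..t k}" and T: "t k \<le> T" and k: "2 \<le> k"
  shows "\<bar>integral {t 0..t 1} (\<lambda>s. ker k s * defect 1 s)\<bar> \<le> 288 / \<alpha> * K1 * consistency k"
proof -
  let ?x = "step t 1"
  have T2: "t 2 \<le> T" using mesh_le[OF k] T by simp
  have t12: "t 1 \<le> t 2" by (rule mesh_le) simp
  have x: "0 < ?x" by (rule step_pos) simp
  define B where "B = 5 / \<alpha> * K1 * (1 + ?x powr (\<alpha> - 1))"
  define X where "X = ?x * B + K1 * (?x + ?x powr \<alpha> / \<alpha>)"
  have "((\<lambda>s. B + K1 * (1 + s powr (\<alpha> - 1))) has_integral X) {0..t 1}"
    unfolding X_def using has_integral_const_real[of B 0 "t 1"] mesh_nonneg[of 1]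
    by (intro has_integral_add abs_g1_integral_bound) (simp add: step_1)
  then have m: "((\<lambda>s. B + K1 * (1 + s powr (\<alpha> - 1))) has_integral X) {t (1 - 1)..t 1}"
    by (simp add: mesh_0)
  have "\<bar>integral {t (1 - 1)..t 1} (\<lambda>s. ker k s * defect 1 s)\<bar> \<le> (ker k (t 1) - ker k (t (1 - 1))) * X"
  proof (rule history_defect_bound[OF Iint T _ _ m])
    fix s assume s: "t (1 - 1) \<le> s" "s \<le> t 1"
    have "\<bar>slope 1 s\<bar> \<le> B" unfolding B_def
      by (rule slope_1_bound[OF T2]) (use s t12 mesh_0 in auto)
    moreover have "\<bar>g1 s\<bar> \<le> K1 * (1 + s powr (\<alpha> - 1))"
      using s t12 T2 mesh_0 by (intro bound1) auto
    ultimately show "\<bar>defect 1 s\<bar> \<le> B + K1 * (1 + s powr (\<alpha> - 1))" unfolding defect_def by linarith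
  qed (use k in auto)
  also have "\<dots> \<le> (ker k (t 1) - ker k (t 0)) * (6 / \<alpha> * K1 * start)"
  proof -
    have "?x * B = 5 / \<alpha> * K1 * start" unfolding B_def start_eq[symmetric] by simp
    moreover have "K1 * (?x + ?x powr \<alpha> / \<alpha>) \<le> K1 * (?x / \<alpha> + ?x powr \<alpha> / \<alpha>)"
      using K_nonneg alpha x by (intro mult_left_mono add_right_mono) (auto simp: field_simps)
    moreover have "K1 * (?x / \<alpha> + ?x powr \<alpha> / \<alpha>) = 1 / \<alpha> * K1 * start"
      by (simp add: start_def add_divide_distrib[symmetric])
    ultimately have "X \<le> 5 / \<alpha> * K1 * start + 1 / \<alpha> * K1 * start" by (simp add: X_def)
    also have "\<dots> = 6 / \<alpha> * K1 * start" by (simp add: add_divide_distrib[symmetric] distrib_right[symmetric])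
    finally have "X \<le> 6 / \<alpha> * K1 * start" .
    moreover have "ker k (t 0) \<le> ker k (t 1)" using ker_mono[of 1 "t 0" "t 1" k] mesh_le[of 0 1] k by simp
    ultimately show ?thesis unfolding diff_self_eq_0 by (intro mult_left_mono) auto
  qed
  also have "\<dots> = 6 / \<alpha> * K1 * ((ker k (t 1) - ker k (t 0)) * start)" by simp
  also have "\<dots> \<le> 6 / \<alpha> * K1 * (48 * consistency k)"
    using kernel_increment_start_le[OF k] K_nonneg alpha by (intro mult_left_mono) auto
  finally show ?thesis by simp
qed

lemma middle_defect_bound:
  assumes Iint: "(\<lambda>s. ker k s * g1 s) integrable_on {0..t k}" and T: "t k \<le> T" and j: "2 \<le> j" "j < k"
  shows "\<bar>integral {t (j - 1)..t j} (\<lambda>s. ker k s * defect j s)\<bar>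
    \<le> 25 * K3 * middle k j"
proof -
  let ?x = "step t j" and ?p = "(t k - t j) powr (-\<alpha> - 1)"
  define M where "M = K3 * (1 + t (j - 1) powr (\<alpha> - 3))"
  have x: "0 < ?x" using j by (intro step_pos) simp
  have M: "0 \<le> M" using K_nonneg by (simp add: M_def)
  have T': "t (Suc j) \<le> T" using mesh_le[of "Suc j" k] j T by simp
  have tj: "t j \<le> t (Suc j)" by (rule mesh_le) simp
  have "?x + step t (Suc j) \<le> 5 * ?x" using step_Suc_le[of j] j by simp
  then have "(?x + step t (Suc j))\<^sup>2 \<le> (5 * ?x)\<^sup>2"
    using x step_Suc_pos[of j] by (intro power_mono) auto
  then have sq: "M * (?x + step t (Suc j))\<^sup>2 \<le> 25 * M * ?x\<^sup>2"
    using M mult_left_mono[of "(?x + step t (Suc j))\<^sup>2" "(5 * ?x)\<^sup>2" M] by (simp add: power_mult_distrib mult_ac)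
  have m: "((\<lambda>s. 25 * M * ?x\<^sup>2) has_integral (?x * (25 * M * ?x\<^sup>2))) {t (j - 1)..t j}"
    using has_integral_const_real[of "25 * M * ?x\<^sup>2" "t (j - 1)" "t j"] mesh_le[of "j - 1" j]
    by (simp add: step_def)
  have "\<bar>integral {t (j - 1)..t j} (\<lambda>s. ker k s * defect j s)\<bar>
      \<le> (ker k (t j) - ker k (t (j - 1))) * (?x * (25 * M * ?x\<^sup>2))"
  proof (rule history_defect_bound[OF Iint T _ _ m])
    fix s assume "t (j - 1) \<le> s" "s \<le> t j"
    then show "\<bar>defect j s\<bar> \<le> 25 * M * ?x\<^sup>2"
      using defect_bound[OF j(1) T', of s, folded M_def] tj sq by simp
  qed (use j in auto)
  also have "\<dots> \<le> (1 * ?x * ?p) * (?x * (25 * M * ?x\<^sup>2))"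
  proof (rule mult_right_mono)
    have "ker k (t j) - ker k (t (j - 1)) \<le> \<alpha> * ?x * ?p" by (rule ker_increment_le[OF j(2)])
    also have "\<dots> \<le> 1 * ?x * ?p" using alpha x by (intro mult_right_mono) auto
    finally show "ker k (t j) - ker k (t (j - 1)) \<le> 1 * ?x * ?p" .
    show "0 \<le> ?x * (25 * M * ?x\<^sup>2)" using M x by simp
  qed
  also have "\<dots> = 25 * K3 * middle k j"
    by (simp add: middle_def M_def power2_eq_square power4_eq_xxxx mult_ac)
  finally show ?thesis .
qed

lemma last_interval_bound:
  assumes k: "2 \<le> k" and Iint: "(\<lambda>s. ker k s * g1 s) integrable_on {0..t k}"
    and B: "\<And>s. t (k - 1) \<le> s \<Longrightarrow> s \<le> t k \<Longrightarrow> \<bar>defect (k - 1) s\<bar> \<le> B"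
  shows "\<bar>integral {t (k - 1)..t k} (\<lambda>s. ker k s * defect (k - 1) s)\<bar> \<le> B * (step t k powr (1 - \<alpha>) / (1 - \<alpha>))"
proof -
  have k1: "1 \<le> k" using k by simp
  have m: "((\<lambda>s. B * ker k s) has_integral (B * (step t k powr (1 - \<alpha>) / (1 - \<alpha>)))) {t (k - 1)..t k}"
    by (intro has_integral_mult_right has_integral_last_kernel[OF k1])
  have "(\<lambda>s. ker k s * defect (k - 1) s) integrable_on {t (k - 1)..t k}"
    unfolding defect_def right_diff_distrib
    by (intro integrable_diff last_slope_integrable[OF k] ker_g1_integrable[OF Iint order_refl])
  then have "norm (integral {t (k - 1)..t k} (\<lambda>s. ker k s * defect (k - 1) s)) \<le> integral {t (k - 1)..t k} (\<lambda>s. B * ker k s)"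
  proof (rule integral_norm_bound_integral)
    show "(\<lambda>s. B * ker k s) integrable_on {t (k - 1)..t k}" using m by blast
    fix s assume "s \<in> {t (k - 1)..t k}"
    then have "\<bar>defect (k - 1) s\<bar> * ker k s \<le> B * ker k s"
      using B[of s] by (intro mult_right_mono) (auto simp: ker_def)
    then show "norm (ker k s * defect (k - 1) s) \<le> B * ker k s"
      by (simp add: abs_mult mult.commute ker_def)
  qed
  then show ?thesis using integral_unique[OF m] by simp
qed

text \<open>For \<open>k = 2\<close> the interpolant reaches back to time zero and the bound on the first derivative is used on the second interval. For
larger \<open>k\<close> the third derivative is bounded at the node before the previous one; since the ratios are bounded, that time is at least a fifth of
the time of the previous node, and the fifth has the power \<open>-3\<close> equal to \<open>125\<close>.\<close>

lemma last_defect_bound: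
  assumes k: "2 \<le> k" and Iint: "(\<lambda>s. ker k s * g1 s) integrable_on {0..t k}" and T: "t k \<le> T"
  shows "\<bar>integral {t (k - 1)..t k} (\<lambda>s. ker k s * defect (k - 1) s)\<bar>
    \<le> (528 / \<alpha> * K1 + 1375 * K3) / (1 - \<alpha>) * consistency k"
proof (cases "k = 2")
  case True
  let ?x = "step t 1" and ?y = "step t 2"
  have pos: "0 < ?x" "0 < ?y" using step_pos by auto
  have T2: "t 2 \<le> T" using T True by simp
  have yb: "?y powr (1 - \<alpha>) = ?y powr (-\<alpha>) * ?y" using pos powr_add[of ?y "-\<alpha>" 1] by simp
  define B where "B = 6 / \<alpha> * K1 * (1 + ?x powr (\<alpha> - 1))"
  have "\<bar>integral {t (k - 1)..t k} (\<lambda>s. ker k s * defect (k - 1) s)\<bar> \<le> B * (step t k powr (1 - \<alpha>) / (1 - \<alpha>))"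
  proof (rule last_interval_bound[OF k Iint])
    fix s assume s: "t (k - 1) \<le> s" "s \<le> t k"
    have s': "t 1 \<le> s" "s \<le> t 2" using s True by auto
    have "\<bar>slope 1 s\<bar> \<le> 5 / \<alpha> * K1 * (1 + ?x powr (\<alpha> - 1))"
      using s' mesh_nonneg[of 1] by (intro slope_1_bound[OF T2]) auto
    moreover have "\<bar>g1 s\<bar> \<le> K1 * (1 + ?x powr (\<alpha> - 1))"
      using s' T2 by (intro g1_bound_after_first) auto
    moreover have "K1 * (1 + ?x powr (\<alpha> - 1)) \<le> 1 / \<alpha> * (K1 * (1 + ?x powr (\<alpha> - 1)))"
      using mult_right_mono[of 1 "1 / \<alpha>" "K1 * (1 + ?x powr (\<alpha> - 1))"] alpha K_nonneg by simp
    moreover have "5 / \<alpha> * K1 * (1 + ?x powr (\<alpha> - 1)) + 1 / \<alpha> * (K1 * (1 + ?x powr (\<alpha> - 1))) = B"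
      unfolding B_def by (simp add: add_divide_distrib[symmetric] distrib_right[symmetric])
    ultimately have "\<bar>slope 1 s - g1 s\<bar> \<le> B" by linarith
    then show "\<bar>defect (k - 1) s\<bar> \<le> B" using True by (simp add: defect_def)
  qed
  also have "\<dots> = 6 / \<alpha> * K1 / (1 - \<alpha>) * (?y powr (-\<alpha>) * (?y * (1 + ?x powr (\<alpha> - 1))))"
    unfolding B_def True yb by simp
  also have "\<dots> \<le> 6 / \<alpha> * K1 / (1 - \<alpha>) * (?y powr (-\<alpha>) * (4 * start))"
  proof -
    have "?y * (1 + ?x powr (\<alpha> - 1)) \<le> 4 * ?x * (1 + ?x powr (\<alpha> - 1))"
      using step_Suc_le[of 1] by (intro mult_right_mono) (auto simp: numeral_2_eq_2)
    also have "\<dots> = 4 * start" unfolding start_eq[symmetric] by simp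
    finally show ?thesis using K_nonneg alpha by (intro mult_left_mono) auto
  qed
  also have "\<dots> = 24 / \<alpha> * K1 / (1 - \<alpha>) * (?y powr (-\<alpha>) * start)" by simp
  also have "\<dots> \<le> 24 / \<alpha> * K1 / (1 - \<alpha>) * (22 * consistency 2)"
    using start_le_consistency_2 K_nonneg alpha by (intro mult_left_mono) auto
  also have "\<dots> = 528 / \<alpha> * K1 / (1 - \<alpha>) * consistency k" using True by simp
  also have "\<dots> \<le> (528 / \<alpha> * K1 + 1375 * K3) / (1 - \<alpha>) * consistency k"
    using K_nonneg alpha consistency_nonneg[of k] by (intro mult_right_mono divide_right_mono) auto
  finally show ?thesis .
next
  case False
  then have k3: "3 \<le> k" using k by simp
  obtain i where i: "k = Suc (Suc (Suc i))" using k3 by (metis numeral_3_eq_3 add_Suc le_Suc_ex plus_nat.add_0)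
  let ?y = "step t k" and ?M = "1 + t (k - 1) powr (\<alpha> - 3)"
  have y: "0 < ?y" using k by (intro step_pos) simp
  have yb: "?y powr (1 - \<alpha>) * ?y\<^sup>2 = ?y powr (3 - \<alpha>)"
    using y powr_add[of ?y "1 - \<alpha>" 2] by simp
  define B where "B = K3 * (125 * ?M) * (11 * ?y\<^sup>2)"
  have ti: "0 < t (Suc i)" using mesh_less[of i] mesh_nonneg[of i] by simp
  have prev: "1 + t (Suc i) powr (\<alpha> - 3) \<le> 125 * ?M"
  proof -
    have "step t (Suc i) \<le> t (Suc i)" using mesh_nonneg[of i] by (simp add: step_def)
    then have "t (Suc (Suc i)) \<le> 5 * t (Suc i)"
      using step_Suc_le[of "Suc i"] by (simp add: step_Suc)
    moreover have "0 < t (Suc (Suc i))" using ti mesh_less[of "Suc i"] by simp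
    ultimately have "t (Suc i) powr (\<alpha> - 3) \<le> (1 / 5 * t (Suc (Suc i))) powr (\<alpha> - 3)"
      using alpha ti by (intro powr_mono2') auto
    also have "\<dots> = (1 / 5) powr (\<alpha> - 3) * t (Suc (Suc i)) powr (\<alpha> - 3)"
      by (rule powr_mult)
    also have "\<dots> \<le> 125 * t (Suc (Suc i)) powr (\<alpha> - 3)"
    proof (rule mult_right_mono)
      have "(1 / 5 :: real) powr (\<alpha> - 3) \<le> (1 / 5) powr (- 3)"
        using alpha by (intro powr_mono') auto
      also have "\<dots> = 125" by (simp add: powr_minus powr_numeral power3_eq_cube)
      finally show "(1 / 5 :: real) powr (\<alpha> - 3) \<le> 125" .
    qed simp
    finally show ?thesis using i by simp
  qed
  have "\<bar>integral {t (k - 1)..t k} (\<lambda>s. ker k s * defect (k - 1) s)\<bar> \<le> B * (step t k powr (1 - \<alpha>) / (1 - \<alpha>))"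
  proof (rule last_interval_bound[OF k Iint])
    fix s assume s: "t (k - 1) \<le> s" "s \<le> t k"
    have "\<bar>defect (k - 1) s\<bar> \<le> K3 * (1 + t (Suc i) powr (\<alpha> - 3)) * (step t (k - 1) + ?y)\<^sup>2"
      using defect_bound[of "k - 1" s] s T i mesh_le[of "Suc i" "Suc (Suc i)"] by simp
    also have "\<dots> \<le> B"
      unfolding B_def
    proof (rule mult_mono)
      show "K3 * (1 + t (Suc i) powr (\<alpha> - 3)) \<le> K3 * (125 * ?M)"
        using prev K_nonneg by (intro mult_left_mono) auto
      have "step t (k - 1) + ?y \<le> 16 / 5 * ?y" using step_le_Suc[of "k - 1"] i by simp
      then have "(step t (k - 1) + ?y)\<^sup>2 \<le> (16 / 5 * ?y)\<^sup>2"
        using y step_pos[of "k - 1"] i by (intro power_mono) auto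
      also have "\<dots> = 256 / 25 * ?y\<^sup>2" by (simp add: power_mult_distrib power_divide)
      also have "\<dots> \<le> 11 * ?y\<^sup>2" by (intro mult_right_mono) auto
      finally show "(step t (k - 1) + ?y)\<^sup>2 \<le> 11 * ?y\<^sup>2" .
    qed (use K_nonneg in auto)
    finally show "\<bar>defect (k - 1) s\<bar> \<le> B" .
  qed
  also have "\<dots> = 1375 * K3 / (1 - \<alpha>) * (?y powr (3 - \<alpha>) * ?M)"
    unfolding B_def yb[symmetric] by simp
  also have "\<dots> \<le> 1375 * K3 / (1 - \<alpha>) * consistency k"
    using consistency_ge_last[of k] K_nonneg alpha by (intro mult_left_mono) auto
  also have "\<dots> \<le> (528 / \<alpha> * K1 + 1375 * K3) / (1 - \<alpha>) * consistency k"
    using K_nonneg alpha consistency_nonneg[of k] by (intro mult_right_mono divide_right_mono) auto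
  finally show ?thesis .
qed

text \<open>First, middle and last intervals contribute one term of \<open>consistency\<close> each. The constants come from the numerical bounds
\<open>4\<close> and \<open>11 / 5\<close> for the ratios of neighbouring steps and are not optimized.\<close>

theorem truncation_error_bound:
  assumes k: "2 \<le> k" and I: "((\<lambda>s. ker k s * g1 s) has_integral I) {0..t k}" and T: "t k \<le> T"
  shows "\<bar>Gamma (1 - \<alpha>) * L2_operator \<alpha> t nodal k - I\<bar>
    \<le> 2000 / (\<alpha> * (1 - \<alpha>)) * (K1 + K3) * consistency k"
proof -
  have Iint: "(\<lambda>s. ker k s * g1 s) integrable_on {0..t k}" using I by blast
  let ?i = "\<lambda>j. integral {t (j - 1)..t j} (\<lambda>s. ker k s * defect j s)"
  have "{1..k-1} = insert 1 {2..k-1}" using k by auto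
  then have split: "(\<Sum>j=1..k-1. ?i j) = ?i 1 + (\<Sum>j=2..k-1. ?i j)" by simp
  have first: "\<bar>?i 1\<bar> \<le> 288 / \<alpha> * K1 * consistency k"
    using first_defect_bound[OF Iint T k] by simp
  have "\<bar>\<Sum>j=2..k-1. ?i j\<bar> \<le> (\<Sum>j=2..k-1. \<bar>?i j\<bar>)" by (rule sum_abs)
  also have "\<dots> \<le> (\<Sum>j=2..k-1. 25 * K3 * middle k j)"
    using k by (intro sum_mono middle_defect_bound[OF Iint T]) auto
  also have "\<dots> \<le> 25 * K3 * consistency k"
    unfolding sum_distrib_left[symmetric]
    using consistency_ge_sum[of k] K_nonneg by (intro mult_left_mono) auto
  finally have middle: "\<bar>\<Sum>j=2..k-1. ?i j\<bar> \<le> 25 * K3 * consistency k" .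
  note last = last_defect_bound[OF k Iint T]
  have "\<bar>Gamma (1 - \<alpha>) * L2_operator \<alpha> t nodal k - I\<bar>
      \<le> 288 / \<alpha> * K1 * consistency k + 25 * K3 * consistency k
        + (528 / \<alpha> * K1 + 1375 * K3) / (1 - \<alpha>) * consistency k"
    unfolding truncation_error_split[OF k I] split using first middle last by linarith
  also have "\<dots> = (288 / \<alpha> * K1 + 25 * K3 + (528 / \<alpha> * K1 + 1375 * K3) / (1 - \<alpha>)) * consistency k"
    by (simp add: distrib_right)
  also have "\<dots> \<le> (2000 / (\<alpha> * (1 - \<alpha>)) * (K1 + K3)) * consistency k"
  proof (rule mult_right_mono[OF _ consistency_nonneg])
    let ?N = "288 * (1 - \<alpha>) * K1 + 25 * (\<alpha> * (1 - \<alpha>)) * K3 + 528 * K1 + 1375 * \<alpha> * K3"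
    have aa: "0 < \<alpha> * (1 - \<alpha>)" using alpha by simp
    have e: "288 / \<alpha> * K1 + 25 * K3 + (528 / \<alpha> * K1 + 1375 * K3) / (1 - \<alpha>)
        = (?N) / (\<alpha> * (1 - \<alpha>))"
      using alpha by (simp add: divide_simps) (simp add: algebra_simps)
    have "(1 - \<alpha>) * K1 \<le> 1 * K1" "\<alpha> * K3 \<le> 1 * K3" "(\<alpha> * (1 - \<alpha>)) * K3 \<le> 1 * K3"
      using mult_right_mono[of "1 - \<alpha>" 1 K1] mult_right_mono[of \<alpha> 1 K3]
        mult_right_mono[of "\<alpha> * (1 - \<alpha>)" 1 K3] alpha K_nonneg mult_le_one[of \<alpha> "1 - \<alpha>"] by auto
    then have "?N \<le> 2000 * (K1 + K3)"
      using K_nonneg by argo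
    then have "(?N) / (\<alpha> * (1 - \<alpha>))
      \<le> (2000 * (K1 + K3)) / (\<alpha> * (1 - \<alpha>))" using aa by (intro divide_right_mono) auto
    then show "288 / \<alpha> * K1 + 25 * K3 + (528 / \<alpha> * K1 + 1375 * K3) / (1 - \<alpha>)
        \<le> 2000 / (\<alpha> * (1 - \<alpha>)) * (K1 + K3)" unfolding e by simp
  qed
  finally show ?thesis .
qed

text \<open>At each point of the interval at least one of the two factors of the Beta integrand is bounded by its value at the
midpoint, so that a sum of two elementary integrands is a majorant.\<close>

lemma first_step_kernel_bound:
  "((\<lambda>s. ker 1 s + ((t 1 / 2) powr (-\<alpha>) * s powr (\<alpha> - 1) + (t 1 / 2) powr (\<alpha> - 1) * ker 1 s)) has_integral
      (t 1 powr (1 - \<alpha>) / (1 - \<alpha>) + ((1 / 2) powr (-\<alpha>) / \<alpha> + (1 / 2) powr (\<alpha> - 1) / (1 - \<alpha>)))) {0..t 1}"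
  (is "(?m has_integral ?V) _")
  "s \<in> {0..t 1} \<Longrightarrow> ker 1 s * (1 + s powr (\<alpha> - 1))
      \<le> ker 1 s + ((t 1 / 2) powr (-\<alpha>) * s powr (\<alpha> - 1) + (t 1 / 2) powr (\<alpha> - 1) * ker 1 s)"
  (is "_ \<Longrightarrow> ?b")
proof -
  have t1: "0 < t 1" using step_pos[of 1] by (simp add: step_1)
  have k: "(ker 1 has_integral (t 1 powr (1 - \<alpha>) / (1 - \<alpha>))) {0..t 1}"
    using has_integral_last_kernel(1)[of 1] by (simp add: step_1 mesh_0)
  have p: "((\<lambda>s. s powr (\<alpha> - 1)) has_integral (t 1 powr \<alpha> / \<alpha>)) {0..t 1}"
    using has_integral_powr_from_0[of "\<alpha> - 1" "t 1"] alpha t1 by simp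
  have e1: "(t 1 / 2) powr (-\<alpha>) * (t 1 powr \<alpha> / \<alpha>) = (1 / 2) powr (-\<alpha>) / \<alpha>"
    using t1 powr_mult[of "t 1" "1 / 2" "-\<alpha>"] by (simp add: powr_minus)
  have e2: "(t 1 / 2) powr (\<alpha> - 1) * (t 1 powr (1 - \<alpha>) / (1 - \<alpha>)) = (1 / 2) powr (\<alpha> - 1) / (1 - \<alpha>)"
    using t1 powr_mult[of "t 1" "1 / 2" "\<alpha> - 1"] powr_add[of "t 1" "\<alpha> - 1" "1 - \<alpha>"] by simp
  show "(?m has_integral ?V) {0..t 1}"
    unfolding e1[symmetric] e2[symmetric] by (intro has_integral_add has_integral_mult_right k p)
  assume s: "s \<in> {0..t 1}"
  have nn: "0 \<le> ker 1 s" by (simp add: ker_def)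
  have "ker 1 s * s powr (\<alpha> - 1) \<le> (t 1 / 2) powr (-\<alpha>) * s powr (\<alpha> - 1) + (t 1 / 2) powr (\<alpha> - 1) * ker 1 s"
  proof (cases "s \<le> t 1 / 2")
    case True
    then have "ker 1 s \<le> (t 1 / 2) powr (-\<alpha>)"
      unfolding ker_def using alpha t1 by (intro powr_mono2') auto
    then have "ker 1 s * s powr (\<alpha> - 1) \<le> (t 1 / 2) powr (-\<alpha>) * s powr (\<alpha> - 1)"
      by (intro mult_right_mono) auto
    then show ?thesis using nn by (simp add: add_increasing2)
  next
    case False
    then have "s powr (\<alpha> - 1) \<le> (t 1 / 2) powr (\<alpha> - 1)"
      using alpha t1 by (intro powr_mono2') auto
    then have "s powr (\<alpha> - 1) * ker 1 s \<le> (t 1 / 2) powr (\<alpha> - 1) * ker 1 s"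
      using nn by (intro mult_right_mono) auto
    then show ?thesis by (simp add: add_increasing mult.commute)
  qed
  then show ?b
    by (simp add: distrib_left)
qed

theorem truncation_error_bound_first_step:
  assumes I: "((\<lambda>s. ker 1 s * g1 s) has_integral I) {0..t 1}" and T: "t 1 \<le> T"
  shows "\<bar>Gamma (1 - \<alpha>) * L2_operator \<alpha> t nodal 1 - I\<bar>
    \<le> 6 / (\<alpha> * (1 - \<alpha>)) * K1 * (step t 1 powr (-\<alpha>) * start)"
proof -
  let ?maj = "\<lambda>s. ker 1 s + ((t 1 / 2) powr (-\<alpha>) * s powr (\<alpha> - 1) + (t 1 / 2) powr (\<alpha> - 1) * ker 1 s)"
  let ?x = "step t 1"
  have x: "0 < ?x" by (rule step_pos) simp
  define P where "P = ?x powr (-\<alpha>) * start"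
  have xm: "?x powr (-\<alpha>) * ?x powr \<alpha> = 1" using x powr_add[of ?x "-\<alpha>" \<alpha>] by simp
  have xp: "?x powr (-\<alpha>) * ?x = ?x powr (1 - \<alpha>)" using x powr_add[of ?x "-\<alpha>" 1] by simp
  have P: "P = ?x powr (1 - \<alpha>) + 1" by (simp only: P_def start_def distrib_left xm xp)
  define V where "V = t 1 powr (1 - \<alpha>) / (1 - \<alpha>) + ((1 / 2) powr (-\<alpha>) / \<alpha> + (1 / 2) powr (\<alpha> - 1) / (1 - \<alpha>))"
  have m: "((\<lambda>s. K1 * ?maj s)
      has_integral K1 * V) {0..t 1}"
    unfolding V_def by (intro has_integral_mult_right first_step_kernel_bound)
  have "norm (integral {0..t 1} (\<lambda>s. ker 1 s * g1 s)) \<le> integral {0..t 1}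
     (\<lambda>s. K1 * ?maj s)"
  proof (rule integral_norm_bound_integral)
    show "(\<lambda>s. ker 1 s * g1 s) integrable_on {0..t 1}" using I by blast
    show "(\<lambda>s. K1 * ?maj s)
      integrable_on {0..t 1}" using m by (rule has_integral_integrable)
    fix s assume s: "s \<in> {0..t 1}"
    have nn: "0 \<le> ker 1 s" by (simp add: ker_def)
    have "norm (ker 1 s * g1 s) = ker 1 s * \<bar>g1 s\<bar>" using nn by (simp add: abs_mult)
    also have "\<dots> \<le> ker 1 s * (K1 * (1 + s powr (\<alpha> - 1)))"
      using nn bound1[of s] s T by (intro mult_left_mono) auto
    also have "\<dots> = K1 * (ker 1 s * (1 + s powr (\<alpha> - 1)))" by simp
    also have "\<dots> \<le> K1 * ?maj s"
      using K_nonneg first_step_kernel_bound(2)[OF s] by (intro mult_left_mono) auto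
    finally show "norm (ker 1 s * g1 s) \<le> \<dots>" .
  qed
  then have Ib: "\<bar>I\<bar> \<le> K1 * V" unfolding integral_unique[OF I] integral_unique[OF m] by simp
  have half: "(1 / 2) powr (-\<alpha>) \<le> 2" "(1 / 2) powr (\<alpha> - 1) \<le> 2"
    using powr_mono'[of "-1" "-\<alpha>" "1 / 2 :: real"] powr_mono'[of "-1" "\<alpha> - 1" "1 / 2 :: real"] alpha
    by (simp_all add: powr_minus)
  have "Gamma (1 - \<alpha>) * L2_operator \<alpha> t nodal 1 = ?x powr (-\<alpha>) / (1 - \<alpha>) * incr nodal 1"
    using L2_operator_1[of nodal] by simp
  then have Lb: "\<bar>Gamma (1 - \<alpha>) * L2_operator \<alpha> t nodal 1\<bar> \<le> 1 / (\<alpha> * (1 - \<alpha>)) * K1 * P"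
  proof -
    assume L: "Gamma (1 - \<alpha>) * L2_operator \<alpha> t nodal 1 = ?x powr (-\<alpha>) / (1 - \<alpha>) * incr nodal 1"
    have "\<bar>incr nodal 1\<bar> \<le> K1 * (?x + ?x powr \<alpha> / \<alpha>)" by (rule incr_1_bound[OF T])
    also have "\<dots> \<le> K1 * (?x / \<alpha> + ?x powr \<alpha> / \<alpha>)"
      using K_nonneg alpha x by (intro mult_left_mono add_right_mono) (auto simp: field_simps)
    also have "\<dots> = K1 * start / \<alpha>" by (simp add: start_def add_divide_distrib[symmetric])
    finally have "?x powr (-\<alpha>) / (1 - \<alpha>) * \<bar>incr nodal 1\<bar> \<le> ?x powr (-\<alpha>) / (1 - \<alpha>) * (K1 * start / \<alpha>)"
      using alpha by (intro mult_left_mono) auto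
    then show ?thesis unfolding L P_def using alpha by (simp add: abs_mult mult_ac)
  qed
  have Vb: "V \<le> 5 / (\<alpha> * (1 - \<alpha>)) * P"
  proof -
    have aa: "0 < \<alpha> * (1 - \<alpha>)" using alpha by simp
    define z where "z = ?x powr (1 - \<alpha>)"
    have z: "0 \<le> z" by (simp add: z_def)
    have "V \<le> z / (1 - \<alpha>) + (2 / \<alpha> + 2 / (1 - \<alpha>))"
      unfolding V_def z_def step_1 using half alpha by (intro add_mono divide_right_mono) auto
    also have "\<dots> = (\<alpha> * z + 2 * (1 - \<alpha>) + 2 * \<alpha>) / (\<alpha> * (1 - \<alpha>))"
      using alpha by (simp add: divide_simps)
    also have "\<dots> \<le> (5 * P) / (\<alpha> * (1 - \<alpha>))"
      using aa alpha z mult_right_mono[of \<alpha> 1 z] unfolding P z_def[symmetric] by (intro divide_right_mono) auto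
    finally show ?thesis by simp
  qed
  have "\<bar>Gamma (1 - \<alpha>) * L2_operator \<alpha> t nodal 1 - I\<bar> \<le> 1 / (\<alpha> * (1 - \<alpha>)) * K1 * P + K1 * (5 / (\<alpha> * (1 - \<alpha>)) * P)"
    using Lb Ib mult_left_mono[OF Vb K_nonneg(1)] by linarith
  also have "\<dots> = 6 / (\<alpha> * (1 - \<alpha>)) * K1 * P"
    by (simp add: add_divide_distrib[symmetric])
  finally show ?thesis by (simp add: P_def)
qed

end

section \<open>Square integrable functions and the weak equation\<close>

lift_definition restrict_l2 :: "'a set \<Rightarrow> ('a::euclidean_space, 'b::euclidean_space) l2 \<Rightarrow> ('a, 'b) l2" is
  "\<lambda>\<Omega> f. if \<Omega> \<in> sets borel then (\<lambda>x. indicat_real \<Omega> x *\<^sub>R f x) else f"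
proof -
  fix \<Omega> :: "'a set" and f g :: "'a \<Rightarrow> 'b"
  assume fg: "square_integrable f \<and> square_integrable g \<and> (AE x in lborel. f x = g x)"
  have sq: "square_integrable (\<lambda>x. indicat_real \<Omega> x *\<^sub>R h x)"
    if "\<Omega> \<in> sets borel" "square_integrable h" for h :: "'a \<Rightarrow> 'b"
  proof -
    have h: "h \<in> borel_measurable lborel" "integrable lborel (\<lambda>x. (norm (h x))\<^sup>2)"
      using that(2) by (auto simp: square_integrable_def)
    have [measurable]: "h \<in> borel_measurable borel" "\<Omega> \<in> sets borel" using h that by auto
    have "integrable lborel (\<lambda>x. (norm (indicat_real \<Omega> x *\<^sub>R h x))\<^sup>2)"
      by (rule Bochner_Integration.integrable_bound[OF h(2)]) (auto intro!: AE_I2 simp: indicator_def)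
    then show ?thesis unfolding square_integrable_def by simp
  qed
  from fg have "AE x in lborel. indicat_real \<Omega> x *\<^sub>R f x = indicat_real \<Omega> x *\<^sub>R g x"
    by (elim conjE) (erule eventually_mono, simp)
  then show "square_integrable (if \<Omega> \<in> sets borel then \<lambda>x. indicat_real \<Omega> x *\<^sub>R f x else f) \<and>
       square_integrable (if \<Omega> \<in> sets borel then \<lambda>x. indicat_real \<Omega> x *\<^sub>R g x else g) \<and>
       (AE x in lborel. (if \<Omega> \<in> sets borel then \<lambda>x. indicat_real \<Omega> x *\<^sub>R f x else f) x =
                 (if \<Omega> \<in> sets borel then \<lambda>x. indicat_real \<Omega> x *\<^sub>R g x else g) x)"
    using fg sq by auto
qed

lemma restrict_l2_inner:
  assumes "\<Omega> \<in> sets borel" "vanishes_outside \<Omega> w"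
  shows "restrict_l2 \<Omega> f \<bullet> w = f \<bullet> w"
  using assms
proof (transfer, elim conjE)
  fix \<Omega> :: "'a set" and w f :: "'a \<Rightarrow> 'b"
  assume \<Omega>: "\<Omega> \<in> sets borel" and w: "AE x in lborel. x \<notin> \<Omega> \<longrightarrow> w x = 0"
    and sq: "square_integrable w" "square_integrable f"
  have [measurable]: "w \<in> borel_measurable borel" "f \<in> borel_measurable borel" "\<Omega> \<in> sets borel"
    using sq \<Omega> by (auto simp: square_integrable_def)
  have "AE x in lborel. (indicat_real \<Omega> x *\<^sub>R f x) \<bullet> w x = f x \<bullet> w x"
    using w by eventually_elim (auto simp: indicator_def)
  then have "(LINT x|lborel. (indicat_real \<Omega> x *\<^sub>R f x) \<bullet> w x) = (LINT x|lborel. f x \<bullet> w x)"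
    by (intro integral_cong_AE) auto
  then show "(LINT x|lborel. (if \<Omega> \<in> sets borel then \<lambda>x. indicat_real \<Omega> x *\<^sub>R f x else f) x \<bullet> w x) =
       (LINT x|lborel. f x \<bullet> w x)" using \<Omega> by simp
qed

lemma restrict_l2_norm:
  assumes "\<Omega> \<in> sets borel" "emeasure lborel \<Omega> < \<infinity>" "ae_bounded \<Omega> f c" "0 \<le> c"
  shows "restrict_l2 \<Omega> f \<bullet> restrict_l2 \<Omega> f \<le> c\<^sup>2 * measure lborel \<Omega>"
  using assms
proof (transfer, elim conjE)
  fix \<Omega> :: "'a set" and f :: "'a \<Rightarrow> 'b" and c :: real
  assume \<Omega>: "\<Omega> \<in> sets borel" "emeasure lborel \<Omega> < \<infinity>" and f: "AE x in lborel. x \<in> \<Omega> \<longrightarrow> norm (f x) \<le> c"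
    and c: "0 \<le> c" and sq: "square_integrable f"
  have [measurable]: "f \<in> borel_measurable borel" "\<Omega> \<in> sets borel"
    using sq \<Omega> by (auto simp: square_integrable_def)
  have le: "AE x in lborel. (indicat_real \<Omega> x *\<^sub>R f x) \<bullet> (indicat_real \<Omega> x *\<^sub>R f x) \<le> c\<^sup>2 * indicat_real \<Omega> x"
    using f by eventually_elim (auto simp: indicator_def power2_norm_eq_inner[symmetric] intro!: power_mono)
  have int: "integrable lborel (\<lambda>x. c\<^sup>2 * indicat_real \<Omega> x)"
    using \<Omega> by (intro integrable_mult_right integrable_real_indicator) auto
  have "(LINT x|lborel. (indicat_real \<Omega> x *\<^sub>R f x) \<bullet> (indicat_real \<Omega> x *\<^sub>R f x)) \<le> (LINT x|lborel. c\<^sup>2 * indicat_real \<Omega> x)"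
  proof (rule integral_mono_AE[OF _ int le])
    show "integrable lborel (\<lambda>x. (indicat_real \<Omega> x *\<^sub>R f x) \<bullet> (indicat_real \<Omega> x *\<^sub>R f x))"
    proof (rule Bochner_Integration.integrable_bound[OF int])
      show "AE x in lborel. norm ((indicat_real \<Omega> x *\<^sub>R f x) \<bullet> (indicat_real \<Omega> x *\<^sub>R f x))
          \<le> norm (c\<^sup>2 * indicat_real \<Omega> x)"
        using le
      proof eventually_elim
        case (elim x)
        with inner_ge_zero[of "indicat_real \<Omega> x *\<^sub>R f x"] show ?case
          unfolding real_norm_def by linarith
      qed
    qed measurable
  qed
  also have "\<dots> = c\<^sup>2 * measure lborel \<Omega>" using \<Omega> by simp
  finally show "(LINT x|lborel. (if \<Omega> \<in> sets borel then \<lambda>x. indicat_real \<Omega> x *\<^sub>R f x else f) x \<bullet>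
      (if \<Omega> \<in> sets borel then \<lambda>x. indicat_real \<Omega> x *\<^sub>R f x else f) x) \<le> c\<^sup>2 * measure lborel \<Omega>"
    using \<Omega> by simp
qed

text \<open>The inner product with \<open>w\<close> sees only the restriction of \<open>f\<close> to \<open>\<Omega>\<close>, whose norm is controlled by the pointwise bound.\<close>

lemma ae_bounded_inner_le:
  fixes f w :: "('a::euclidean_space, 'b::euclidean_space) l2"
  assumes "open \<Omega>" "bounded \<Omega>" "vanishes_outside \<Omega> w" "ae_bounded \<Omega> f c" "0 \<le> c"
  shows "\<bar>f \<bullet> w\<bar> \<le> c * sqrt (measure lborel \<Omega>) * norm w"
proof -
  have \<Omega>: "\<Omega> \<in> sets borel" "emeasure lborel \<Omega> < \<infinity>"
    using assms(1,2) emeasure_bounded_finite by auto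
  have "norm (restrict_l2 \<Omega> f) \<le> sqrt (c\<^sup>2 * measure lborel \<Omega>)"
    unfolding norm_eq_sqrt_inner using restrict_l2_norm[OF \<Omega> assms(4,5)] by (rule real_sqrt_le_mono)
  also have "\<dots> = c * sqrt (measure lborel \<Omega>)"
    using assms(5) by (simp add: real_sqrt_mult)
  finally have "norm (restrict_l2 \<Omega> f) \<le> c * sqrt (measure lborel \<Omega>)" .
  then have "norm (restrict_l2 \<Omega> f) * norm w \<le> c * sqrt (measure lborel \<Omega>) * norm w"
    by (intro mult_right_mono) auto
  then show ?thesis
    using Cauchy_Schwarz_ineq2[of "restrict_l2 \<Omega> f" w] restrict_l2_inner[OF \<Omega>(1) assms(3), of f] by simp
qed

lemma vanishes_outside_diff:
  "vanishes_outside \<Omega> f \<Longrightarrow> vanishes_outside \<Omega> g \<Longrightarrow> vanishes_outside \<Omega> (f - g)"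
proof transfer
  fix \<Omega> and f g :: "'a \<Rightarrow> 'b"
  assume "AE x in lborel. x \<notin> \<Omega> \<longrightarrow> f x = 0" "AE x in lborel. x \<notin> \<Omega> \<longrightarrow> g x = 0"
  then show "AE x in lborel. x \<notin> \<Omega> \<longrightarrow> f x - g x = 0" by eventually_elim auto
qed

lemma vanishes_outside_0: "vanishes_outside \<Omega> 0"
  by transfer simp

lemma H10_vanishes_outside: "v \<in> H10 \<Omega> \<Longrightarrow> vanishes_outside \<Omega> (func v)"
  by (auto simp: H10_def H1_def L2_def)

text \<open>Both sides are continuous in the pair of a function and its gradient, and $H^1_0$ lies in the closure of the test functions in
the $H^1$ norm.\<close>

lemma weak_equation_on_H10:
  assumes test: "\<And>\<phi>. test_function \<Omega> \<phi> \<Longrightarrow> w \<bullet> to_l2 \<phi> = - (G \<bullet> to_l2 (gradient \<phi>))"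
    and v: "v \<in> H10 \<Omega>"
  shows "w \<bullet> func v = - (G \<bullet> grad v)"
proof -
  let ?S = "{v :: 'a sobolev. w \<bullet> fst v + G \<bullet> snd v = 0}"
  have "closed ?S" by (intro closed_Collect_eq continuous_intros)
  moreover have "{(to_l2 \<phi>, to_l2 (gradient \<phi>)) |\<phi>. test_function \<Omega> \<phi>} \<subseteq> ?S" using test by auto
  ultimately have "closure {(to_l2 \<phi>, to_l2 (gradient \<phi>)) |\<phi>. test_function \<Omega> \<phi>} \<subseteq> ?S"
    by (rule closure_minimal[rotated])
  then have "v \<in> ?S" using v by (auto simp: H10_def)
  then show ?thesis by simp
qed

lemma eq_laplacian_plus_difference:
  assumes "eq_laplacian_plus \<Omega> w1 v1 F" "eq_laplacian_plus \<Omega> w2 v2 F" "v \<in> H10 \<Omega>"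
  shows "(w1 - w2) \<bullet> func v = - ((grad v1 - grad v2) \<bullet> grad v)"
  using assms(3) by (rule weak_equation_on_H10[rotated])
    (use assms(1,2) in \<open>simp add: eq_laplacian_plus_def inner_diff_left\<close>)

lemma Dt_Suc: "Dt S (Suc l) u s = vector_derivative (Dt S l u) (at s within S)"
  by (simp add: Dt_def)

lemma Ck_curve_has_derivative:
  assumes "Ck_curve k S u" "l < k" "s \<in> interior S"
  shows "(Dt S l u has_vector_derivative Dt S (Suc l) u s) (at s)"
proof -
  have "s \<in> S" using assms(3) interior_subset by blast
  then have "Dt S l u differentiable (at s within S)"
    using assms(1,2) by (auto simp: Ck_curve_def differentiable_on_def)
  then have "(Dt S l u has_vector_derivative Dt S (Suc l) u s) (at s within S)"
    unfolding Dt_Suc by (rule iffD1[OF vector_derivative_works])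
  then show ?thesis unfolding at_within_interior[OF assms(3)] .
qed

lemma interior_halfopen: "0 < s \<Longrightarrow> s < T \<Longrightarrow> s \<in> interior {0<..T}" for s T :: real
  using interior_maximal[of "{0<..<T}" "{0<..T}"] by fastforce

lemma bounded_linear_func_inner: "bounded_linear (\<lambda>v::'a::euclidean_space sobolev. func v \<bullet> w)"
  by (rule bounded_linear_compose[OF bounded_linear_inner_left bounded_linear_fst])

text \<open>Bounded linear functionals commute with the gauge integral; at the end points the integrands may differ.\<close>

lemma caputo_integral_inner:
  assumes u: "Ck_curve k {0<..T} u" "0 < k" and t: "0 < t" "t \<le> T"
    and I: "((\<lambda>s. (t - s) powr (-\<alpha>) *\<^sub>R vector_derivative (\<lambda>s. func (u s)) (at s)) has_integral I) {0..t}"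
    and G: "\<And>s. 0 < s \<Longrightarrow> s < t \<Longrightarrow> G s = func (Dt {0<..T} 1 u s) \<bullet> w"
  shows "((\<lambda>s. (t - s) powr (-\<alpha>) * G s) has_integral (I \<bullet> w)) {0..t}"
proof -
  have "((\<lambda>s. ((t - s) powr (-\<alpha>) *\<^sub>R vector_derivative (\<lambda>s. func (u s)) (at s)) \<bullet> w) has_integral (I \<bullet> w)) {0..t}"
    using has_integral_linear[OF I bounded_linear_inner_left[of w]] by (simp add: o_def)
  then show ?thesis
  proof (rule has_integral_spike_finite[of "{0, t}", rotated 2])
    fix s assume s: "s \<in> {0..t} - {0, t}"
    then have "s \<in> interior {0<..T}" using t by (intro interior_halfopen) auto
    from Ck_curve_has_derivative[OF u this]
    have "((\<lambda>s. func (Dt {0<..T} 0 u s)) has_vector_derivative func (Dt {0<..T} 1 u s)) (at s)"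
      unfolding One_nat_def by (rule bounded_linear.has_vector_derivative[OF bounded_linear_fst])
    then have "vector_derivative (\<lambda>s. func (u s)) (at s) = func (Dt {0<..T} 1 u s)"
      by (intro vector_derivative_at) (simp add: Dt_def)
    then show "(t - s) powr (-\<alpha>) * G s = ((t - s) powr (-\<alpha>) *\<^sub>R vector_derivative (\<lambda>s. func (u s)) (at s)) \<bullet> w"
      using G[of s] s by auto
  qed simp
qed

lemma step_extended:
  "step (\<lambda>k. if k \<le> n then t k else t n + real (k - n) * step t n) k = (if k \<le> n then step t k else step t n)"
proof (cases "k \<le> n")
  case False
  then obtain d where "k = Suc (n + d)" by (metis less_iff_Suc_add not_le)
  then show ?thesis by (cases d) (auto simp: step_def algebra_simps)
next
  case True
  then have "k - 1 \<le> n" by simp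
  with True show ?thesis by (simp add: step_def)
qed

text \<open>The quadratic form argument at level \<open>n\<close> compares row \<open>n\<close> with row \<open>n + 1\<close>. Continuing the mesh with the constant step \<open>step t n\<close> supplies
all later rows and is admissible because \<open>rho_L \<le> 1 \<le> rho_R\<close>; the operators up to level \<open>n\<close> do not change.\<close>

lemma extended_ratio_mesh:
  assumes mesh: "time_mesh T N t" and ratio: "\<forall>k\<in>{2..N}. step t k / step t (k - 1) \<in> {rho_L..rho_R}"
    and n: "1 \<le> n" "n \<le> N"
  shows "ratio_mesh (\<lambda>k. if k \<le> n then t k else t n + real (k - n) * step t n)" (is "ratio_mesh ?t")
proof
  have pos: "0 < step t k" if "1 \<le> k" "k \<le> N" for k
  proof -
    obtain i where "k = Suc i" using \<open>1 \<le> k\<close> by (cases k) auto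
    then show ?thesis using mesh that by (simp add: step_def time_mesh_def)
  qed
  show "?t 0 = 0" using mesh by (simp add: time_mesh_def)
  show "?t k < ?t (Suc k)" for k
  proof -
    have "0 < step ?t (Suc k)" unfolding step_extended using pos n by auto
    then show ?thesis by (simp only: step_def diff_Suc_1 diff_gt_0_iff_gt)
  qed
  show "step ?t (Suc k) / step ?t k \<in> {rho_L..rho_R}" if "1 \<le> k" for k
  proof (cases "Suc k \<le> n")
    case True
    then have "step t (Suc k) / step t k \<in> {rho_L..rho_R}" using ratio n that by (auto dest: bspec[of _ _ "Suc k"])
    then show ?thesis unfolding step_extended using True by simp
  next
    case False
    have "step ?t (Suc k) = step t n" "step ?t k = step t n"
      unfolding step_extended using False by (auto simp: not_less_eq_eq le_antisym)
    then show ?thesis using pos[of n] n rho_L_bounds rho_R_bounds by simp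
  qed
qed

lemma L2_operator_cong:
  assumes "\<And>i. i \<le> k \<Longrightarrow> t i = t' i" "1 \<le> k"
  shows "L2_operator \<alpha> t v k = L2_operator \<alpha> t' v k"
proof -
  have l: "lagrange2 t v j = lagrange2 t' v j" if "j \<in> {1..k-1}" for j
    unfolding lagrange2_def[abs_def] using assms that by auto
  show ?thesis
  proof (cases "k = 1")
    case True
    then show ?thesis using assms by (simp add: L2_operator_def step_def)
  next
    case False
    then have "k - 1 \<in> {1..k-1}" using assms(2) by auto
    with l have "lagrange2 t v (k - 1) = lagrange2 t' v (k - 1)" by blast
    moreover have "(\<Sum>j=1..k-1. integral {t (j - 1)..t j}
            (\<lambda>s. (t k - s) powr (-\<alpha>) *\<^sub>R vector_derivative (lagrange2 t v j) (at s)))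
       = (\<Sum>j=1..k-1. integral {t' (j - 1)..t' j}
            (\<lambda>s. (t' k - s) powr (-\<alpha>) *\<^sub>R vector_derivative (lagrange2 t' v j) (at s)))"
      by (intro sum.cong refl) (use l assms in auto)
    ultimately show ?thesis using assms False by (simp add: L2_operator_def)
  qed
qed

context subdiffusion_mesh
begin

lemma L2_operator_linear:
  fixes v :: "nat \<Rightarrow> 'v::real_normed_vector" and h :: "'v \<Rightarrow> 'w::real_normed_vector"
  assumes k: "1 \<le> k" and h: "linear h"
  shows "L2_operator \<alpha> t (\<lambda>i. h (v i)) k = h (L2_operator \<alpha> t v k)"
proof -
  have incr: "incr (\<lambda>i. h (v i)) = (\<lambda>j. h (incr v j))" by (simp add: incr_def[abs_def] linear_diff[OF h])
  have "Gamma (1 - \<alpha>) *\<^sub>R L2_operator \<alpha> t (\<lambda>i. h (v i)) k = h (Gamma (1 - \<alpha>) *\<^sub>R L2_operator \<alpha> t v k)"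
  proof (cases "k = 1")
    case True
    show ?thesis unfolding True L2_operator_1 incr by (simp add: linear_scale[OF h])
  next
    case False
    then have "2 \<le> k" using k by simp
    then show ?thesis unfolding L2_operator_eq[OF \<open>2 \<le> k\<close>] incr
      by (simp only: linear_add[OF h] linear_diff[OF h] linear_scale[OF h] linear_sum[OF h])
  qed
  moreover have "Gamma (1 - \<alpha>) \<noteq> 0" using Gamma_pos by linarith
  ultimately show ?thesis by (simp add: linear_scale[OF h])
qed

lemma L2_operator_diff:
  fixes a b :: "nat \<Rightarrow> 'v::real_normed_vector"
  assumes k: "1 \<le> k"
  shows "L2_operator \<alpha> t (\<lambda>i. a i - b i) k = L2_operator \<alpha> t a k - L2_operator \<alpha> t b k"
proof -
  have 1: "linear (\<lambda>p::'v \<times> 'v. fst p - snd p)" "linear (fst :: 'v \<times> 'v \<Rightarrow> 'v)" "linear (snd :: 'v \<times> 'v \<Rightarrow> 'v)"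
    by (auto intro!: linearI simp: scaleR_diff_right)
  show ?thesis
    using L2_operator_linear[OF k 1(1), of "\<lambda>i. (a i, b i)"] L2_operator_linear[OF k 1(2), of "\<lambda>i. (a i, b i)"]
      L2_operator_linear[OF k 1(3), of "\<lambda>i. (a i, b i)"] by simp
qed

text \<open>The gradients telescope, and Young's inequality with the weight $\tau_k^{-\alpha}$ spends exactly the coercivity constant
\<open>1 / 40\<close> on the increments.\<close>

theorem energy_estimate:
  fixes v R :: "nat \<Rightarrow> 'v::real_inner" and G :: "nat \<Rightarrow> 'w::real_inner"
  assumes eq: "\<And>k. k \<in> {1..n} \<Longrightarrow> (L2_operator \<alpha> t v k - R k) \<bullet> incr v k = - (G k \<bullet> (G k - G (k - 1)))"
    and G0: "G 0 = 0"
    and R: "\<And>k. k \<in> {1..n} \<Longrightarrow> \<bar>Gamma (1 - \<alpha>) * (R k \<bullet> incr v k)\<bar> \<le> F k * norm (incr v k)"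
  shows "(norm (G n))\<^sup>2 \<le> 20 / Gamma (1 - \<alpha>) * (\<Sum>k=1..n. step t k powr \<alpha> * (F k)\<^sup>2)"
proof -
  let ?g = "Gamma (1 - \<alpha>)"
  have tele: "(norm (G m))\<^sup>2 / 2 \<le> (\<Sum>k=1..m. G k \<bullet> (G k - G (k - 1)))" for m
  proof (induction m)
    case (Suc m)
    have "0 \<le> (norm (G (Suc m) - G m))\<^sup>2" by simp
    then have "(norm (G (Suc m)))\<^sup>2 / 2 - (norm (G m))\<^sup>2 / 2 \<le> G (Suc m) \<bullet> (G (Suc m) - G m)"
      by (simp add: power2_norm_eq_inner inner_diff_left inner_diff_right inner_commute)
    with Suc show ?case by simp
  qed (simp add: G0)
  have young: "F k * norm (incr v k) \<le> energy v k / 40 + 10 * (step t k powr \<alpha> * (F k)\<^sup>2)" if k: "k \<in> {1..n}" for k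
  proof -
    let ?p = "step t k powr (- (\<alpha> / 2))" and ?q = "step t k powr (\<alpha> / 2)"
    have pos: "0 < step t k" using k by (intro step_pos) auto
    have pq: "?p * ?q = 1" "?p\<^sup>2 = step t k powr (-\<alpha>)" "?q\<^sup>2 = step t k powr \<alpha>"
      using pos by (simp_all add: powr_add[symmetric] power2_eq_square)
    have "0 \<le> (?p * norm (incr v k) - 20 * (?q * F k))\<^sup>2" by simp
    also have "\<dots> = energy v k + 400 * (step t k powr \<alpha> * (F k)\<^sup>2) - 40 * (?p * ?q) * (F k * norm (incr v k))"
      by (simp add: power2_diff power_mult_distrib pq(2,3) energy_def)
    finally show ?thesis unfolding pq(1) by simp
  qed
  have "?g * ((norm (G n))\<^sup>2 / 2) \<le> ?g * (\<Sum>k=1..n. G k \<bullet> (G k - G (k - 1)))"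
    using tele Gamma_pos by (intro mult_left_mono) auto
  also have "\<dots> = ?g * (\<Sum>k=1..n. R k \<bullet> incr v k - L2_operator \<alpha> t v k \<bullet> incr v k)"
  proof -
    have "G k \<bullet> (G k - G (k - 1)) = R k \<bullet> incr v k - L2_operator \<alpha> t v k \<bullet> incr v k" if "k \<in> {1..n}" for k
      using eq[OF that] unfolding inner_diff_left by linarith
    then show ?thesis by simp
  qed
  also have "\<dots> = (\<Sum>k=1..n. ?g * (R k \<bullet> incr v k)) - ?g * (\<Sum>k=1..n. L2_operator \<alpha> t v k \<bullet> incr v k)"
    by (simp add: sum_subtractf right_diff_distrib sum_distrib_left)
  also have "\<dots> \<le> (\<Sum>k=1..n. energy v k / 40 + 10 * (step t k powr \<alpha> * (F k)\<^sup>2)) - (\<Sum>k=1..n. energy v k) / 40"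
  proof (rule diff_mono)
    show "(\<Sum>k=1..n. ?g * (R k \<bullet> incr v k)) \<le> (\<Sum>k=1..n. energy v k / 40 + 10 * (step t k powr \<alpha> * (F k)\<^sup>2))"
    proof (rule sum_mono)
      fix k assume k: "k \<in> {1..n}"
      show "?g * (R k \<bullet> incr v k) \<le> energy v k / 40 + 10 * (step t k powr \<alpha> * (F k)\<^sup>2)"
        using R[OF k] young[OF k] by linarith
    qed
  qed (rule L2_operator_coercive)
  also have "\<dots> = 10 * (\<Sum>k=1..n. step t k powr \<alpha> * (F k)\<^sup>2)"
    by (simp add: sum.distrib sum_divide_distrib sum_distrib_left)
  finally show ?thesis using Gamma_pos by (simp add: field_simps)
qed

text \<open>The truncation error of the first step does not tend to zero with the step sizes, but neither does
\<open>consistency 2\<close>, whose first term is a power of \<open>step t 1 / step t 2\<close>.\<close>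

lemma first_step_absorbed:
  "step t 1 powr (-\<alpha>) * start \<le> 88 * consistency 2" "step t 1 powr \<alpha> \<le> 11 / 5 * step t 2 powr \<alpha>"
proof -
  have x: "0 < step t 1" "0 < step t 2" using step_pos by auto
  have "step t 2 \<le> 4 * step t 1" using step_Suc_le[of 1] by (simp add: numeral_2_eq_2)
  then have "step t 1 powr (-\<alpha>) \<le> (1 / 4 * step t 2) powr (-\<alpha>)"
    using x alpha by (intro powr_mono2') auto
  also have "\<dots> = (1 / 4) powr (-\<alpha>) * step t 2 powr (-\<alpha>)" by (rule powr_mult)
  also have "\<dots> = 4 powr \<alpha> * step t 2 powr (-\<alpha>)" by (simp add: powr_divide powr_minus)
  also have "\<dots> \<le> 4 powr 1 * step t 2 powr (-\<alpha>)"
    using alpha by (intro mult_right_mono powr_mono) auto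
  finally have "step t 1 powr (-\<alpha>) * start \<le> 4 powr 1 * step t 2 powr (-\<alpha>) * start"
    using start_nonneg by (intro mult_right_mono)
  then show "step t 1 powr (-\<alpha>) * start \<le> 88 * consistency 2" using start_le_consistency_2 by simp
  have "step t 1 powr \<alpha> \<le> (11 / 5 * step t 2) powr \<alpha>"
    using step_le_Suc[of 1] x alpha by (intro powr_mono2) (auto simp: numeral_2_eq_2)
  also have "\<dots> = (11 / 5) powr \<alpha> * step t 2 powr \<alpha>" by (rule powr_mult)
  also have "\<dots> \<le> (11 / 5) powr 1 * step t 2 powr \<alpha>"
    using alpha by (intro mult_right_mono powr_mono) auto
  finally show "step t 1 powr \<alpha> \<le> 11 / 5 * step t 2 powr \<alpha>" by simp
qed

end

section \<open>The error estimate\<close>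

lemma ae_bounded_mono:
  assumes "ae_bounded \<Omega> f c" "c \<le> d"
  shows "ae_bounded \<Omega> f d"
  using assms
proof (transfer, elim conjE)
  fix \<Omega> :: "'a set" and f :: "'a \<Rightarrow> 'b" and c d :: real
  assume "AE x in lborel. x \<in> \<Omega> \<longrightarrow> norm (f x) \<le> c" "c \<le> d"
  then show "AE x in lborel. x \<in> \<Omega> \<longrightarrow> norm (f x) \<le> d" by (auto elim!: eventually_mono)
qed

text \<open>The value at time zero of the first derivative is set to zero to comply with the bound there.\<close>

lemma solution_component_scalar_curve:
  assumes mesh: "subdiffusion_mesh t \<alpha>"
    and \<Omega>: "open \<Omega>" "bounded \<Omega>" and w: "vanishes_outside \<Omega> w"
    and sol: "subdiffusion_solution \<alpha> T \<Omega> f u0 u"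
    and b1: "\<forall>s\<in>{0<..T}. ae_bounded \<Omega> (func (Dt {0<..T} 1 u s)) (C1 * (1 + s powr (\<alpha> - 1)))"
    and b3: "\<forall>s\<in>{0<..T}. ae_bounded \<Omega> (func (Dt {0<..T} 3 u s)) (C3 * (1 + s powr (\<alpha> - 3)))"
  defines "g \<equiv> \<lambda>l s. func (Dt {0<..T} l u s) \<bullet> w"
  shows "scalar_curve t \<alpha> (\<lambda>s. func (u s) \<bullet> w) (\<lambda>s. if s = 0 then 0 else g 1 s) (g 2) (g 3) T
    (\<bar>C1\<bar> * sqrt (measure lborel \<Omega>) * norm w) (\<bar>C3\<bar> * sqrt (measure lborel \<Omega>) * norm w)"
proof -
  interpret subdiffusion_mesh t \<alpha> by (rule mesh)
  have u: "Ck_curve 3 {0<..T} u" and cont0: "continuous_on {0..T} (\<lambda>s. func (u s))"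
    using sol by (auto simp: subdiffusion_solution_def)
  have d: "(g l has_real_derivative g (Suc l) s) (at s)" if "l < 3" "0 < s" "s < T" for l s
    unfolding g_def has_real_derivative_iff_has_vector_derivative
    using Ck_curve_has_derivative[OF u that(1) interior_halfopen[OF that(2,3)]]
    by (rule bounded_linear.has_vector_derivative[OF bounded_linear_func_inner])
  have g0: "g 0 = (\<lambda>s. func (u s) \<bullet> w)" by (simp add: g_def Dt_def)
  have eq: "eventually (\<lambda>x. (if x = 0 then 0 else g 1 x) = g 1 x) (nhds s)" if "0 < s" for s
  proof -
    have "eventually (\<lambda>x. x \<in> {0<..}) (nhds s)" using that by (intro eventually_nhds_in_open) auto
    then show ?thesis by (rule eventually_mono) auto
  qed
  have bnd: "\<bar>func (Dt {0<..T} l u s) \<bullet> w\<bar> \<le> \<bar>C\<bar> * sqrt (measure lborel \<Omega>) * norm w * (1 + s powr p)"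
    if "ae_bounded \<Omega> (func (Dt {0<..T} l u s)) (C * (1 + s powr p))" for l s C p
  proof -
    have "C * (1 + s powr p) \<le> \<bar>C\<bar> * (1 + s powr p)" by (intro mult_right_mono) auto
    from ae_bounded_inner_le[OF \<Omega> w ae_bounded_mono[OF that this]] show ?thesis by (simp add: mult_ac)
  qed
  show ?thesis
  proof
    show "continuous_on {0..T} (\<lambda>s. func (u s) \<bullet> w)" by (intro continuous_intros cont0)
    have "continuous_on {0<..T} (Dt {0<..T} 1 u)"
      using u by (auto simp: Ck_curve_def intro: differentiable_imp_continuous_on)
    then have "continuous_on {0<..T} (g 1)" unfolding g_def by (intro continuous_intros)
    then show "continuous_on {0<..T} (\<lambda>s. if s = 0 then 0 else g 1 s)"
      by (rule continuous_on_eq) auto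
    fix s
    show "\<bar>if s = 0 then 0 else g 1 s\<bar> \<le> \<bar>C1\<bar> * sqrt (measure lborel \<Omega>) * norm w * (1 + s powr (\<alpha> - 1))"
      if "0 \<le> s" "s \<le> T"
      using that bnd[of 1 s C1 "\<alpha> - 1"] b1 by (auto simp: g_def)
    show "\<bar>g 3 s\<bar> \<le> \<bar>C3\<bar> * sqrt (measure lborel \<Omega>) * norm w * (1 + s powr (\<alpha> - 3))" if "0 < s" "s \<le> T"
      using that bnd[of 3 s C3 "\<alpha> - 3"] b3 by (auto simp: g_def)
    assume s: "0 < s" "s < T"
    show "((\<lambda>s. func (u s) \<bullet> w) has_real_derivative (if s = 0 then 0 else g 1 s)) (at s)"
      using d[of 0 s] s unfolding g0 by simp
    show "((\<lambda>s. if s = 0 then 0 else g 1 s) has_real_derivative g 2 s) (at s)"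
      using DERIV_cong_ev[OF refl eq[OF s(1)] refl] d[of 1 s] s by (simp add: numeral_2_eq_2)
    show "(g 2 has_real_derivative g 3 s) (at s)"
      using d[of 2 s] s by (simp add: numeral_3_eq_3 numeral_2_eq_2)
  qed auto
qed

text \<open>The constant is explicit and depends on the domain through its volume only. The gradients of the initial values are left
unspecified, so the error \<open>G\<close> of the gradient starts with the value zero by definition, in accordance with \<open>v 0 = 0\<close>.\<close>

theorem L2_scheme_error:
  fixes \<Omega> :: "'a::euclidean_space set" and u :: "real \<Rightarrow> 'a sobolev"
  assumes \<alpha>: "0 < \<alpha>" "\<alpha> < 1" and \<Omega>: "open \<Omega>" "bounded \<Omega>" and T: "0 < T"
    and sol: "subdiffusion_solution \<alpha> T \<Omega> f u0 u"
    and b1: "\<forall>s\<in>{0<..T}. ae_bounded \<Omega> (func (Dt {0<..T} 1 u s)) (C1 * (1 + s powr (\<alpha> - 1)))"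
    and b3: "\<forall>s\<in>{0<..T}. ae_bounded \<Omega> (func (Dt {0<..T} 3 u s)) (C3 * (1 + s powr (\<alpha> - 3)))"
    and mesh: "time_mesh T N t"
    and ratio: "\<forall>k\<in>{2..N}. step t k / step t (k - 1) \<in> {rho_L..rho_R}"
    and scheme: "L2_scheme_solution \<alpha> \<Omega> f t N u0 U"
    and n: "2 \<le> n" "n \<le> N"
  defines "A \<equiv> 2000 / (\<alpha> * (1 - \<alpha>)) * ((\<bar>C1\<bar> + \<bar>C3\<bar>) * sqrt (measure lborel \<Omega>))"
  shows "(norm (grad (u (t n)) - grad (U n)))\<^sup>2
      \<le> 64 * A\<^sup>2 / Gamma (1 - \<alpha>) * (\<Sum>k=2..n. step t k powr \<alpha> *
          (step t 1 powr \<alpha> * (t k - t 1) powr (-\<alpha>)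
           + (\<Sum>j=2..k-1. step t j ^ 4 * (1 + t (j - 1) powr (\<alpha> - 3)) * (t k - t j) powr (-\<alpha> - 1))
           + step t k powr (3 - \<alpha>) * (1 + t (k - 1) powr (\<alpha> - 3)))\<^sup>2)" (is "_ \<le> _ * (\<Sum>k=2..n. ?T k)")
proof -
  define t' where "t' k = (if k \<le> n then t k else t n + real (k - n) * step t n)" for k
  have t': "t' k = t k" if "k \<le> n" for k using that by (simp add: t'_def)
  interpret full: ratio_mesh "\<lambda>k. if k \<le> N then t k else t N + real (k - N) * step t N"
    using extended_ratio_mesh[OF mesh ratio, of N] n by simp
  interpret M: subdiffusion_mesh t' \<alpha>
  proof -
    have "ratio_mesh t'"
      using extended_ratio_mesh[OF mesh ratio, of n] n unfolding t'_def[abs_def] by simp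
    then show "subdiffusion_mesh t' \<alpha>" using \<alpha> by (simp add: subdiffusion_mesh_def subdiffusion_mesh_axioms_def)
  qed
  have tT: "0 < t' k" "t' k \<le> T" if "k \<in> {1..n}" for k
  proof -
    show "0 < t' k" using that M.step_pos[of 1] M.mesh_le[of 1 k] by (simp add: M.step_1)
    show "t' k \<le> T" using that full.mesh_le[of k N] n t'[of k] mesh by (simp add: time_mesh_def)
  qed
  let ?g = "Gamma (1 - \<alpha>)"
  have gpos: "0 < ?g" by (rule M.Gamma_pos)
  define v where "v i = func (u (t' i)) - func (U i)" for i
  define G where "G i = (if i = 0 then 0 else grad (u (t' i)) - grad (U i))" for i
  have v0: "v 0 = 0"
    using sol scheme M.mesh_0 by (simp add: v_def subdiffusion_solution_def L2_scheme_solution_def)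
  have uH: "u (t' k) \<in> H10 \<Omega>" and UH: "U k \<in> H10 \<Omega>" if "k \<in> {1..n}" for k
  proof -
    have "t' k \<in> {0<..T}" using tT[OF that] by simp
    then show "u (t' k) \<in> H10 \<Omega>" using sol unfolding subdiffusion_solution_def by blast
    have "k \<in> {1..N}" using that n by simp
    then show "U k \<in> H10 \<Omega>" using scheme unfolding L2_scheme_solution_def by blast
  qed
  define P where "P k I \<longleftrightarrow>
      ((\<lambda>s. (t' k - s) powr (-\<alpha>) *\<^sub>R vector_derivative (\<lambda>s. func (u s)) (at s)) has_integral I) {0..t' k} \<and>
      eq_laplacian_plus \<Omega> ((1 / ?g) *\<^sub>R I) (u (t' k)) (f (t' k))" for k I
  have "\<exists>I. \<forall>k\<in>{1..n}. P k (I k)"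
  proof (rule bchoice, rule ballI)
    fix k assume "k \<in> {1..n}"
    then have "t' k \<in> {0<..T}" using tT by simp
    then obtain D where "has_caputo_derivative \<alpha> (\<lambda>s. func (u s)) D (t' k)"
      "eq_laplacian_plus \<Omega> D (u (t' k)) (f (t' k))"
      using sol unfolding subdiffusion_solution_def by blast
    then show "\<exists>I. P k I" unfolding has_caputo_derivative_def P_def by blast
  qed
  then obtain I where "\<forall>k\<in>{1..n}. P k (I k)" ..
  then have I: "((\<lambda>s. (t' k - s) powr (-\<alpha>) *\<^sub>R vector_derivative (\<lambda>s. func (u s)) (at s)) has_integral I k) {0..t' k}"
    "eq_laplacian_plus \<Omega> ((1 / ?g) *\<^sub>R I k) (u (t' k)) (f (t' k))" if "k \<in> {1..n}" for k
    using that unfolding P_def by blast+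
  define R where "R k = L2_operator \<alpha> t' (\<lambda>i. func (u (t' i))) k - (1 / ?g) *\<^sub>R I k" for k
  have Lv: "L2_operator \<alpha> t' v k - R k = (1 / ?g) *\<^sub>R I k - L2_operator \<alpha> t' (\<lambda>i. func (U i)) k"
    if "k \<in> {1..n}" for k
    using M.L2_operator_diff[of k "\<lambda>i. func (u (t' i))" "\<lambda>i. func (U i)"] that
    by (simp add: R_def v_def[abs_def])
  have weak: "(L2_operator \<alpha> t' v k - R k) \<bullet> func p = - (G k \<bullet> grad p)" if k: "k \<in> {1..n}" and p: "p \<in> H10 \<Omega>" for k p
  proof -
    have "L2_operator \<alpha> t' (\<lambda>i. func (U i)) k = L2_operator \<alpha> t (\<lambda>i. func (U i)) k"
      using k t' by (intro L2_operator_cong) auto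
    then have "eq_laplacian_plus \<Omega> (L2_operator \<alpha> t' (\<lambda>i. func (U i)) k) (U k) (f (t' k))"
      using scheme k n t'[of k] by (simp add: L2_scheme_solution_def)
    from eq_laplacian_plus_difference[OF I(2)[OF k] this p] show ?thesis
      using Lv[OF k] k by (simp add: G_def)
  qed
  have eq: "(L2_operator \<alpha> t' v k - R k) \<bullet> M.incr v k = - (G k \<bullet> (G k - G (k - 1)))" if k: "k \<in> {1..n}" for k
  proof (cases "k = 1")
    case True
    show ?thesis using weak[OF k uH[OF k]] weak[OF k UH[OF k]] v0 True
      by (simp add: M.incr_def G_def v_def inner_diff_right)
  next
    case False
    then have k1: "k - 1 \<in> {1..n}" "k \<noteq> 0" "k - 1 \<noteq> 0" using k by auto
    show ?thesis
      using weak[OF k uH[OF k]] weak[OF k UH[OF k]] weak[OF k uH[OF k1(1)]] weak[OF k UH[OF k1(1)]] k1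
      by (simp add: M.incr_def G_def v_def inner_diff_right)
  qed
  define F where "F k = A * M.consistency (if k = 1 then 2 else k)" for k
  have bound: "\<bar>?g * (R k \<bullet> M.incr v k)\<bar> \<le> F k * norm (M.incr v k)" if k: "k \<in> {1..n}" for k
  proof -
    let ?w = "M.incr v k"
    have vk: "vanishes_outside \<Omega> (v j)" if "j \<le> n" for j
    proof (cases "j = 0")
      case True
      then show ?thesis by (simp add: v0 vanishes_outside_0)
    next
      case False
      then have "j \<in> {1..n}" using that by simp
      then show ?thesis unfolding v_def
        by (intro vanishes_outside_diff H10_vanishes_outside uH UH)
    qed
    have w: "vanishes_outside \<Omega> ?w"
      unfolding M.incr_def using k by (intro vanishes_outside_diff vk) auto
    define g where "g l s = func (Dt {0<..T} l u s) \<bullet> ?w" for l s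
    define m where "m = sqrt (measure lborel \<Omega>)"
    interpret S: scalar_curve t' \<alpha> "\<lambda>s. func (u s) \<bullet> ?w" "\<lambda>s. if s = 0 then 0 else g 1 s" "g 2" "g 3" T
      "\<bar>C1\<bar> * m * norm ?w" "\<bar>C3\<bar> * m * norm ?w"
      unfolding g_def m_def
      by (rule solution_component_scalar_curve[OF M.subdiffusion_mesh_axioms \<Omega> w sol b1 b3])
    have m0: "0 \<le> m" by (simp add: m_def)
    have Ik: "((\<lambda>s. M.ker k s * (if s = 0 then 0 else g 1 s)) has_integral (I k \<bullet> ?w)) {0..t' k}"
      unfolding M.ker_def
    proof (rule caputo_integral_inner[of 3 T u])
      show "Ck_curve 3 {0<..T} u" using sol by (simp add: subdiffusion_solution_def)
      show "(if s = 0 then 0 else g 1 s) = func (Dt {0<..T} 1 u s) \<bullet> ?w" if "0 < s" for s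
        using that by (simp add: g_def)
    qed (use tT[OF k] I(1)[OF k] in simp_all)
    have "L2_operator \<alpha> t' S.nodal k = L2_operator \<alpha> t' (\<lambda>i. func (u (t' i))) k \<bullet> ?w"
      using M.L2_operator_linear[of k "\<lambda>x. x \<bullet> ?w" "\<lambda>i. func (u (t' i))"] k
      by (simp add: S.nodal_def[abs_def] bounded_linear.linear[OF bounded_linear_inner_left])
    then have Rk: "?g * (R k \<bullet> ?w) = ?g * L2_operator \<alpha> t' S.nodal k - I k \<bullet> ?w"
      using gpos by (simp add: R_def inner_diff_left right_diff_distrib)
    have A': "2000 / (\<alpha> * (1 - \<alpha>)) * (\<bar>C1\<bar> * m * norm ?w + \<bar>C3\<bar> * m * norm ?w) = A * norm ?w"
      unfolding A_def m_def by (simp only: distrib_left distrib_right mult.assoc)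
    show ?thesis
    proof (cases "k = 1")
      case True
      have "\<bar>?g * (R k \<bullet> ?w)\<bar> \<le> 6 / (\<alpha> * (1 - \<alpha>)) * (\<bar>C1\<bar> * m * norm ?w) * (step t' 1 powr (-\<alpha>) * M.start)"
        unfolding Rk using S.truncation_error_bound_first_step[of "I k \<bullet> ?w"] Ik tT[OF k] True by simp
      also have "\<dots> \<le> 6 / (\<alpha> * (1 - \<alpha>)) * (\<bar>C1\<bar> * m * norm ?w) * (88 * M.consistency 2)"
        using M.first_step_absorbed(1) \<alpha> m0 by (intro mult_left_mono) auto
      also have "\<dots> = 528 / (\<alpha> * (1 - \<alpha>)) * (\<bar>C1\<bar> * m * norm ?w) * M.consistency 2" by simp
      also have "\<dots> \<le> 2000 / (\<alpha> * (1 - \<alpha>)) * (\<bar>C1\<bar> * m * norm ?w + \<bar>C3\<bar> * m * norm ?w) * M.consistency 2"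
        using \<alpha> m0 M.consistency_nonneg[of 2]
        by (intro mult_right_mono mult_mono divide_right_mono) auto
      also have "\<dots> = F k * norm ?w" unfolding A' F_def using True by simp
      finally show ?thesis .
    next
      case False
      then have "2 \<le> k" using k by simp
      from S.truncation_error_bound[OF this Ik tT(2)[OF k]]
      show ?thesis unfolding Rk A' F_def using False by (simp add: mult_ac)
    qed
  qed
  have "(norm (G n))\<^sup>2 \<le> 20 / ?g * (\<Sum>k=1..n. step t' k powr \<alpha> * (F k)\<^sup>2)"
    by (rule M.energy_estimate[OF eq _ bound]) (simp_all add: G_def)
  also have "\<dots> \<le> 20 / ?g * (16 / 5 * A\<^sup>2 * (\<Sum>k=2..n. step t' k powr \<alpha> * (M.consistency k)\<^sup>2))"
  proof (rule mult_left_mono)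
    let ?S = "\<Sum>k=2..n. step t' k powr \<alpha> * (M.consistency k)\<^sup>2"
    have "{1..n} = insert 1 {2..n}" using n by auto
    then have "(\<Sum>k=1..n. step t' k powr \<alpha> * (F k)\<^sup>2)
        = step t' 1 powr \<alpha> * (F 1)\<^sup>2 + (\<Sum>k=2..n. step t' k powr \<alpha> * (F k)\<^sup>2)" by simp
    also have "(\<Sum>k=2..n. step t' k powr \<alpha> * (F k)\<^sup>2) = A\<^sup>2 * ?S"
      unfolding sum_distrib_left by (intro sum.cong refl) (auto simp: F_def power_mult_distrib)
    also have "step t' 1 powr \<alpha> * (F 1)\<^sup>2 = A\<^sup>2 * (step t' 1 powr \<alpha> * (M.consistency 2)\<^sup>2)"
      by (simp add: F_def power_mult_distrib)
    also have "\<dots> \<le> A\<^sup>2 * (11 / 5 * step t' 2 powr \<alpha> * (M.consistency 2)\<^sup>2)"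
      using M.first_step_absorbed(2) by (intro mult_left_mono mult_right_mono) auto
    also have "\<dots> = 11 / 5 * A\<^sup>2 * (step t' 2 powr \<alpha> * (M.consistency 2)\<^sup>2)" by simp
    also have "\<dots> \<le> 11 / 5 * A\<^sup>2 * ?S"
      using n by (intro mult_left_mono member_le_sum[where f = "\<lambda>k. step t' k powr \<alpha> * (M.consistency k)\<^sup>2"]) auto
    finally show "(\<Sum>k=1..n. step t' k powr \<alpha> * (F k)\<^sup>2) \<le> 16 / 5 * A\<^sup>2 * ?S" by simp
  qed (use gpos in simp)
  also have "\<dots> = 64 * A\<^sup>2 / ?g * (\<Sum>k=2..n. step t' k powr \<alpha> * (M.consistency k)\<^sup>2)"
    by simp
  also have "(\<Sum>k=2..n. step t' k powr \<alpha> * (M.consistency k)\<^sup>2) = (\<Sum>k=2..n. ?T k)"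
  proof (rule sum.cong[OF refl])
    fix k assume k: "k \<in> {2..n}"
    have prev: "t' (k - 1) = t (k - 1)" using k by (intro t') auto
    have s: "step t' j = step t j" if "j \<le> n" for j using that by (simp add: step_def t')
    have "(\<Sum>j=2..k-1. step t' j ^ 4 * (1 + t' (j - 1) powr (\<alpha> - 3)) * (t' k - t' j) powr (-\<alpha> - 1))
        = (\<Sum>j=2..k-1. step t j ^ 4 * (1 + t (j - 1) powr (\<alpha> - 3)) * (t k - t j) powr (-\<alpha> - 1))"
      using k by (intro sum.cong refl) (auto simp: s t')
    then show "step t' k powr \<alpha> * (M.consistency k)\<^sup>2 = ?T k"
      unfolding M.consistency_def M.middle_def using k n prev by (simp add: s t')
  qed
  finally show ?thesis using n by (simp add: G_def t')
qed

theorem theorem5p2: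
  fixes \<Omega> :: "'a::euclidean_space set" and \<alpha> C1 C3 :: real
  assumes "0 < \<alpha>" and "\<alpha> < 1" and "bounded_lipschitz_domain \<Omega>"
  shows "\<exists>C>0. \<forall>(T::real) (u0 :: ('a, real) l2) (f :: real \<Rightarrow> 'a \<Rightarrow> real) (u :: real \<Rightarrow> 'a sobolev)
      (N::nat) (t :: nat \<Rightarrow> real) (U :: nat \<Rightarrow> 'a sobolev) (n::nat).
    0 < T \<longrightarrow>
    subdiffusion_solution \<alpha> T \<Omega> f u0 u \<longrightarrow>
    (\<forall>s\<in>{0<..T}. ae_bounded \<Omega> (func (Dt {0<..T} 1 u s)) (C1 * (1 + s powr (\<alpha> - 1)))) \<longrightarrow>
    (\<forall>s\<in>{0<..T}. ae_bounded \<Omega> (func (Dt {0<..T} 3 u s)) (C3 * (1 + s powr (\<alpha> - 3)))) \<longrightarrow>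
    time_mesh T N t \<longrightarrow>
    (\<forall>k\<in>{2..N}. step t k / step t (k - 1) \<in> {rho_L..rho_R}) \<longrightarrow>
    L2_scheme_solution \<alpha> \<Omega> f t N u0 U \<longrightarrow>
    2 \<le> n \<longrightarrow> n \<le> N \<longrightarrow>
    (norm (grad (u (t n)) - grad (U n)))\<^sup>2
      \<le> C * (\<Sum>k=2..n. step t k powr \<alpha> *
          (step t 1 powr \<alpha> * (t k - t 1) powr (-\<alpha>)
           + (\<Sum>j=2..k-1. step t j ^ 4 * (1 + t (j - 1) powr (\<alpha> - 3)) * (t k - t j) powr (-\<alpha> - 1))
           + step t k powr (3 - \<alpha>) * (1 + t (k - 1) powr (\<alpha> - 3)))\<^sup>2)"
  proof -
  let ?A = "2000 / (\<alpha> * (1 - \<alpha>)) * ((\<bar>C1\<bar> + \<bar>C3\<bar>) * sqrt (measure lborel \<Omega>))"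
  have \<Omega>: "open \<Omega>" "bounded \<Omega>" using assms(3) by (auto simp: bounded_lipschitz_domain_def)
  have g: "0 < Gamma (1 - \<alpha>)" using assms(2) by (intro Gamma_real_pos) simp
  show ?thesis
  proof (intro exI conjI allI impI)
    \<comment> \<open>The summand one makes the constant positive when \<open>C1\<close> and \<open>C3\<close> vanish.\<close>
    show "0 < 64 * ?A\<^sup>2 / Gamma (1 - \<alpha>) + 1" using g by (intro add_nonneg_pos divide_nonneg_pos) auto
  next
    fix T u0 f u N t U n
    assume "0 < T" "subdiffusion_solution \<alpha> T \<Omega> f u0 u"
      "\<forall>s\<in>{0<..T}. ae_bounded \<Omega> (func (Dt {0<..T} 1 u s)) (C1 * (1 + s powr (\<alpha> - 1)))"
      "\<forall>s\<in>{0<..T}. ae_bounded \<Omega> (func (Dt {0<..T} 3 u s)) (C3 * (1 + s powr (\<alpha> - 3)))"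
      "time_mesh T N t" "\<forall>k\<in>{2..N}. step t k / step t (k - 1) \<in> {rho_L..rho_R}"
      "L2_scheme_solution \<alpha> \<Omega> f t N u0 U" "2 \<le> n" "n \<le> N"
    note bound = L2_scheme_error[OF assms(1,2) \<Omega> this]
    show "(norm (grad (u (t n)) - grad (U n)))\<^sup>2 \<le> (64 * ?A\<^sup>2 / Gamma (1 - \<alpha>) + 1) * (\<Sum>k=2..n. step t k powr \<alpha> *
          (step t 1 powr \<alpha> * (t k - t 1) powr (-\<alpha>)
           + (\<Sum>j=2..k-1. step t j ^ 4 * (1 + t (j - 1) powr (\<alpha> - 3)) * (t k - t j) powr (-\<alpha> - 1))
           + step t k powr (3 - \<alpha>) * (1 + t (k - 1) powr (\<alpha> - 3)))\<^sup>2)" (is "_ \<le> _ * ?S")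
    proof -
      have "0 \<le> ?S" by (intro sum_nonneg mult_nonneg_nonneg) auto
      with bound show ?thesis by (simp add: distrib_right)
    qed
  qed
qed

end
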